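(* The POD-reduced model $$\tfrac{\rm d}{{\rm d}t}E\,x_{\rm POD}=A(x_{\rm POD})\,x_{\rm POD}+B\,u,\quad x_{\rm POD}(0)=x_{\rm POD,0},\qquad y_{\rm POD}=C\,x_{\rm POD},$$ with state $x_{\rm POD}\in\mathbb{R}^{r+m}$, input $u$, output $y_{\rm POD}$ and the matrices $E$, $A(\cdot)$, $B$, $C$ obtained by POD projection of the semidiscretized magneto-quasistatic system as defined in the context, is passive.
   Context: All spaces are real; $\|\cdot\|$ is the Euclidean norm. Domain and data. $\Omega\subset\mathbb{R}^3$ is a simply connected bounded Lipschitz domain, decomposed into a conducting subdomain $\Omega_C$ (connected, $\overline{\Omega}_C\subset\Omega$) and a non-conducting subdomain $\Omega_I=\Omega\setminus\overline{\Omega}_C$; $\Omega_I$ has finitely many connected internal subdomains with single boundary components and an external subdomain $\Omega_{I,\rm ext}$ with two boundary components $\overline{\Omega}_{I,\rm ext}\cap\overline{\Omega}_C$ and $\partial\Omega$. The conductivity is $\sigma=\sigma_C\mathbb{1}_{\Omega_C}$ with $\sigma_C>0$. The reluctivity is $\nu(\xi,\zeta)=\nu_C(\zeta)\mathbb{1}_{\Omega_C}(\xi)+\nu_I\mathbb{1}_{\Omega_I}(\xi)$, where $\nu_I>0$ and $\nu_C:\mathbb{R}_{\ge0}\to\mathbb{R}_{\ge0}$ is measurable, and $\zeta\mapsto\nu_C(\zeta)\zeta$ is strongly monotone with constant $m_{\nu_C}>0$ and Lipschitz continuous with constant $L_{\nu_C}>0$. The resistance matrix $R\in\mathbb{R}^{m\times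 m}$ is symmetric positive definite. The winding function $\chi=[\chi_1,\ldots,\chi_m]$ has columns $\chi_j\in L^2(\Omega;\mathbb{R}^3)$ with $\nabla\cdot\chi_j=0$ and pairwise disjoint supports; $\gamma_j$ are functions with components in $H^1(\Omega)$ and $\chi_j=\nabla\times\gamma_j$. FEM matrices. $\varphi_1^e,\ldots,\varphi_{n_e}^e\in H_0(\mathrm{curl},\Omega)$ are the edge (Nédélec, first type) basis functions and $\varphi_1^f,\ldots,\varphi_{n_f}^f$ the face basis functions of a regular simplicial triangulation of $\Omega$. $C_d\in\mathbb{R}^{n_f\times n_e}$ is the discrete curl matrix, with $(C_d)_{kj}=\pm1$ if edge $j$ belongs to face $k$ with the same/opposite orientation, and $0$ otherwise. For $a=[\alpha_1^e,\ldots,\alpha_{n_e}^e]^T$ put $(M_\sigma)_{kl}=\int_\Omega\sigma\,\varphi_l^e\cdot\varphi_k^e\,{\rm d}\xi$, $(K(a))_{kl}=\int_\Omega\nu(\xi,\|\nabla\times\sum_j\alpha_j^e\varphi_j^e\|)(\nabla\times\varphi_l^e)\cdot(\nabla\times\varphi_k^e)\,{\rm d}\xi$, $X_{kj}=\int_\Omega\chi_j\cdot\varphi_k^e\,{\rm d}\xi$. They factor as $K(a)=C_d^TM_\nu(C_d\,a)C_d$ and $X=C_d^T\Upsilon$, where, with $C_d\,a=[\alpha_1^f,\ldots,\alpha_{n_f}^f]^T$, $(M_\nu(C_d\,a))_{kl}=\int_\Omega\nu(\xi,\|\sum_j\alpha_j^f\varphi_j^f\|)\varphi_l^f\cdot\varphi_k^f\,{\rm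 d}\xi$ and $\Upsilon_{kj}=\int_\Omega\gamma_j\cdot\varphi_k^f\,{\rm d}\xi$; $M_\nu(C_d\,a)$ is symmetric positive definite for all $a$. Ordering the edge basis functions according to the conducting and non-conducting subdomains gives $a=[a_1^T,a_2^T]^T$ with $a_1\in\mathbb{R}^{n_1}$, $a_2\in\mathbb{R}^{n_2}$, $n_e=n_1+n_2$, $C_d=[C_1\ C_2]$, and $$M_\sigma=\begin{bmatrix}M_{11}&0\\ 0&0\end{bmatrix},\quad K(a)=\begin{bmatrix}K_{11}(a_1)&K_{12}\\ K_{21}&K_{22}\end{bmatrix},\quad X=\begin{bmatrix}X_1\\ X_2\end{bmatrix},$$ where only $K_{11}(a_1)$ depends on $a$, $K_{21}=K_{12}^T$, $M_{11}$ is symmetric positive definite, and $X_2\in\mathbb{R}^{n_2\times m}$ has full column rank. The semidiscretized system is $\tfrac{\rm d}{{\rm d}t}M_\sigma a=-K(a)a+X\boldsymbol{i}$, $\tfrac{\rm d}{{\rm d}t}X^Ta=-R\boldsymbol{i}+u$, $M_\sigma a(0)=M_\sigma a_0$, $X^Ta(0)=X^Ta_0$, with output $\boldsymbol{i}$. ODE form. Let $k_2=\dim\ker(C_2)$ and let the columns of $\hat{Y}_{C_2}\in\mathbb{R}^{n_2\times(n_2-k_2)}$ form a basis of $\mathrm{im}(C_2^T)$. Let the columns of $Y\in\mathbb{R}^{(n_2-k_2)\times(n_2-k_2-m)}$ form an orthonormal basis of $\ker(X_2^T\hat{Y}_{C_2})$, $Z=\hat{Y}_{C_2}^TX_2(X_2^T\hat{Y}_{C_2}\hat{Y}_{C_2}^TX_2)^{-1/2}$,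 $\hat{Z}=\hat{Y}_{C_2}^TX_2(X_2^T\hat{Y}_{C_2}\hat{Y}_{C_2}^TX_2)^{-1}$, $Y_2=\hat{Y}_{C_2}Y$, $Z_2=\hat{Y}_{C_2}Z$ ($Y_2^TK_{22}Y_2$ is invertible). For $x_{\rm ODE}\in\mathbb{R}^{n_1+m}$ with first $n_1$ components $a_1$ put $$\mathcal{E}_{\rm ODE}=\begin{bmatrix}M_{11}+X_1R^{-1}X_1^T&X_1R^{-1}X_2^TZ_2\\ Z_2^TX_2R^{-1}X_1^T&Z_2^TX_2R^{-1}X_2^TZ_2\end{bmatrix},\qquad \mathcal{B}_{\rm ODE}=\begin{bmatrix}X_1\\ Z_2^TX_2\end{bmatrix}R^{-1},$$ $$\mathcal{A}_{\rm ODE}(x_{\rm ODE})=-\begin{bmatrix}K_{11}(a_1)&K_{12}Z_2\\ Z_2^TK_{21}&Z_2^TK_{22}Z_2\end{bmatrix}+\begin{bmatrix}K_{12}\\ Z_2^TK_{22}\end{bmatrix}Y_2(Y_2^TK_{22}Y_2)^{-1}Y_2^T\begin{bmatrix}K_{21}&K_{22}Z_2\end{bmatrix},$$ $$\mathcal{C}_{\rm ODE}=\hat{Z}^T\hat{Y}_{C_2}^T\bigl(I-K_{22}Y_2(Y_2^TK_{22}Y_2)^{-1}Y_2^T\bigr)\begin{bmatrix}K_{21}&K_{22}Z_2\end{bmatrix}.$$ The initial vector is $x_{\rm ODE,0}=[a_{1,0}^T,(Z^Ta_{21,0})^T]^T$, where $a_{1,0}$ and $a_{21,0}$ are the conducting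 and regularized non-conducting components of $a_0$ ($a_0=[a_{1,0}^T,(\hat Y_{C_2}a_{21,0}+Y_{C_2}a_{22,0})^T]^T$, the columns of $Y_{C_2}$ forming a basis of $\ker C_2$). POD reduction. The columns of $U_{a_1}\in\mathbb{R}^{n_1\times r}$, $r\ll n_1$, form the POD basis (the $r$ leading left singular vectors) of a snapshot matrix $X_{a_1}=[a_1(t_1),\ldots,a_1(t_q)]$ of the $a_1$-component of the semidiscretized system. With $\tilde{U}=\begin{bmatrix}U_{a_1}&0\\ 0&I_m\end{bmatrix}$, $$E=\tilde{U}^T\mathcal{E}_{\rm ODE}\tilde{U},\quad A(x)=\tilde{U}^T\mathcal{A}_{\rm ODE}(\tilde{U}x)\tilde{U},\quad B=\tilde{U}^T\mathcal{B}_{\rm ODE},\quad C=\mathcal{C}_{\rm ODE}\tilde{U},\quad x_{\rm POD,0}=\tilde{U}^Tx_{\rm ODE,0}.$$ Passivity. For a control system $\tfrac{\rm d}{{\rm d}t}Ex=A(x)x+Bu$, $Ex(0)=Ex_0$, with output $y$, state space $\mathcal{X}=\mathbb{R}^n$ and input/output space $\mathbb{R}^m$, an input $u\in L^2([0,T];\mathbb{R}^m)$ is admissible with the initial condition $Ex(0)=Ex_0$ if the initial value problem has a solution $x:[0,T]\to\mathcal{X}$ such that the state equation holds in the sense of weak derivatives (in particular, $x$ is continuous) and $y\in L^2([0,T];\mathbb{R}^m)$. A function $\mathcal{S}:\mathcal{X}\to\mathbb{R}_{\ge0}\cup\{\infty\}$ is a storage function for passivity if for all $T>0$, all $x_0\in\mathcal{X}$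 with $\mathcal{S}(x_0)<\infty$ and all inputs $u\in L^2([0,T];\mathbb{R}^m)$ admissible with $Ex(0)=Ex_0$: (a) $t\mapsto\mathcal{S}(x(t))$ is continuous from $[0,T]$ to $\mathbb{R}_{\ge0}\cup\{\infty\}$; (b) for all $0\le t_0\le t_1\le T$, $\mathcal{S}(x(t_1))-\mathcal{S}(x(t_0))\le\int_{t_0}^{t_1}u(\tau)^Ty(\tau)\,{\rm d}\tau$. The system is passive if there exists a storage function for passivity. *)

theory Defs
  imports
    "HOL-Analysis.Analysis"
    "Jordan_Normal_Form.DL_Rank"
    "Jordan_Normal_Form.Matrix_Kernel"
    "Jordan_Normal_Form.Gauss_Jordan_Elimination"
begin

(* From here on $ and \<bullet> refer to vectors and matrices of Jordan_Normal_Form, whose dimensions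
   are natural numbers and may be 0; points of space are of type real^3. *)
no_notation vec_nth (infixl \<open>$\<close> 90)
unbundle no inner_syntax

type_synonym R3 = "real^3"
type_synonym rvec = "real Matrix.vec"
type_synonym rmat = "real Matrix.mat"


section \<open>Function spaces and weak derivatives\<close>

definition L2_on :: "'a::euclidean_space set \<Rightarrow> ('a \<Rightarrow> 'b::euclidean_space) \<Rightarrow> bool" where
  "L2_on S f \<longleftrightarrow> f \<in> borel_measurable (lebesgue_on S) \<and>
     integrable (lebesgue_on S) (\<lambda>x. (norm (f x))\<^sup>2)"

definition loc_integrable :: "'a::euclidean_space set \<Rightarrow> ('a \<Rightarrow> real) \<Rightarrow> bool" where
  "loc_integrable S f \<longleftrightarrow> (\<forall>K. compact K \<and> K \<subseteq> S \<longrightarrow> integrable (lebesgue_on K) f)"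

primrec Ck :: "nat \<Rightarrow> ('a::euclidean_space \<Rightarrow> real) \<Rightarrow> bool" where
  "Ck 0 f \<longleftrightarrow> continuous_on UNIV f"
| "Ck (Suc k) f \<longleftrightarrow> (\<exists>g. (\<forall>x. (f has_derivative (\<lambda>h. inner (g x) h)) (at x)) \<and>
     (\<forall>b\<in>Basis. Ck k (\<lambda>x. inner (g x) b)))"

definition test_fun :: "'a::euclidean_space set \<Rightarrow> ('a \<Rightarrow> real) \<Rightarrow> bool" where
  "test_fun S \<phi> \<longleftrightarrow> (\<forall>k. Ck k \<phi>) \<and> compact (closure {x. \<phi> x \<noteq> 0}) \<and> closure {x. \<phi> x \<noteq> 0} \<subseteq> S"

definition test_field :: "R3 set \<Rightarrow> (R3 \<Rightarrow> R3) \<Rightarrow> bool" where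
  "test_field S \<psi> \<longleftrightarrow> (\<forall>b\<in>Basis. test_fun S (\<lambda>x. inner (\<psi> x) b))"

definition weak_partial ::
  "'a::euclidean_space set \<Rightarrow> 'a \<Rightarrow> ('a \<Rightarrow> real) \<Rightarrow> ('a \<Rightarrow> real) \<Rightarrow> bool" where
  "weak_partial S b f g \<longleftrightarrow> loc_integrable S f \<and> loc_integrable S g \<and>
     (\<forall>\<phi>. test_fun S \<phi> \<longrightarrow>
       integral\<^sup>L (lebesgue_on S) (\<lambda>x. f x * frechet_derivative \<phi> (at x) b) =
       - integral\<^sup>L (lebesgue_on S) (\<lambda>x. g x * \<phi> x))"

definition H1_on :: "'a::euclidean_space set \<Rightarrow> ('a \<Rightarrow> real) \<Rightarrow> bool" where
  "H1_on S f \<longleftrightarrow> L2_on S f \<and> (\<forall>b\<in>Basis. \<exists>g. L2_on S g \<and> weak_partial S b f g)"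

(* Classical curl; for piecewise smooth fields it is meaningful away from the interfaces,
   hence almost everywhere. *)
definition curl :: "(R3 \<Rightarrow> R3) \<Rightarrow> R3 \<Rightarrow> R3" where
  "curl f x = (let d = (\<lambda>i j. vec_nth (frechet_derivative f (at x) (axis i 1)) j) in
     vector [d 2 3 - d 3 2, d 3 1 - d 1 3, d 1 2 - d 2 1])"

definition weak_curl :: "R3 set \<Rightarrow> (R3 \<Rightarrow> R3) \<Rightarrow> (R3 \<Rightarrow> R3) \<Rightarrow> bool" where
  "weak_curl S f g \<longleftrightarrow> (\<forall>\<psi>. test_field S \<psi> \<longrightarrow>
     integral\<^sup>L (lebesgue_on S) (\<lambda>x. inner (f x) (curl \<psi> x)) =
     integral\<^sup>L (lebesgue_on S) (\<lambda>x. inner (g x) (\<psi> x)))"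

definition weak_div_free :: "R3 set \<Rightarrow> (R3 \<Rightarrow> R3) \<Rightarrow> bool" where
  "weak_div_free S f \<longleftrightarrow> (\<forall>\<phi>. test_fun S \<phi> \<longrightarrow>
     integral\<^sup>L (lebesgue_on S) (\<lambda>x. frechet_derivative \<phi> (at x) (f x)) = 0)"

(* f belongs to H_0(curl, S), the closure of the test fields in the graph norm, and g is its
   (weak) curl. *)
definition H0_curl :: "R3 set \<Rightarrow> (R3 \<Rightarrow> R3) \<Rightarrow> (R3 \<Rightarrow> R3) \<Rightarrow> bool" where
  "H0_curl S f g \<longleftrightarrow> L2_on S f \<and> L2_on S g \<and>
     (\<exists>\<psi> :: nat \<Rightarrow> R3 \<Rightarrow> R3. (\<forall>n. test_field S (\<psi> n)) \<and>
        (\<lambda>n. integral\<^sup>L (lebesgue_on S) (\<lambda>x. (norm (\<psi> n x - f x))\<^sup>2)) \<longlonglongrightarrow> 0 \<and>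
        (\<lambda>n. integral\<^sup>L (lebesgue_on S) (\<lambda>x. (norm (curl (\<psi> n) x - g x))\<^sup>2)) \<longlonglongrightarrow> 0)"

definition ess_support :: "R3 set \<Rightarrow> (R3 \<Rightarrow> R3) \<Rightarrow> R3 set" where
  "ess_support S f = {x. \<forall>e>0. \<not> (AE y in lebesgue_on (S \<inter> ball x e). f y = 0)}"

(* Up to a rigid motion the domain is locally the region below the graph of a Lipschitz function. *)
definition lipschitz_domain :: "R3 set \<Rightarrow> bool" where
  "lipschitz_domain S \<longleftrightarrow> open S \<and> connected S \<and> S \<noteq> {} \<and>
     (\<forall>p\<in>frontier S. \<exists>(Q :: R3 \<Rightarrow> R3) (g :: real^2 \<Rightarrow> real) r h L.
        orthogonal_transformation Q \<and> 0 < r \<and> 0 < h \<and> L-lipschitz_on UNIV g \<and>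
        (\<forall>z. norm z < r \<longrightarrow> \<bar>g z\<bar> < h) \<and>
        (\<forall>z s. norm z < r \<and> \<bar>s\<bar> < h \<longrightarrow>
           (p + Q (vector [vec_nth z 1, vec_nth z 2, s]) \<in> S \<longleftrightarrow> s < g z)))"


section \<open>Matrices\<close>

definition spd :: "nat \<Rightarrow> rmat \<Rightarrow> bool" where
  "spd n A \<longleftrightarrow> A \<in> carrier_mat n n \<and> A\<^sup>T = A \<and>
     (\<forall>v\<in>carrier_vec n. v \<noteq> 0\<^sub>v n \<longrightarrow> v \<bullet> (A *\<^sub>v v) > 0)"

abbreviation minv :: "rmat \<Rightarrow> rmat" where
  "minv A \<equiv> the (mat_inverse A)"

(* N is the symmetric positive definite matrix G^(-1/2). *)
definition inv_sqrt_mat :: "nat \<Rightarrow> rmat \<Rightarrow> rmat \<Rightarrow> bool" where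
  "inv_sqrt_mat n G N \<longleftrightarrow> spd n N \<and> N * N = minv G"

definition append_cols :: "rmat \<Rightarrow> rmat \<Rightarrow> rmat" (infixr \<open>@\<^sub>c\<close> 65) where
  "A @\<^sub>c B = four_block_mat A B (0\<^sub>m 0 (dim_col A)) (0\<^sub>m 0 (dim_col B))"

definition cols_basis :: "nat \<Rightarrow> rmat \<Rightarrow> rvec set \<Rightarrow> bool" where
  "cols_basis n A W \<longleftrightarrow> dim_row A = n \<and> distinct (cols A) \<and>
     \<not> LinearCombinations.module.lin_dep class_ring (module_vec TYPE(real) n) (set (cols A)) \<and>
     LinearCombinations.module.span class_ring (module_vec TYPE(real) n) (set (cols A)) = W"

definition mat_image :: "rmat \<Rightarrow> rvec set" where
  "mat_image A = (\<lambda>v. A *\<^sub>v v) ` carrier_vec (dim_col A)"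

(* U consists of the first r columns of the orthogonal factor W in a singular value decomposition
   M = W S V^T with non-increasing singular values. *)
definition leading_left_singular :: "nat \<Rightarrow> rmat \<Rightarrow> rmat \<Rightarrow> bool" where
  "leading_left_singular r M U \<longleftrightarrow> (let n = dim_row M; q = dim_col M in r \<le> n \<and>
     (\<exists>W S V. W \<in> carrier_mat n n \<and> S \<in> carrier_mat n q \<and> V \<in> carrier_mat q q \<and>
        W\<^sup>T * W = 1\<^sub>m n \<and> V\<^sup>T * V = 1\<^sub>m q \<and> M = W * S * V\<^sup>T \<and>
        diagonal_mat S \<and> (\<forall>i < min n q. 0 \<le> S $$ (i, i)) \<and>
        (\<forall>i j. i \<le> j \<and> j < min n q \<longrightarrow> S $$ (j, j) \<le> S $$ (i, i)) \<and>
        U = Matrix.mat n r (\<lambda>(i, j). W $$ (i, j))))"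


section \<open>Control systems and passivity\<close>

definition L2_vec :: "nat \<Rightarrow> real \<Rightarrow> (real \<Rightarrow> rvec) \<Rightarrow> bool" where
  "L2_vec n T f \<longleftrightarrow> (\<forall>t\<in>{0..T}. f t \<in> carrier_vec n) \<and> (\<forall>k<n. L2_on {0..T} (\<lambda>t. f t $ k))"

definition continuous_vec :: "nat \<Rightarrow> real \<Rightarrow> (real \<Rightarrow> rvec) \<Rightarrow> bool" where
  "continuous_vec n T f \<longleftrightarrow> (\<forall>t\<in>{0..T}. f t \<in> carrier_vec n) \<and>
     (\<forall>k<n. continuous_on {0..T} (\<lambda>t. f t $ k))"

definition weak_deriv_vec :: "nat \<Rightarrow> real \<Rightarrow> (real \<Rightarrow> rvec) \<Rightarrow> (real \<Rightarrow> rvec) \<Rightarrow> bool" where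
  "weak_deriv_vec n T f g \<longleftrightarrow> (\<forall>k<n. weak_partial {0<..<T} 1 (\<lambda>t. f t $ k) (\<lambda>t. g t $ k))"

(* d/dt (E x) = A(x) x + B u,  E x(0) = E x0,  y = C x *)
record control_system =
  state_dim :: nat
  io_dim :: nat
  sys_E :: rmat
  sys_A :: "rvec \<Rightarrow> rmat"
  sys_B :: rmat
  sys_C :: rmat
  sys_x0 :: rvec

definition is_solution ::
  "control_system \<Rightarrow> real \<Rightarrow> rvec \<Rightarrow> (real \<Rightarrow> rvec) \<Rightarrow> (real \<Rightarrow> rvec) \<Rightarrow> bool" where
  "is_solution \<Sigma> T x0 u x \<longleftrightarrow>
     continuous_vec (state_dim \<Sigma>) T x \<and>
     weak_deriv_vec (dim_row (sys_E \<Sigma>)) T (\<lambda>t. sys_E \<Sigma> *\<^sub>v x t)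
       (\<lambda>t. sys_A \<Sigma> (x t) *\<^sub>v x t + sys_B \<Sigma> *\<^sub>v u t) \<and>
     sys_E \<Sigma> *\<^sub>v x 0 = sys_E \<Sigma> *\<^sub>v x0 \<and>
     L2_vec (io_dim \<Sigma>) T (\<lambda>t. sys_C \<Sigma> *\<^sub>v x t)"

(* An input is admissible if it has a solution; (a) and (b) are required of every solution.
   As \<infinity> - \<infinity> = \<infinity> in ereal, (b) also says that the storage is finite along all trajectories
   considered. *)
definition storage_function :: "control_system \<Rightarrow> (rvec \<Rightarrow> ennreal) \<Rightarrow> bool" where
  "storage_function \<Sigma> S \<longleftrightarrow>
     (\<forall>T>0. \<forall>x0\<in>carrier_vec (state_dim \<Sigma>). S x0 < \<infinity> \<longrightarrow>
        (\<forall>u x. L2_vec (io_dim \<Sigma>) T u \<and> is_solution \<Sigma> T x0 u x \<longrightarrow>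
           continuous_on {0..T} (\<lambda>t. S (x t)) \<and>
           (\<forall>t0 t1. 0 \<le> t0 \<and> t0 \<le> t1 \<and> t1 \<le> T \<longrightarrow>
              enn2ereal (S (x t1)) - enn2ereal (S (x t0)) \<le>
              ereal (integral\<^sup>L (lebesgue_on {t0..t1}) (\<lambda>\<tau>. u \<tau> \<bullet> (sys_C \<Sigma> *\<^sub>v x \<tau>))))))"

(* Storage functions are understood to be proper: S = \<infinity> satisfies (a) and (b) vacuously, and with
   it every system would be passive.  The initial value is quantified in storage_function, so
   sys_x0 plays no role here. *)
definition is_passive :: "control_system \<Rightarrow> bool" where
  "is_passive \<Sigma> \<longleftrightarrow> (\<exists>S. storage_function \<Sigma> S \<and> (\<exists>x\<in>carrier_vec (state_dim \<Sigma>). S x < \<infinity>))"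


section \<open>Magneto-quasistatic problem\<close>

record mqs =
  Om :: "R3 set"
  OmC :: "R3 set"
  sigC :: real
  nuC :: "real \<Rightarrow> real"
  nuI :: real
  ports :: nat
  Rmat :: rmat
  chi :: "nat \<Rightarrow> R3 \<Rightarrow> R3"
  gam :: "nat \<Rightarrow> R3 \<Rightarrow> R3"
  mesh :: "R3 set set"                (* tetrahedra *)
  edges :: "(R3 \<times> R3) list"           (* oriented interior edges *)
  faces :: "(R3 \<times> R3 \<times> R3) list"      (* oriented faces *)
  n1 :: nat                           (* number of edges of the conducting subdomain *)

definition OmI :: "mqs \<Rightarrow> R3 set" where
  "OmI P = Om P - closure (OmC P)"

definition mqs_domain :: "mqs \<Rightarrow> bool" where
  "mqs_domain P \<longleftrightarrow>
     lipschitz_domain (Om P) \<and> bounded (Om P) \<and> simply_connected (Om P) \<and>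
     open (OmC P) \<and> connected (OmC P) \<and> OmC P \<noteq> {} \<and> closure (OmC P) \<subseteq> Om P \<and>
     finite (components (OmI P)) \<and>
     (\<exists>Ext\<in>components (OmI P).
        components (frontier Ext) = {closure Ext \<inter> closure (OmC P), frontier (Om P)} \<and>
        (\<forall>D\<in>components (OmI P) - {Ext}. closure D \<subseteq> Om P \<and> connected (frontier D)))"

definition mqs_material :: "mqs \<Rightarrow> bool" where
  "mqs_material P \<longleftrightarrow>
     sigC P > 0 \<and> nuI P > 0 \<and>
     nuC P \<in> borel_measurable (restrict_space borel {0..}) \<and> (\<forall>s\<ge>0. nuC P s \<ge> 0) \<and>
     (\<exists>mm>0. \<forall>s\<ge>0. \<forall>t\<ge>0. (nuC P s * s - nuC P t * t) * (s - t) \<ge> mm * (s - t)\<^sup>2) \<and>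
     (\<exists>L>0. L-lipschitz_on {0..} (\<lambda>s. nuC P s * s)) \<and>
     spd (ports P) (Rmat P)"

definition mqs_winding :: "mqs \<Rightarrow> bool" where
  "mqs_winding P \<longleftrightarrow>
     (\<forall>j<ports P. L2_on (Om P) (chi P j) \<and> weak_div_free (Om P) (chi P j) \<and>
        (\<forall>b\<in>Basis. H1_on (Om P) (\<lambda>x. inner (gam P j x) b)) \<and>
        weak_curl (Om P) (gam P j) (chi P j)) \<and>
     (\<forall>i<ports P. \<forall>j<ports P. i \<noteq> j \<longrightarrow>
        ess_support (Om P) (chi P i) \<inter> ess_support (Om P) (chi P j) = {})"

definition sig :: "mqs \<Rightarrow> R3 \<Rightarrow> real" where
  "sig P \<xi> = sigC P * indicat_real (OmC P) \<xi>"

definition nu :: "mqs \<Rightarrow> R3 \<Rightarrow> real \<Rightarrow> real" where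
  "nu P \<xi> \<zeta> = nuC P \<zeta> * indicat_real (OmC P) \<xi> + nuI P * indicat_real (OmI P) \<xi>"


section \<open>Finite elements\<close>

definition verts :: "R3 set \<Rightarrow> R3 set" where
  "verts T = {v. v extreme_point_of T}"

(* Gradient and value of the barycentric coordinate of the tetrahedron T at its vertex v, i.e. of
   the affine function that is 1 at v and 0 at the other vertices. *)
definition bary_grad :: "R3 set \<Rightarrow> R3 \<Rightarrow> R3" where
  "bary_grad T v = (THE g. \<forall>w\<in>verts T - {v}. inner g (v - w) = 1)"

definition bary :: "R3 set \<Rightarrow> R3 \<Rightarrow> R3 \<Rightarrow> real" where
  "bary T v x = 1 + inner (bary_grad T v) (x - v)"

(* Lowest order Nedelec function of the first type for the edge from v to w; its tangential integral
   along that edge is 1.  It is set to 0 on the (null) set of element boundaries. *)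
fun edge_fun :: "R3 set set \<Rightarrow> R3 \<times> R3 \<Rightarrow> R3 \<Rightarrow> R3" where
  "edge_fun M (v, w) x = (\<Sum>T | T \<in> M \<and> v \<in> verts T \<and> w \<in> verts T.
     indicat_real (interior T) x *\<^sub>R
       (bary T v x *\<^sub>R bary_grad T w - bary T w x *\<^sub>R bary_grad T v))"

abbreviation ne :: "mqs \<Rightarrow> nat" where "ne P \<equiv> length (edges P)"
abbreviation nf :: "mqs \<Rightarrow> nat" where "nf P \<equiv> length (faces P)"
abbreviation n2 :: "mqs \<Rightarrow> nat" where "n2 P \<equiv> ne P - n1 P"

abbreviation phi :: "mqs \<Rightarrow> nat \<Rightarrow> R3 \<Rightarrow> R3" where
  "phi P j \<equiv> edge_fun (mesh P) (edges P ! j)"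

(* The mesh resolves OmC; the weak curl of an edge function is its elementwise curl.  Edges on the
   boundary carry no degree of freedom.  Every interior edge and every face is listed once,
   with some orientation; the edges of tetrahedra in the conducting subdomain come first. *)
definition mqs_fem :: "mqs \<Rightarrow> bool" where
  "mqs_fem P \<longleftrightarrow>
     triangulation (mesh P) \<and> (\<forall>T\<in>mesh P. 3 simplex T) \<and>
     \<Union>(mesh P) = closure (Om P) \<and>
     \<Union>{T \<in> mesh P. T \<subseteq> closure (OmC P)} = closure (OmC P) \<and>
     bij_betw (\<lambda>j. case edges P ! j of (v, w) \<Rightarrow> {v, w}) {..<ne P}
       {e. card e = 2 \<and> (\<exists>T\<in>mesh P. e \<subseteq> verts T) \<and> \<not> convex hull e \<subseteq> frontier (Om P)} \<and>
     bij_betw (\<lambda>k. case faces P ! k of (p, q, s) \<Rightarrow> {p, q, s}) {..<nf P}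
       {F. card F = 3 \<and> (\<exists>T\<in>mesh P. F \<subseteq> verts T)} \<and>
     n1 P \<le> ne P \<and>
     (\<forall>j<ne P. j < n1 P \<longleftrightarrow> (\<exists>T\<in>mesh P. T \<subseteq> closure (OmC P) \<and>
        fst (edges P ! j) \<in> verts T \<and> snd (edges P ! j) \<in> verts T)) \<and>
     (\<forall>j<ne P. H0_curl (Om P) (phi P j) (curl (phi P j)))"

fun incidence :: "R3 \<times> R3 \<times> R3 \<Rightarrow> R3 \<times> R3 \<Rightarrow> real" where
  "incidence (p, q, s) (v, w) =
     (if (v, w) \<in> {(p, q), (q, s), (s, p)} then 1
      else if (w, v) \<in> {(p, q), (q, s), (s, p)} then -1 else 0)"

definition Cd :: "mqs \<Rightarrow> rmat" where
  "Cd P = Matrix.mat (nf P) (ne P) (\<lambda>(k, j). incidence (faces P ! k) (edges P ! j))"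

definition Msig :: "mqs \<Rightarrow> rmat" where
  "Msig P = Matrix.mat (ne P) (ne P) (\<lambda>(k, l).
     integral\<^sup>L (lebesgue_on (Om P)) (\<lambda>\<xi>. sig P \<xi> * inner (phi P l \<xi>) (phi P k \<xi>)))"

definition Kmat :: "mqs \<Rightarrow> rvec \<Rightarrow> rmat" where
  "Kmat P a = Matrix.mat (ne P) (ne P) (\<lambda>(k, l).
     integral\<^sup>L (lebesgue_on (Om P)) (\<lambda>\<xi>.
       nu P \<xi> (norm (curl (\<lambda>x. \<Sum>j<ne P. (a $ j) *\<^sub>R phi P j x) \<xi>)) *
       inner (curl (phi P l) \<xi>) (curl (phi P k) \<xi>)))"

definition Xmat :: "mqs \<Rightarrow> rmat" where
  "Xmat P = Matrix.mat (ne P) (ports P) (\<lambda>(k, j).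
     integral\<^sup>L (lebesgue_on (Om P)) (\<lambda>\<xi>. inner (chi P j \<xi>) (phi P k \<xi>)))"

(* Blocks for the splitting of the edges into conducting and non-conducting ones.  Of the blocks of
   K(a) only the first depends on a, and it depends on a1 only; the missing components of a are
   filled with 0. *)
definition C2 :: "mqs \<Rightarrow> rmat" where
  "C2 P = Matrix.mat (nf P) (n2 P) (\<lambda>(k, j). Cd P $$ (k, n1 P + j))"

definition M11 :: "mqs \<Rightarrow> rmat" where
  "M11 P = Matrix.mat (n1 P) (n1 P) (\<lambda>(k, l). Msig P $$ (k, l))"

definition K11 :: "mqs \<Rightarrow> rvec \<Rightarrow> rmat" where
  "K11 P a1 = Matrix.mat (n1 P) (n1 P) (\<lambda>(k, l). Kmat P (a1 @\<^sub>v 0\<^sub>v (n2 P)) $$ (k, l))"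

definition K12 :: "mqs \<Rightarrow> rmat" where
  "K12 P = Matrix.mat (n1 P) (n2 P) (\<lambda>(k, l). Kmat P (0\<^sub>v (ne P)) $$ (k, n1 P + l))"

definition K21 :: "mqs \<Rightarrow> rmat" where
  "K21 P = Matrix.mat (n2 P) (n1 P) (\<lambda>(k, l). Kmat P (0\<^sub>v (ne P)) $$ (n1 P + k, l))"

definition K22 :: "mqs \<Rightarrow> rmat" where
  "K22 P = Matrix.mat (n2 P) (n2 P) (\<lambda>(k, l). Kmat P (0\<^sub>v (ne P)) $$ (n1 P + k, n1 P + l))"

definition X1 :: "mqs \<Rightarrow> rmat" where
  "X1 P = Matrix.mat (n1 P) (ports P) (\<lambda>(k, j). Xmat P $$ (k, j))"

definition X2 :: "mqs \<Rightarrow> rmat" where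
  "X2 P = Matrix.mat (n2 P) (ports P) (\<lambda>(k, j). Xmat P $$ (n1 P + k, j))"

(* d/dt M_sigma a = -K(a) a + X i,  d/dt X^T a = -R i + u.  The components of a are only L^2 in
   time, since its part in ker C_2 is arbitrary; M_sigma a and X^T a are continuous. *)
definition semidiscrete_solution ::
  "mqs \<Rightarrow> rvec \<Rightarrow> real \<Rightarrow> (real \<Rightarrow> rvec) \<Rightarrow> (real \<Rightarrow> rvec) \<Rightarrow> (real \<Rightarrow> rvec) \<Rightarrow> bool" where
  "semidiscrete_solution P a0 T u a i \<longleftrightarrow>
     L2_vec (ports P) T u \<and> L2_vec (ne P) T a \<and> L2_vec (ports P) T i \<and>
     continuous_vec (ne P) T (\<lambda>t. Msig P *\<^sub>v a t) \<and>
     continuous_vec (ports P) T (\<lambda>t. (Xmat P)\<^sup>T *\<^sub>v a t) \<and>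
     weak_deriv_vec (ne P) T (\<lambda>t. Msig P *\<^sub>v a t)
       (\<lambda>t. - (Kmat P (a t) *\<^sub>v a t) + Xmat P *\<^sub>v i t) \<and>
     weak_deriv_vec (ports P) T (\<lambda>t. (Xmat P)\<^sup>T *\<^sub>v a t) (\<lambda>t. - (Rmat P *\<^sub>v i t) + u t) \<and>
     Msig P *\<^sub>v a 0 = Msig P *\<^sub>v a0 \<and> (Xmat P)\<^sup>T *\<^sub>v a 0 = (Xmat P)\<^sup>T *\<^sub>v a0"

definition snapshot_matrix :: "mqs \<Rightarrow> (real \<Rightarrow> rvec) \<Rightarrow> real list \<Rightarrow> rmat" where
  "snapshot_matrix P a ts = Matrix.mat (n1 P) (length ts) (\<lambda>(i, j). a (ts ! j) $ i)"


section \<open>Regularised and reduced models\<close>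

(* In this section Yh stands for the basis matrix of im (C_2^T), Y for that of ker (X_2^T Yh), and
   N for (X_2^T Yh Yh^T X_2)^(-1/2). *)

definition gram :: "mqs \<Rightarrow> rmat \<Rightarrow> rmat" where
  "gram P Yh = (X2 P)\<^sup>T * Yh * Yh\<^sup>T * X2 P"

definition Zmat :: "mqs \<Rightarrow> rmat \<Rightarrow> rmat \<Rightarrow> rmat" where
  "Zmat P Yh N = Yh\<^sup>T * X2 P * N"

definition Zhat :: "mqs \<Rightarrow> rmat \<Rightarrow> rmat" where
  "Zhat P Yh = Yh\<^sup>T * X2 P * minv (gram P Yh)"

definition Z2 :: "mqs \<Rightarrow> rmat \<Rightarrow> rmat \<Rightarrow> rmat" where
  "Z2 P Yh N = Yh * Zmat P Yh N"

definition Y2proj :: "mqs \<Rightarrow> rmat \<Rightarrow> rmat \<Rightarrow> rmat" where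
  "Y2proj P Yh Y = (let Y2 = Yh * Y in Y2 * minv (Y2\<^sup>T * K22 P * Y2) * Y2\<^sup>T)"

definition E_ode :: "mqs \<Rightarrow> rmat \<Rightarrow> rmat \<Rightarrow> rmat" where
  "E_ode P Yh N = (let Z2 = Z2 P Yh N; Ri = minv (Rmat P) in
     four_block_mat
       (M11 P + X1 P * Ri * (X1 P)\<^sup>T)         (X1 P * Ri * (X2 P)\<^sup>T * Z2)
       (Z2\<^sup>T * X2 P * Ri * (X1 P)\<^sup>T)           (Z2\<^sup>T * X2 P * Ri * (X2 P)\<^sup>T * Z2))"

definition B_ode :: "mqs \<Rightarrow> rmat \<Rightarrow> rmat \<Rightarrow> rmat" where
  "B_ode P Yh N = (X1 P @\<^sub>r ((Z2 P Yh N)\<^sup>T * X2 P)) * minv (Rmat P)"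

definition A_ode :: "mqs \<Rightarrow> rmat \<Rightarrow> rmat \<Rightarrow> rmat \<Rightarrow> rvec \<Rightarrow> rmat" where
  "A_ode P Yh Y N x = (let Z2 = Z2 P Yh N in
     - four_block_mat (K11 P (vec_first x (n1 P))) (K12 P * Z2)
                      (Z2\<^sup>T * K21 P)                (Z2\<^sup>T * K22 P * Z2)
     + (K12 P @\<^sub>r (Z2\<^sup>T * K22 P)) * Y2proj P Yh Y * (K21 P @\<^sub>c (K22 P * Z2)))"

definition C_ode :: "mqs \<Rightarrow> rmat \<Rightarrow> rmat \<Rightarrow> rmat \<Rightarrow> rmat" where
  "C_ode P Yh Y N = (Zhat P Yh)\<^sup>T * Yh\<^sup>T * (1\<^sub>m (n2 P) - K22 P * Y2proj P Yh Y) *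
     (K21 P @\<^sub>c (K22 P * Z2 P Yh N))"

definition x0_ode :: "mqs \<Rightarrow> rmat \<Rightarrow> rmat \<Rightarrow> rvec \<Rightarrow> rvec \<Rightarrow> rvec" where
  "x0_ode P Yh N a10 a21 = a10 @\<^sub>v ((Zmat P Yh N)\<^sup>T *\<^sub>v a21)"

definition Ut :: "mqs \<Rightarrow> rmat \<Rightarrow> rmat" where
  "Ut P U = four_block_mat U (0\<^sub>m (n1 P) (ports P)) (0\<^sub>m (ports P) (dim_col U)) (1\<^sub>m (ports P))"

definition pod_model :: "mqs \<Rightarrow> rmat \<Rightarrow> rmat \<Rightarrow> rmat \<Rightarrow> rmat \<Rightarrow> rvec \<Rightarrow> rvec \<Rightarrow> control_system" where
  "pod_model P Yh Y N U a10 a21 = (let V = Ut P U in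
     \<lparr> state_dim = dim_col U + ports P,
       io_dim = ports P,
       sys_E = V\<^sup>T * E_ode P Yh N * V,
       sys_A = (\<lambda>x. V\<^sup>T * A_ode P Yh Y N (V *\<^sub>v x) * V),
       sys_B = V\<^sup>T * B_ode P Yh N,
       sys_C = C_ode P Yh Y N * V,
       sys_x0 = V\<^sup>T *\<^sub>v x0_ode P Yh N a10 a21 \<rparr>)"

end

theory Submission
  imports Defs
begin

text \<open>
  The reduced model is passive because its storage is the magnetic energy.  Let \<open>W(a)\<close> be the energy
  of the field with edge coefficients \<open>a\<close>, with density \<open>\<integral>\<^sub>0\<^sup>s \<nu>\<^sub>C(t) t dt\<close> in the conductor and \<open>\<nu>\<^sub>I s\<^sup>2 / 2\<close> in
  the insulator, where \<open>s\<close> is the modulus of the curl.  Monotonicity of \<open>\<nu>\<^sub>C(t) t\<close> makes \<open>W\<close> convex, and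
  its gradient is \<open>K(a) a\<close>.  A reduced state \<open>x\<close> lifts linearly to edge coefficients \<open>L x\<close>, in which the
  components along \<open>Y\<^sub>2\<close> are determined by the requirement that they carry no force.  The Schur
  complement in \<open>A\<close> therefore turns \<open>- A(x) x\<close> into the gradient of \<open>x \<mapsto> W(L x)\<close>.  Let
  \<open>w = X\<^sub>1\<^sup>T a\<^sub>1' + X\<^sub>2\<^sup>T Z\<^sub>2 z'\<close> be the flux derivative along a solution.  The last \<open>m\<close> state equations,
  which the POD projection leaves alone, say that \<open>y = R\<^sup>-\<^sup>1 (u - w)\<close>, and testing the state equation with
  \<open>x'\<close> gives
  \<open>u\<^sup>T y - d/dt W(L x) = (u - w)\<^sup>T R\<^sup>-\<^sup>1 (u - w) + a\<^sub>1'\<^sup>T M\<^sub>1\<^sub>1 a\<^sub>1' \<ge> 0\<close>.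
  This is the content of \<open>pod_model_passive\<close>.

  Solutions are differentiable in the weak sense only.  Since \<open>E\<close> is invertible, a solution is an
  antiderivative of its weak derivative (\<open>weak_partial_FTC\<close>), and convexity replaces the chain rule:
  \<open>W(L x(t)) - W(L x(s)) \<le> - A(x(t)) x(t) \<cdot> (x(t) - x(s))\<close>, which is summed over fine partitions.
  The result is \<open>passive_of_convex_storage\<close>, a criterion for passivity of general systems.

  It remains to show that the inverses in the model exist.  On a tetrahedron the curl of an edge
  function is a constant, and by Stokes' theorem its fluxes through the faces are incidence numbers.
  Hence \<open>C\<^sub>2 v = 0\<close> if and only if the field with non-conducting coefficients \<open>v\<close> is curl-free almost
  everywhere (\<open>Cd_zero_iff\<close>).  So \<open>K\<^sub>2\<^sub>2\<close> is positive definite on the image of \<open>C\<^sub>2\<^sup>T\<close> (\<open>stiffness_spd\<close>).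
  Integration by parts shows that \<open>X\<^sub>2\<^sup>T v = 0\<close> for \<open>v\<close> in the kernel of \<open>C\<^sub>2\<close> (\<open>X2_kernel\<close>), which together with the rank
  of \<open>X\<^sub>2\<close> makes the Gram matrix positive definite (\<open>gram_spd\<close>).  The mass matrix \<open>M\<^sub>1\<^sub>1\<close> is positive
  definite since the coefficient of an edge function is the tangential integral of the field along
  its edge (\<open>M11_spd\<close>).  Because non-conducting edge functions vanish in the conductor, only the first
  block of \<open>K(a)\<close> depends on \<open>a\<close>.
\<close>

section \<open>Smooth step functions on the real line\<close>

lemma Ck_real_Suc:
  fixes f :: "real \<Rightarrow> real"
  shows "Ck (Suc k) f \<longleftrightarrow> (\<exists>g. (\<forall>x. (f has_real_derivative g x) (at x)) \<and> Ck k g)"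
  by (simp add: has_field_derivative_def)

lemma Ck_const: "Ck k (\<lambda>x::real. c)"
proof (induction k arbitrary: c)
  case (Suc k)
  then show ?case unfolding Ck_real_Suc by (intro exI[of _ "\<lambda>x. 0"]) auto
qed simp

lemma Ck_Suc_imp_Ck: "Ck (Suc k) f \<Longrightarrow> Ck k (f :: real \<Rightarrow> real)"
proof (induction k arbitrary: f)
  case 0
  then show ?case unfolding Ck_real_Suc
    by (auto intro!: continuous_at_imp_continuous_on dest: DERIV_isCont)
next
  case (Suc k)
  then show ?case by (subst (asm) Ck_real_Suc, subst Ck_real_Suc) blast
qed

lemma Ck_add: "Ck k f \<Longrightarrow> Ck k g \<Longrightarrow> Ck k (\<lambda>x::real. f x + g x)"
proof (induction k arbitrary: f g)
  case (Suc k)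
  then obtain f' g' where "\<forall>x. (f has_real_derivative f' x) (at x)" "Ck k f'"
    "\<forall>x. (g has_real_derivative g' x) (at x)" "Ck k g'"
    unfolding Ck_real_Suc by auto
  then show ?case unfolding Ck_real_Suc
    by (intro exI[of _ "\<lambda>x. f' x + g' x"]) (auto intro!: DERIV_add Suc.IH)
qed (auto intro!: continuous_intros)

lemma Ck_mult: "Ck k f \<Longrightarrow> Ck k g \<Longrightarrow> Ck k (\<lambda>x::real. f x * g x)"
proof (induction k arbitrary: f g)
  case (Suc k)
  then obtain f' g' where f: "\<forall>x. (f has_real_derivative f' x) (at x)" "Ck k f'"
    and g: "\<forall>x. (g has_real_derivative g' x) (at x)" "Ck k g'"
    unfolding Ck_real_Suc by auto
  have "Ck k (\<lambda>x. f' x * g x + g' x * f x)"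
    using Suc f g by (auto intro!: Ck_add Suc.IH dest: Ck_Suc_imp_Ck simp del: Ck.simps)
  then show ?case unfolding Ck_real_Suc
    by (intro exI[of _ "\<lambda>x. f' x * g x + g' x * f x"]) (auto intro!: DERIV_mult' f(1) g(1) DERIV_mult simp: f g)
qed (auto intro!: continuous_intros)

lemma Ck_affine: "Ck k f \<Longrightarrow> Ck k (\<lambda>x::real. f (c * x + d))"
proof (induction k arbitrary: f)
  case 0
  then show ?case by (auto intro!: continuous_intros continuous_on_compose2[of UNIV f])
next
  case (Suc k)
  then obtain f' where f: "\<forall>x. (f has_real_derivative f' x) (at x)" "Ck k f'"
    unfolding Ck_real_Suc by auto
  have "((\<lambda>x. f (c * x + d)) has_real_derivative f' (c * x + d) * c) (at x)" for x
    by (rule DERIV_chain2[where f=f]) (use f in \<open>auto intro!: derivative_eq_intros\<close>)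
  moreover have "Ck k (\<lambda>x. f' (c * x + d) * c)"
    by (intro Ck_mult Ck_const Suc.IH f)
  ultimately show ?case unfolding Ck_real_Suc
    by (intro exI[of _ "\<lambda>x. f' (c * x + d) * c"]) simp
qed

text \<open>The functions \<open>p(1/x) exp(-1/x)\<close>, continued by \<open>0\<close>, are closed under differentiation; this is
  what makes \<open>exp(-1/x)\<close> smooth at \<open>0\<close>.\<close>

definition flat :: "real poly \<Rightarrow> real \<Rightarrow> real" where
  "flat p x = (if x > 0 then poly p (1 / x) * exp (- 1 / x) else 0)"

lemma poly_times_exp_tendsto_0: "((\<lambda>y::real. poly p y * exp (- y)) \<longlongrightarrow> 0) at_top"
proof -
  have "((\<lambda>y. \<Sum>i\<le>degree p. coeff p i * (y ^ i / exp y)) \<longlongrightarrow> (\<Sum>i\<le>degree p. coeff p i * 0)) at_top"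
    by (intro tendsto_intros tendsto_power_div_exp_0)
  then show ?thesis
    by (simp add: poly_altdef sum_distrib_right exp_minus divide_inverse mult.assoc)
qed

lemma flat_tendsto_0: "(flat p \<longlongrightarrow> 0) (at 0)"
proof -
  have r: "((\<lambda>x. poly p (1/x) * exp (- (1/x))) \<longlongrightarrow> 0) (at_right 0)"
    using filterlim_compose[OF poly_times_exp_tendsto_0 filterlim_inverse_at_top_right, of p]
    by (simp add: inverse_eq_divide)
  have "(flat p \<longlongrightarrow> 0) (at_right 0)"
    by (rule Lim_transform_eventually[OF r])
       (auto simp: flat_def eventually_at_right_field intro!: exI[of _ 1])
  moreover have "(flat p \<longlongrightarrow> 0) (at_left 0)"
    by (rule Lim_transform_eventually[OF tendsto_const])
       (auto simp: flat_def eventually_at_left_field intro!: exI[of _ "-1"])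
  ultimately show ?thesis
    by (simp add: filterlim_split_at)
qed

lemma flat_has_derivative:
  "(flat p has_real_derivative flat ([:0, 0, 1:] * (p - pderiv p)) x) (at x)"
proof -
  consider "x > 0" | "x < 0" | "x = 0" by linarith
  then show ?thesis
  proof cases
    case 1
    have "((\<lambda>x. poly p (1 / x) * exp (- 1 / x)) has_real_derivative
        flat ([:0, 0, 1:] * (p - pderiv p)) x) (at x)"
      using 1 by (auto intro!: derivative_eq_intros DERIV_chain2[OF poly_DERIV]
        simp: flat_def field_simps power2_eq_square)
    moreover have "\<forall>\<^sub>F y in nhds x. flat p y = poly p (1 / y) * exp (- 1 / y)"
      using eventually_nhds_in_open[of "{0<..}" x] 1
      by (auto elim!: eventually_mono simp: flat_def)
    ultimately show ?thesis by (subst DERIV_cong_ev[OF refl _ refl]) auto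
  next
    case 2
    have "\<forall>\<^sub>F y in nhds x. flat p y = 0"
      using eventually_nhds_in_open[of "{..<0}" x] 2
      by (auto elim!: eventually_mono simp: flat_def)
    with 2 show ?thesis
      by (subst DERIV_cong_ev[where g = "\<lambda>_. 0", OF refl _ refl]) (auto simp: flat_def)
  next
    case 3
    have "flat ([:0,1:] * p) = (\<lambda>h. flat p h / h)"
      by (auto simp: flat_def field_simps)
    with flat_tendsto_0[of "[:0,1:] * p"] have "((\<lambda>h. flat p h / h) \<longlongrightarrow> 0) (at 0)" by simp
    moreover have "flat q 0 = 0" for q by (simp add: flat_def)
    ultimately show ?thesis
      using 3 by (simp add: DERIV_def)
  qed
qed

lemma Ck_flat: "Ck k (flat p)"
proof (induction k arbitrary: p)
  case 0
  show ?case using flat_has_derivative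
    by (auto intro!: continuous_at_imp_continuous_on DERIV_isCont)
next
  case (Suc k)
  then show ?case unfolding Ck_real_Suc using flat_has_derivative by blast
qed

text \<open>Normalised antiderivative of the bump \<open>exp(-1/x) exp(-1/(1-x))\<close>.  Differences of rescaled
  steps serve as test functions that approximate indicator functions of intervals.\<close>

lemma smooth_step_exists:
  obtains S S' :: "real \<Rightarrow> real" where "\<And>k. Ck k S" "\<And>x. (S has_real_derivative S' x) (at x)"
    "continuous_on UNIV S'" "\<And>x. 0 \<le> S' x" "\<And>x. x \<le> 0 \<or> 1 \<le> x \<Longrightarrow> S' x = 0"
    "\<And>x. x \<le> 0 \<Longrightarrow> S x = 0" "\<And>x. 1 \<le> x \<Longrightarrow> S x = 1" "\<And>x. 0 \<le> S x" "\<And>x. S x \<le> 1"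
proof -
  define b where "b x = flat 1 x * flat 1 (1 - x)" for x :: real
  have Ckb: "Ck k b" for k
    using Ck_mult[OF Ck_flat Ck_affine[OF Ck_flat], of k 1 1 "-1" 1]
    by (simp add: b_def[abs_def])
  have contb: "continuous_on UNIV b" using Ckb[of 0] by simp
  have b0: "0 \<le> b x" for x by (auto simp: b_def flat_def)
  have bpos: "0 < b x" if "0 < x" "x < 1" for x using that by (auto simp: b_def flat_def)
  have boff: "b x = 0" if "x \<le> 0 \<or> 1 \<le> x" for x using that by (auto simp: b_def flat_def)
  obtain F where F: "\<And>x. (F has_real_derivative b x) (at x)"
  proof -
    have "continuous (at x) b" for x
      using contb by (simp add: continuous_on_eq_continuous_at)
    then obtain F where "\<forall>x. (F has_vector_derivative b x) (at x)"
      using einterval_antiderivative[of "-\<infinity>" "\<infinity>" b] by auto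
    then show ?thesis using that by (auto simp: has_real_derivative_iff_has_vector_derivative)
  qed
  have mono: "F x \<le> F y" if "x \<le> y" for x y
    using DERIV_nonneg_imp_nondecreasing[OF that] F b0 by blast
  have lt: "F 0 < F 1"
    by (rule DERIV_pos_imp_increasing_open)
       (use F bpos in \<open>auto intro!: continuous_at_imp_continuous_on DERIV_isCont\<close>)
  have const: "F x = F y" if "x \<le> y" "y \<le> 0 \<or> 1 \<le> x" for x y
  proof (cases "x = y")
    case False
    with that have "x < y" by simp
    moreover have "(F has_real_derivative 0) (at z)" if "x < z" "z < y" for z
      using F[of z] boff[of z] that \<open>y \<le> 0 \<or> 1 \<le> x\<close> by auto
    ultimately show ?thesis
      using DERIV_isconst_end[of x y F] F by (metis DERIV_isCont continuous_at_imp_continuous_on)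
  qed simp
  define S where "S x = (F x - F 0) / (F 1 - F 0)" for x
  define S' where "S' x = b x / (F 1 - F 0)" for x
  have der: "(S has_real_derivative S' x) (at x)" for x
    unfolding S_def S'_def using F lt by (auto intro!: derivative_eq_intros)
  have CkS': "Ck k S'" for k
    using Ck_mult[OF Ckb Ck_const, of k "1 / (F 1 - F 0)"] by (simp add: S'_def[abs_def])
  have S0: "S x = 0" if "x \<le> 0" for x using const[of x 0] that by (simp add: S_def)
  have S1: "S x = 1" if "1 \<le> x" for x using const[of 1 x] that lt by (simp add: S_def)
  have S: "0 \<le> S x \<and> S x \<le> 1" for x
  proof -
    consider "x \<le> 0" | "1 \<le> x" | "0 \<le> x" "x \<le> 1" by linarith
    then show ?thesis
    proof cases
      case 3
      with mono[of 0 x] mono[of x 1] lt show ?thesis by (simp add: S_def divide_le_eq)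
    qed (simp_all add: S0 S1)
  qed
  have CkS: "Ck k S" for k
  proof (rule Ck_Suc_imp_Ck)
    show "Ck (Suc k) S" unfolding Ck_real_Suc using der CkS' by blast
  qed
  show thesis
  proof (rule that[of S S'])
    show "continuous_on UNIV S'" using CkS'[of 0] by simp
    show "0 \<le> S' x" for x using b0[of x] lt by (simp add: S'_def)
    show "S' x = 0" if "x \<le> 0 \<or> 1 \<le> x" for x using boff[OF that] by (simp add: S'_def)
  qed (use CkS der S S0 S1 in auto)
qed

section \<open>Weak derivatives of continuous functions of time\<close>

lemma integrable_lebesgue_on_subset:
  fixes f :: "'a::euclidean_space \<Rightarrow> 'b::euclidean_space"
  assumes "integrable (lebesgue_on S) f" "A \<subseteq> S" "S \<in> sets lebesgue" "A \<in> sets lebesgue"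
  shows "integrable (lebesgue_on A) f"
proof -
  have "set_integrable lebesgue S f"
    using assms by (simp add: set_integrable_def integrable_restrict_space)
  then have "set_integrable lebesgue A f" by (rule set_integrable_subset) (use assms in auto)
  then show ?thesis using assms by (simp add: set_integrable_def integrable_restrict_space)
qed

lemma test_fun_realI:
  fixes \<phi> :: "real \<Rightarrow> real"
  assumes "\<And>k. Ck k \<phi>" "0 < a" "b < T" "\<And>x. x \<notin> {a..b} \<Longrightarrow> \<phi> x = 0"
  shows "test_fun {0<..<T} \<phi>"
proof -
  have "{x. \<phi> x \<noteq> 0} \<subseteq> {a..b}" using assms(4) by force
  then have *: "closure {x. \<phi> x \<noteq> 0} \<subseteq> {a..b}" by (rule closure_minimal) simp
  then have "compact (closure {x. \<phi> x \<noteq> 0})"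
    by (intro compact_closure[THEN iffD2] bounded_subset[OF bounded_closed_interval[of a b]])
       (meson closure_subset order_trans)
  moreover have "{a..b} \<subseteq> {0<..<T}" using assms(2,3) by auto
  ultimately show ?thesis using * assms(1) unfolding test_fun_def by blast
qed

lemma weighted_average_close:
  fixes f w :: "real \<Rightarrow> real"
  assumes f: "continuous_on {a..b} f" and w: "continuous_on {a..b} w" "(w has_integral 1) {a..b}"
    and nonneg: "\<And>x. x \<in> {a..b} \<Longrightarrow> 0 \<le> w x"
    and near: "\<And>x. x \<in> {a..b} \<Longrightarrow> w x \<noteq> 0 \<Longrightarrow> \<bar>f x - c\<bar> \<le> e"
  shows "\<bar>integral {a..b} (\<lambda>x. f x * w x) - c\<bar> \<le> e"
proof -
  have i: "(\<lambda>x. f x * w x) integrable_on {a..b}" "(\<lambda>x. c * w x) integrable_on {a..b}"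
    "(\<lambda>x. e * w x) integrable_on {a..b}"
    by (intro integrable_continuous_real continuous_intros f w)+
  have c: "integral {a..b} (\<lambda>x. c * w x) = c" "integral {a..b} (\<lambda>x. e * w x) = e"
    using w(2) by (simp_all add: integral_unique)
  have "integral {a..b} (\<lambda>x. f x * w x) - c = integral {a..b} (\<lambda>x. f x * w x - c * w x)"
    using i c by (subst integral_diff) auto
  also have "norm \<dots> \<le> integral {a..b} (\<lambda>x. e * w x)"
  proof (rule integral_norm_bound_integral)
    show "norm (f x * w x - c * w x) \<le> e * w x" if "x \<in> {a..b}" for x
      using near[OF that] nonneg[OF that]
      by (cases "w x = 0") (auto simp: abs_mult left_diff_distrib[symmetric] intro!: mult_right_mono)
  qed (use i in \<open>auto intro!: integrable_diff\<close>)
  finally show ?thesis using c(2) by (simp only: real_norm_def)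
qed

text \<open>A continuous function \<open>f\<close> that has a weak derivative \<open>g\<close> is an antiderivative of \<open>g\<close>: testing with
  a smoothed indicator function of \<open>{s..t}\<close> gives, on one side, the difference of averages of \<open>f\<close> just
  to the right of \<open>s\<close> and of \<open>t\<close>, and on the other side, by dominated convergence, the integral of
  \<open>g\<close>.\<close>

lemma weak_partial_FTC_interior:
  fixes f g :: "real \<Rightarrow> real"
  assumes weak: "weak_partial {0<..<T} 1 f g" and f: "continuous_on {0..T} f"
    and g: "integrable (lebesgue_on {0..T}) g" and st: "0 < s" "s < t" "t < T"
  shows "f t - f s = integral {s..t} g"
proof -
  obtain S S' :: "real \<Rightarrow> real" where S: "\<And>k. Ck k S" "\<And>x. (S has_real_derivative S' x) (at x)"
    "continuous_on UNIV S'" "\<And>x. 0 \<le> S' x" "\<And>x. x \<le> 0 \<or> 1 \<le> x \<Longrightarrow> S' x = 0"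
    "\<And>x. x \<le> 0 \<Longrightarrow> S x = 0" "\<And>x. 1 \<le> x \<Longrightarrow> S x = 1" "\<And>x. 0 \<le> S x" "\<And>x. S x \<le> 1"
    using smooth_step_exists by metis
  define d where "d n = min (t - s) ((T - t) / 2) / real (Suc n)" for n
  have d: "0 < d n" "d n \<le> t - s" "t + d n < T" for n
  proof -
    have "min (t - s) ((T - t) / 2) / real (Suc n) \<le> min (t - s) ((T - t) / 2) / 1"
      using st by (intro divide_left_mono) auto
    then have "d n \<le> min (t - s) ((T - t) / 2)" by (simp only: d_def div_by_1)
    then have *: "d n \<le> t - s" "d n \<le> (T - t) / 2" by simp_all
    show "d n \<le> t - s" by (fact *)
    show "t + d n < T" using * st by argo
    show "0 < d n" using st by (simp add: d_def)
  qed
  have "(\<lambda>n. min (t - s) ((T - t) / 2) * (1 / real (Suc n))) \<longlonglongrightarrow> min (t - s) ((T - t) / 2) * 0"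
    by (intro tendsto_mult tendsto_const LIMSEQ_Suc[OF lim_1_over_n])
  then have d0: "d \<longlonglongrightarrow> 0" by (simp add: d_def[abs_def])
  \<comment> \<open>\<open>\<phi> n\<close> rises on \<open>{s..s + d n}\<close> and falls on \<open>{t..t + d n}\<close>; the choice of \<open>d\<close> keeps its support
    inside \<open>{0<..<T}\<close>.  The weights \<open>w n s\<close> and \<open>w n t\<close> have integral \<open>1\<close>.\<close>
  define w where "w n c x = S' ((x - c) / d n) / d n" for n c x
  define \<phi> where "\<phi> n x = S ((x - s) / d n) - S ((x - t) / d n)" for n x
  have Sd: "((\<lambda>x. S ((x - c) / d n)) has_real_derivative w n c x) (at x)" for n c x
  proof -
    have "((\<lambda>x. (x - c) / d n) has_real_derivative 1 / d n) (at x)"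
      using d(1)[of n] by (auto intro!: derivative_eq_intros)
    from DERIV_chain2[OF S(2) this] show ?thesis by (simp add: w_def)
  qed
  have contw: "continuous_on A (w n c)" for n c A
    unfolding w_def using d(1)[of n]
    by (intro continuous_intros continuous_on_compose2[OF S(3)]) auto
  have w0: "w n c x = 0" if "x \<notin> {c..c + d n}" for n c x
    using S(5)[of "(x - c) / d n"] d(1)[of n] that by (auto simp: w_def field_simps)
  have \<phi>': "(\<phi> n has_real_derivative w n s x - w n t x) (at x)" for n x
    unfolding \<phi>_def by (intro DERIV_diff Sd)
  have Ck\<phi>: "Ck k (\<phi> n)" for k n
  proof -
    have "Ck k (\<lambda>x. S ((1 / d n) * x + (- c / d n)))" for c by (rule Ck_affine[OF S(1)])
    then have *: "Ck k (\<lambda>x. S ((x - c) / d n))" for c by (simp add: diff_divide_distrib)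
    have "Ck k (\<lambda>x. S ((x - s) / d n) + (-1) * S ((x - t) / d n))"
      by (intro Ck_add Ck_mult Ck_const *)
    then show ?thesis by (simp add: \<phi>_def[abs_def])
  qed
  have test: "test_fun {0<..<T} (\<phi> n)" for n
  proof (rule test_fun_realI[OF Ck\<phi> st(1) d(3)])
    show "\<phi> n x = 0" if "x \<notin> {s..t + d n}" for x
    proof -
      from that consider "x < s" | "t + d n < x" by force
      then show ?thesis
        by cases (use st d(1,2)[of n] S(6,7) in \<open>auto simp: \<phi>_def divide_nonpos_pos le_divide_eq\<close>)
    qed
  qed
  have gT: "integrable (lebesgue_on {0<..<T}) g"
    by (rule integrable_lebesgue_on_subset[OF g]) auto
  have open_closed: "integral {0<..<T} h = integral {0..T} h" for h :: "real \<Rightarrow> real"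
    by (rule integral_open_interval_real[symmetric])
  have lhs: "integral\<^sup>L (lebesgue_on {0<..<T}) (\<lambda>x. f x * frechet_derivative (\<phi> n) (at x) 1)
      = integral {0..T} (\<lambda>x. f x * w n s x) - integral {0..T} (\<lambda>x. f x * w n t x)" for n
  proof -
    have fr: "frechet_derivative (\<phi> n) (at x) 1 = w n s x - w n t x" for x
      using frechet_derivative_at[OF \<phi>'[of n x, unfolded has_field_derivative_def]]
      by (metis mult.right_neutral)
    have c: "continuous_on {0..T} (\<lambda>x. f x * (w n s x - w n t x))"
      by (intro continuous_intros f contw)
    have "integrable (lebesgue_on {0..T}) (\<lambda>x. f x * (w n s x - w n t x))"
      by (intro absolutely_integrable_imp_integrable absolutely_integrable_continuous_real c) auto
    then have "integrable (lebesgue_on {0<..<T}) (\<lambda>x. f x * (w n s x - w n t x))"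
      by (rule integrable_lebesgue_on_subset) auto
    then have "integral\<^sup>L (lebesgue_on {0<..<T}) (\<lambda>x. f x * (w n s x - w n t x))
      = integral {0..T} (\<lambda>x. f x * (w n s x - w n t x))"
      by (subst lebesgue_integral_eq_integral) (auto simp: open_closed)
    also have "\<dots> = integral {0..T} (\<lambda>x. f x * w n s x - f x * w n t x)"
      by (simp add: right_diff_distrib)
    also have "\<dots> = integral {0..T} (\<lambda>x. f x * w n s x) - integral {0..T} (\<lambda>x. f x * w n t x)"
      by (intro integral_diff integrable_continuous_real continuous_intros f contw)
    finally show ?thesis by (simp add: fr)
  qed
  have avg: "(\<lambda>n. integral {0..T} (\<lambda>x. f x * w n c x)) \<longlonglongrightarrow> f c" if c: "c \<in> {s, t}" for c
  proof (rule LIMSEQ_I)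
    fix e :: real assume e: "0 < e"
    have cT: "0 < c" "c + d n < T" for n using c st d(3)[of n] d(2)[of n] by auto
    have "c \<in> {0..T}" using cT(1) cT(2)[of 0] d(1)[of 0] by simp
    then obtain \<delta> where \<delta>: "0 < \<delta>" "\<And>x. x \<in> {0..T} \<Longrightarrow> dist x c < \<delta> \<Longrightarrow> dist (f x) (f c) < e / 2"
      using f[unfolded continuous_on_iff] e by (metis half_gt_zero)
    obtain n0 where n0: "\<And>n. n \<ge> n0 \<Longrightarrow> d n < \<delta>"
      using d0[THEN LIMSEQ_D, of \<delta>] \<delta>(1) by fastforce
    have "\<bar>integral {0..T} (\<lambda>x. f x * w n c x) - f c\<bar> \<le> e / 2" if n: "n \<ge> n0" for n
    proof (rule weighted_average_close[OF f contw])
      have "(w n c has_integral S ((T - c) / d n) - S ((0 - c) / d n)) {0..T}"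
        by (rule fundamental_theorem_of_calculus)
           (use st has_field_derivative_at_within[OF Sd]
             in \<open>auto simp: has_real_derivative_iff_has_vector_derivative[symmetric]\<close>)
      moreover have "S ((T - c) / d n) = 1" "S ((0 - c) / d n) = 0"
        using cT(1) cT(2)[of n] d(1)[of n] by (auto intro!: S(6,7) simp: le_divide_eq divide_nonpos_pos)
      ultimately show "(w n c has_integral 1) {0..T}" by simp
      show "0 \<le> w n c x" for x using S(4) d(1)[of n] by (simp add: w_def)
      show "\<bar>f x - f c\<bar> \<le> e / 2" if "x \<in> {0..T}" "w n c x \<noteq> 0" for x
      proof -
        have "x \<in> {c..c + d n}" using w0 that by blast
        then have "dist x c < \<delta>" using n0[OF n] by (auto simp: dist_real_def)
        then show ?thesis using \<delta>(2) that by (fastforce simp: dist_real_def)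
      qed
    qed
    then show "\<exists>n0. \<forall>n\<ge>n0. norm (integral {0..T} (\<lambda>x. f x * w n c x) - f c) < e"
      using e by (intro exI[of _ n0]) fastforce
  qed
  have "(\<lambda>n. integral\<^sup>L (lebesgue_on {0<..<T}) (\<lambda>x. g x * \<phi> n x)) \<longlonglongrightarrow>
      integral\<^sup>L (lebesgue_on {0<..<T}) (\<lambda>x. indicat_real {s<..t} x *\<^sub>R g x)"
  proof (rule integral_dominated_convergence[where w = "\<lambda>x. norm (g x)"])
    have meas_\<phi>: "\<phi> n \<in> borel_measurable (lebesgue_on {0<..<T})" for n
      using Ck\<phi>[of 0 n] by (intro continuous_imp_measurable_on_sets_lebesgue) (auto intro: continuous_on_subset)
    show "(\<lambda>x. g x * \<phi> n x) \<in> borel_measurable (lebesgue_on {0<..<T})" for n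
      using meas_\<phi> gT by (intro borel_measurable_times) (auto dest: borel_measurable_integrable)
    show "(\<lambda>x. indicat_real {s<..t} x *\<^sub>R g x) \<in> borel_measurable (lebesgue_on {0<..<T})"
      using gT st by (intro borel_measurable_scaleR borel_measurable_indicator)
        (auto dest: borel_measurable_integrable simp: sets_restrict_space_iff)
    show "AE x in lebesgue_on {0<..<T}. norm (g x * \<phi> n x) \<le> norm (g x)" for n
    proof (rule AE_I2)
      fix x
      have "\<bar>\<phi> n x\<bar> \<le> 1" using S(8)[of "(x - s) / d n"] S(9)[of "(x - s) / d n"]
        S(8)[of "(x - t) / d n"] S(9)[of "(x - t) / d n"] by (simp add: \<phi>_def)
      then show "norm (g x * \<phi> n x) \<le> norm (g x)"
        by (simp add: abs_mult mult_left_le)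
    qed
    show "AE x in lebesgue_on {0<..<T}. (\<lambda>n. g x * \<phi> n x) \<longlonglongrightarrow> indicat_real {s<..t} x *\<^sub>R g x"
    proof (rule AE_I2)
      fix x
      have S_lim: "(\<lambda>n. S ((x - c) / d n)) \<longlonglongrightarrow> (if x \<le> c then 0 else 1)" for c
      proof (cases "x \<le> c")
        case True
        then have "S ((x - c) / d n) = 0" for n using d(1)[of n] by (simp add: S(6) divide_nonpos_pos)
        then show ?thesis using True by simp
      next
        case False
        then obtain n0 where n0: "\<And>n. n \<ge> n0 \<Longrightarrow> d n < x - c"
          using d0[THEN LIMSEQ_D, of "x - c"] by fastforce
        then have "S ((x - c) / d n) = 1" if "n \<ge> n0" for n
          using d(1)[of n] less_imp_le[OF n0[OF that]] by (intro S(7)) (simp add: le_divide_eq)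
        then show ?thesis using False by (intro tendsto_eventually) (auto simp: eventually_sequentially)
      qed
      have "(\<lambda>n. g x * \<phi> n x) \<longlonglongrightarrow> g x * ((if x \<le> s then 0 else 1) - (if x \<le> t then 0 else 1))"
        unfolding \<phi>_def by (intro tendsto_intros S_lim)
      also have "g x * ((if x \<le> s then 0 else 1) - (if x \<le> t then 0 else 1)) = indicat_real {s<..t} x *\<^sub>R g x"
        using st by (auto simp: indicator_def)
      finally show "(\<lambda>n. g x * \<phi> n x) \<longlonglongrightarrow> indicat_real {s<..t} x *\<^sub>R g x" .
    qed
  qed (use gT in auto)
  moreover have "integral\<^sup>L (lebesgue_on {0<..<T}) (\<lambda>x. indicat_real {s<..t} x *\<^sub>R g x) = integral {s..t} g"
  proof -
    have sub: "integrable (lebesgue_on {s<..t}) g" by (rule integrable_lebesgue_on_subset[OF g]) (use st in auto)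
    have "integral\<^sup>L (lebesgue_on {0<..<T}) (\<lambda>x. indicat_real {s<..t} x *\<^sub>R g x)
        = integral\<^sup>L (lebesgue_on {s<..t}) g"
      using st by (subst (1 2) integral_restrict_space)
        (auto intro!: Bochner_Integration.integral_cong simp: indicator_def)
    also have "\<dots> = integral {s<..t} g" by (rule lebesgue_integral_eq_integral[OF sub]) auto
    also have "\<dots> = integral {s..t} g"
    proof (rule integral_spike_set)
      show "negligible {x \<in> {s<..t} - {s..t}. g x \<noteq> 0}" by (rule negligible_subset[of "{}"]) auto
      show "negligible {x \<in> {s..t} - {s<..t}. g x \<noteq> 0}" by (rule negligible_subset[of "{s}"]) auto
    qed
    finally show ?thesis .
  qed
  ultimately have rhs: "(\<lambda>n. integral\<^sup>L (lebesgue_on {0<..<T}) (\<lambda>x. g x * \<phi> n x)) \<longlonglongrightarrow> integral {s..t} g"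
    by simp
  have "integral\<^sup>L (lebesgue_on {0<..<T}) (\<lambda>x. f x * frechet_derivative (\<phi> n) (at x) 1)
      = - integral\<^sup>L (lebesgue_on {0<..<T}) (\<lambda>x. g x * \<phi> n x)" for n
    using weak test unfolding weak_partial_def by blast
  then have "(\<lambda>n. integral {0..T} (\<lambda>x. f x * w n s x) - integral {0..T} (\<lambda>x. f x * w n t x))
      \<longlonglongrightarrow> - integral {s..t} g"
    using tendsto_minus[OF rhs] by (simp add: lhs)
  moreover have "(\<lambda>n. integral {0..T} (\<lambda>x. f x * w n s x) - integral {0..T} (\<lambda>x. f x * w n t x))
      \<longlonglongrightarrow> f s - f t"
    by (intro tendsto_diff avg) auto
  ultimately show ?thesis using LIMSEQ_unique by fastforce
qed

lemma weak_partial_FTC: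
  fixes f g :: "real \<Rightarrow> real"
  assumes weak: "weak_partial {0<..<T} 1 f g" and f: "continuous_on {0..T} f"
    and g: "integrable (lebesgue_on {0..T}) g" and st: "0 \<le> s" "s \<le> t" "t \<le> T" and T: "0 < T"
  shows "f t - f s = integral {s..t} g"
proof -
  have gi: "g integrable_on {0..T}" by (rule integrable_on_lebesgue_on[OF g]) auto
  define h where "h x = f x - integral {0..x} g" for x
  have h: "continuous_on {0..T} h"
    unfolding h_def by (intro continuous_intros f indefinite_integral_continuous_1 gi)
  have comb: "integral {0..x} g + integral {x..y} g = integral {0..y} g" if "0 \<le> x" "x \<le> y" "y \<le> T" for x y
    using that gi by (intro Henstock_Kurzweil_Integration.integral_combine) (auto intro: integrable_on_subinterval)
  have inner: "h x = h y" if "0 < x" "x < y" "y < T" for x y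
    using weak_partial_FTC_interior[OF weak f g that] comb[of x y] that by (simp add: h_def)
  have "h x = h (T / 2)" if "x \<in> {0..T}" for x
  proof (rule continuous_constant_on_closure[where S = "{0<..<T}" and f = h and a = "h (T / 2)"])
    show "continuous_on (closure {0<..<T}) h" using h T by simp
  next
    show "h y = h (T / 2)" if "y \<in> {0<..<T}" for y
    proof (cases rule: linorder_cases[of y "T / 2"])
      case less
      show ?thesis by (rule inner) (use that less T in auto)
    next
      case greater
      show ?thesis by (rule inner[symmetric]) (use that greater T in auto)
    qed (simp only:)
  qed (use that T in auto)
  from this[of s] this[of t] have "h s = h t" using st by simp
  then show ?thesis using comb[of s t] st by (simp add: h_def)
qed

section \<open>Passivity from a convex storage function\<close>

text \<open>Finitely many steps of length at most \<open>d\<close> lead from \<open>s\<close> to \<open>t\<close>.\<close>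

lemma locally_antimono_imp_le:
  fixes w :: "real \<Rightarrow> real"
  assumes "0 < d" "\<And>x y. s \<le> x \<Longrightarrow> x \<le> y \<Longrightarrow> y \<le> t \<Longrightarrow> y \<le> x + d \<Longrightarrow> w y \<le> w x" "s \<le> t"
  shows "w t \<le> w s"
proof -
  have "w (min t (s + real n * d)) \<le> w s" for n
  proof (induction n)
    case 0
    then show ?case using assms by simp
  next
    case (Suc n)
    have "w (min t (s + real (Suc n) * d)) \<le> w (min t (s + real n * d))"
      by (rule assms(2)) (use assms(1,3) in \<open>auto simp: min_def algebra_simps\<close>)
    with Suc show ?case by linarith
  qed
  moreover obtain n :: nat where "(t - s) / d \<le> real n" using real_arch_simple by blast
  then have "min t (s + real n * d) = t" using assms(1) by (auto simp: min_def field_simps)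
  ultimately show ?thesis by metis
qed

text \<open>The chain rule for a convex function along an absolutely continuous curve, as an inequality.
  On a short interval the subgradient \<open>q\<close> at the right end differs from \<open>q\<close> elsewhere by at most \<open>e\<close>,
  so the increment of \<open>w\<close> exceeds the integral of \<open>q p\<close> by at most \<open>e\<close> times the variation of the
  curve.  These local estimates add up to the same estimate on all of \<open>{s..t}\<close>, and \<open>e\<close> is arbitrary.\<close>

lemma integral_ge_of_subgradient_increments:
  fixes w :: "real \<Rightarrow> real" and p q x :: "nat \<Rightarrow> real \<Rightarrow> real"
  assumes q: "\<And>k. k < n \<Longrightarrow> continuous_on {0..T} (q k)"
    and p: "\<And>k. k < n \<Longrightarrow> p k absolutely_integrable_on {0..T}"
    and x: "\<And>k s t. k < n \<Longrightarrow> 0 \<le> s \<Longrightarrow> s \<le> t \<Longrightarrow> t \<le> T \<Longrightarrow> x k t - x k s = integral {s..t} (p k)"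
    and w: "\<And>s t. 0 \<le> s \<Longrightarrow> s \<le> t \<Longrightarrow> t \<le> T \<Longrightarrow> w t - w s \<le> (\<Sum>k<n. q k t * (x k t - x k s))"
    and st: "0 \<le> s" "s \<le> t" "t \<le> T"
  shows "w t - w s \<le> integral {s..t} (\<lambda>\<tau>. \<Sum>k<n. q k \<tau> * p k \<tau>)"
proof -
  have qp: "(\<lambda>\<tau>. q k \<tau> * p k \<tau>) absolutely_integrable_on {a..b}"
    and pi: "p k absolutely_integrable_on {a..b}" if "k < n" "0 \<le> a" "b \<le> T" for k a b
  proof -
    have "(\<lambda>\<tau>. q k \<tau> * p k \<tau>) absolutely_integrable_on {0..T}"
      by (intro absolutely_integrable_bounded_measurable_product_real
          continuous_imp_measurable_on_sets_lebesgue q p that compact_imp_bounded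
          compact_continuous_image) auto
    then show "(\<lambda>\<tau>. q k \<tau> * p k \<tau>) absolutely_integrable_on {a..b}"
      by (rule set_integrable_subset) (use that in auto)
    show "p k absolutely_integrable_on {a..b}"
      by (rule set_integrable_subset[OF p[OF that(1)]]) (use that in auto)
  qed
  note qpi = set_lebesgue_integral_eq_integral(1)[OF qp] and pii = set_lebesgue_integral_eq_integral(1)[OF pi]
  have pabs: "(\<lambda>\<tau>. \<bar>p k \<tau>\<bar>) integrable_on {a..b}" if "k < n" "0 \<le> a" "b \<le> T" for k a b
    using pi[OF that] by (simp add: absolutely_integrable_on_def)
  define G where "G a b = integral {a..b} (\<lambda>\<tau>. \<Sum>k<n. q k \<tau> * p k \<tau>)" for a b
  define M where "M a b = (\<Sum>k<n. integral {a..b} (\<lambda>\<tau>. \<bar>p k \<tau>\<bar>))" for a b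
  have G_add: "G s y = G s x' + G x' y" if "s \<le> x'" "x' \<le> y" "y \<le> T" for x' y
    unfolding G_def using that st
    by (intro Henstock_Kurzweil_Integration.integral_combine[symmetric] integrable_sum) (auto intro: qpi)
  have M_add: "M s y = M s x' + M x' y" if "s \<le> x'" "x' \<le> y" "y \<le> T" for x' y
    unfolding M_def sum.distrib[symmetric] using that st
    by (intro sum.cong refl Henstock_Kurzweil_Integration.integral_combine[symmetric]) (auto intro: pabs)
  have "w t - w s \<le> G s t + e * M s t" if e: "0 < e" for e
  proof -
    have "\<exists>d>0. \<forall>a\<in>{0..T}. \<forall>b\<in>{0..T}. dist a b < d \<longrightarrow> dist (q k a) (q k b) < e" if "k < n" for k
      using compact_uniformly_continuous[OF q[OF that]] e unfolding uniformly_continuous_on_def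
      by (metis compact_Icc)
    then obtain D where D: "\<And>k. k < n \<Longrightarrow> 0 < D k"
      "\<And>k a b. k < n \<Longrightarrow> a \<in> {0..T} \<Longrightarrow> b \<in> {0..T} \<Longrightarrow> dist a b < D k \<Longrightarrow> dist (q k a) (q k b) < e"
      by metis
    define d where "d = Min (insert 1 (D ` {..<n})) / 2"
    have d: "0 < d" "\<And>k. k < n \<Longrightarrow> d < D k"
    proof -
      have pos: "0 < Min (insert 1 (D ` {..<n}))" using D(1) by (subst Min_gr_iff) auto
      then show "0 < d" by (simp add: d_def)
      fix k assume "k < n"
      then have "Min (insert 1 (D ` {..<n})) \<le> D k" by (intro Min_le) auto
      then show "d < D k" using pos unfolding d_def by linarith
    qed
    have step: "w b - w a \<le> G a b + e * M a b" if ab: "0 \<le> a" "a \<le> b" "b \<le> T" "b \<le> a + d" for a b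
    proof -
      have "w b - w a \<le> (\<Sum>k<n. q k b * integral {a..b} (p k))"
        using w[OF ab(1-3)] x[OF _ ab(1-3)] by simp
      also have "\<dots> \<le> (\<Sum>k<n. integral {a..b} (\<lambda>\<tau>. q k \<tau> * p k \<tau>) + e * integral {a..b} (\<lambda>\<tau>. \<bar>p k \<tau>\<bar>))"
      proof (rule sum_mono)
        fix k assume "k \<in> {..<n}"
        then have k: "k < n" by simp
        note i = qpi[OF k ab(1,3)] pii[OF k ab(1,3)] pabs[OF k ab(1,3)]
        have "q k b * integral {a..b} (p k) = integral {a..b} (\<lambda>\<tau>. q k b * p k \<tau>)" by simp
        also have "\<dots> \<le> integral {a..b} (\<lambda>\<tau>. q k \<tau> * p k \<tau> + e * \<bar>p k \<tau>\<bar>)"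
        proof (rule integral_le)
          fix \<tau> assume \<tau>: "\<tau> \<in> {a..b}"
          have "dist b \<tau> < D k" using \<tau> ab d(2)[OF k] by (simp add: dist_real_def)
          then have "\<bar>q k b - q k \<tau>\<bar> \<le> e"
            using D(2)[OF k, of b \<tau>] \<tau> ab by (simp add: dist_real_def)
          then have "\<bar>(q k b - q k \<tau>) * p k \<tau>\<bar> \<le> e * \<bar>p k \<tau>\<bar>"
            unfolding abs_mult by (rule mult_right_mono) simp
          then show "q k b * p k \<tau> \<le> q k \<tau> * p k \<tau> + e * \<bar>p k \<tau>\<bar>" by (simp add: algebra_simps)
        qed (intro integrable_add integrable_on_mult_right i)+
        also have "\<dots> = integral {a..b} (\<lambda>\<tau>. q k \<tau> * p k \<tau>) + e * integral {a..b} (\<lambda>\<tau>. \<bar>p k \<tau>\<bar>)"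
          using i by (subst integral_add) (auto intro: integrable_on_mult_right)
        finally show "q k b * integral {a..b} (p k) \<le> \<dots>" .
      qed
      also have "\<dots> = G a b + e * M a b"
        unfolding G_def M_def sum.distrib sum_distrib_left[symmetric]
        using qpi[OF _ ab(1,3)] by (subst integral_sum) auto
      finally show ?thesis .
    qed
    have "w t - G s t - e * M s t \<le> w s - G s s - e * M s s"
    proof (rule locally_antimono_imp_le[OF d(1) _ st(2)])
      fix a b assume ab: "s \<le> a" "a \<le> b" "b \<le> t" "b \<le> a + d"
      then show "w b - G s b - e * M s b \<le> w a - G s a - e * M s a"
        using step[of a b] G_add[of a b] M_add[of a b] st by (simp add: algebra_simps)
    qed
    moreover have "G s s = 0" "M s s = 0" by (simp_all add: G_def M_def)
    ultimately show ?thesis by simp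
  qed
  moreover have M0: "0 \<le> M s t"
    unfolding M_def by (intro sum_nonneg integral_nonneg pabs) (use st in auto)
  ultimately have "w t - w s - G s t \<le> e" if "0 < e" for e
  proof -
    have "w t - w s \<le> G s t + e / (M s t + 1) * M s t"
      using M0 that by (intro \<open>\<And>e. 0 < e \<Longrightarrow> w t - w s \<le> G s t + e * M s t\<close>) auto
    also have "e / (M s t + 1) * M s t \<le> e" using M0 that by (simp add: field_simps)
    finally show ?thesis by simp
  qed
  then show ?thesis unfolding G_def using field_le_epsilon[of "w t - w s - G s t" 0] by (fastforce simp: G_def)
qed

lemma L2_on_imp_integrable:
  assumes "L2_on {a..b::real} (f :: real \<Rightarrow> real)"
  shows "integrable (lebesgue_on {a..b}) f"
proof (rule Bochner_Integration.integrable_bound)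
  show "integrable (lebesgue_on {a..b}) (\<lambda>x. 1 + (norm (f x))\<^sup>2)"
    using assms unfolding L2_on_def
    by (intro Bochner_Integration.integrable_add) (auto simp: lmeasurable_iff_integrable[symmetric] intro!: integrable_const_ivl)
  show "AE x in lebesgue_on {a..b}. norm (f x) \<le> norm (1 + (norm (f x))\<^sup>2)"
  proof (rule AE_I2)
    fix x
    have "0 \<le> (\<bar>f x\<bar> - 1)\<^sup>2" by simp
    then show "norm (f x) \<le> norm (1 + (norm (f x))\<^sup>2)" by (simp add: power2_eq_square algebra_simps)
  qed
qed (use assms in \<open>simp add: L2_on_def\<close>)

lemma L2_on_mult_integrable:
  fixes f g :: "'a::euclidean_space \<Rightarrow> real"
  assumes "L2_on S f" "L2_on S g"
  shows "integrable (lebesgue_on S) (\<lambda>x. f x * g x)"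
proof (rule Bochner_Integration.integrable_bound)
  show "integrable (lebesgue_on S) (\<lambda>x. (norm (f x))\<^sup>2 + (norm (g x))\<^sup>2)"
    using assms unfolding L2_on_def by (intro Bochner_Integration.integrable_add) auto
  show "AE x in lebesgue_on S. norm (f x * g x) \<le> norm ((norm (f x))\<^sup>2 + (norm (g x))\<^sup>2)"
  proof (rule AE_I2)
    fix x
    have "0 \<le> (\<bar>f x\<bar> - \<bar>g x\<bar>)\<^sup>2" by simp
    then have "2 * (\<bar>f x\<bar> * \<bar>g x\<bar>) \<le> (f x)\<^sup>2 + (g x)\<^sup>2"
      by (simp add: power2_diff mult.assoc)
    moreover have "0 \<le> \<bar>f x\<bar> * \<bar>g x\<bar>" by simp
    ultimately have "\<bar>f x\<bar> * \<bar>g x\<bar> \<le> (f x)\<^sup>2 + (g x)\<^sup>2" by linarith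
    then show "norm (f x * g x) \<le> norm ((norm (f x))\<^sup>2 + (norm (g x))\<^sup>2)"
      by (simp add: abs_mult)
  qed
qed (use assms in \<open>auto simp: L2_on_def\<close>)

lemma mult_mat_vec_nth:
  "A \<in> carrier_mat nr nc \<Longrightarrow> v \<in> carrier_vec nc \<Longrightarrow> i < nr \<Longrightarrow> (A *\<^sub>v v) $ i = (\<Sum>j<nc. A $$ (i, j) * v $ j)"
  by (auto simp: scalar_prod_def atLeast0LessThan intro!: sum.cong)

lemma scalar_prod_sum: "w \<in> carrier_vec n \<Longrightarrow> v \<bullet> w = (\<Sum>k<n. v $ k * w $ k)"
  by (auto simp: scalar_prod_def atLeast0LessThan)

text \<open>A system is passive if \<open>- A(x) x\<close> is a continuous selection of subgradients of a nonnegative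
  function \<open>W\<close> and the power balance \<open>- A(x) x \<cdot> x' \<le> u \<cdot> y\<close> holds, where \<open>x'\<close> is given by the state
  equation.\<close>

theorem passive_of_convex_storage:
  fixes \<Sigma> :: control_system and Einv :: rmat and W :: "rvec \<Rightarrow> real"
  defines "F \<equiv> \<lambda>x. sys_A \<Sigma> x *\<^sub>v x"
  assumes dim: "n = state_dim \<Sigma>" "m = io_dim \<Sigma>"
    and E: "sys_E \<Sigma> \<in> carrier_mat n n" "Einv \<in> carrier_mat n n" "Einv * sys_E \<Sigma> = 1\<^sub>m n"
    and A: "\<And>x. x \<in> carrier_vec n \<Longrightarrow> sys_A \<Sigma> x \<in> carrier_mat n n"
    and B: "sys_B \<Sigma> \<in> carrier_mat n m" and C: "sys_C \<Sigma> \<in> carrier_mat m n"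
    and nonneg: "\<And>x. x \<in> carrier_vec n \<Longrightarrow> 0 \<le> W x"
    and subgrad: "\<And>x y. x \<in> carrier_vec n \<Longrightarrow> y \<in> carrier_vec n \<Longrightarrow> W x - W y \<le> - (F x \<bullet> (x - y))"
    and cont: "\<And>T x. continuous_vec n T x \<Longrightarrow> continuous_vec n T (\<lambda>t. F (x t))"
    and diss: "\<And>x w. x \<in> carrier_vec n \<Longrightarrow> w \<in> carrier_vec m \<Longrightarrow>
        - (F x \<bullet> (Einv *\<^sub>v (F x + sys_B \<Sigma> *\<^sub>v w))) \<le> w \<bullet> (sys_C \<Sigma> *\<^sub>v x)"
  shows "is_passive \<Sigma>"
  unfolding is_passive_def
proof (intro exI[of _ "\<lambda>x. ennreal (W x)"] conjI)
  show "\<exists>x\<in>carrier_vec (state_dim \<Sigma>). ennreal (W x) < \<infinity>"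
    by (rule bexI[of _ "0\<^sub>v (state_dim \<Sigma>)"]) auto
  show "storage_function \<Sigma> (\<lambda>x. ennreal (W x))"
    unfolding storage_function_def dim[symmetric]
  proof (intro allI impI ballI, elim conjE, intro conjI allI impI; (elim conjE)?)
    fix T :: real and x0 u x
    assume T: "0 < T" and x0: "x0 \<in> carrier_vec n" and u: "L2_vec m T u" and sol: "is_solution \<Sigma> T x0 u x"
    have xcont: "continuous_vec n T x" using sol by (simp add: is_solution_def dim)
    have xc: "x t \<in> carrier_vec n" if "t \<in> {0..T}" for t using xcont that by (simp add: continuous_vec_def)
    have xk: "continuous_on {0..T} (\<lambda>t. x t $ k)" if "k < n" for k
      using xcont that by (simp add: continuous_vec_def)
    have Fk: "continuous_on {0..T} (\<lambda>t. F (x t) $ k)" if "k < n" for k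
      using cont[OF xcont] that by (simp add: continuous_vec_def)
    have Fc: "F y \<in> carrier_vec n" if "y \<in> carrier_vec n" for y
      unfolding F_def using A[OF that] that by simp
    have uc: "u t \<in> carrier_vec m" if "t \<in> {0..T}" for t using u that by (simp add: L2_vec_def)
    have uk: "L2_on {0..T} (\<lambda>t. u t $ k)" if "k < m" for k using u that by (simp add: L2_vec_def)
    define g where "g t = F (x t) + sys_B \<Sigma> *\<^sub>v u t" for t
    have gc: "g t \<in> carrier_vec n" if "t \<in> {0..T}" for t
      using Fc[OF xc[OF that]] B uc[OF that] by (simp add: g_def)
    have gi: "integrable (lebesgue_on {0..T}) (\<lambda>t. g t $ k)" if k: "k < n" for k
    proof -
      have "integrable (lebesgue_on {0..T}) (\<lambda>t. F (x t) $ k)"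
        by (intro absolutely_integrable_imp_integrable absolutely_integrable_continuous_real Fk k) auto
      moreover have "integrable (lebesgue_on {0..T}) (\<lambda>t. \<Sum>j<m. sys_B \<Sigma> $$ (k, j) * u t $ j)"
        by (intro Bochner_Integration.integrable_sum integrable_mult_right L2_on_imp_integrable uk) simp
      ultimately have "integrable (lebesgue_on {0..T}) (\<lambda>t. F (x t) $ k + (\<Sum>j<m. sys_B \<Sigma> $$ (k, j) * u t $ j))"
        by (rule Bochner_Integration.integrable_add)
      moreover have "g t $ k = F (x t) $ k + (\<Sum>j<m. sys_B \<Sigma> $$ (k, j) * u t $ j)" if "t \<in> {0..T}" for t
        using mult_mat_vec_nth[OF B uc[OF that] k] B k by (simp add: g_def)
      ultimately show ?thesis by (subst Bochner_Integration.integrable_cong[OF refl]) auto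
    qed
    define p where "p k t = (Einv *\<^sub>v g t) $ k" for k t
    have p_sum: "p k t = (\<Sum>j<n. Einv $$ (k, j) * g t $ j)" if "k < n" "t \<in> {0..T}" for k t
      unfolding p_def using mult_mat_vec_nth[OF E(2) gc] that by simp
    have pa: "p k absolutely_integrable_on {0..T}" if k: "k < n" for k
    proof -
      have "integrable (lebesgue_on {0..T}) (\<lambda>t. \<Sum>j<n. Einv $$ (k, j) * g t $ j)"
        by (intro Bochner_Integration.integrable_sum integrable_mult_right gi) simp
      then have "integrable (lebesgue_on {0..T}) (p k)"
        using p_sum[OF k] by (subst Bochner_Integration.integrable_cong[OF refl]) auto
      then show ?thesis by (simp add: integrable_restrict_space set_integrable_def)
    qed
    \<comment> \<open>Since \<open>E\<close> is invertible, the state itself is an antiderivative of \<open>E\<^sup>-\<^sup>1 g\<close>.\<close>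
    have incr: "x t $ k - x s $ k = integral {s..t} (p k)" if k: "k < n" and st: "0 \<le> s" "s \<le> t" "t \<le> T" for k s t
    proof -
      have Ek: "(sys_E \<Sigma> *\<^sub>v x t) $ j - (sys_E \<Sigma> *\<^sub>v x s) $ j = integral {s..t} (\<lambda>\<tau>. g \<tau> $ j)" if j: "j < n" for j
      proof (rule weak_partial_FTC[OF _ _ gi[OF j] st T])
        show "weak_partial {0<..<T} 1 (\<lambda>t. (sys_E \<Sigma> *\<^sub>v x t) $ j) (\<lambda>t. g t $ j)"
          using sol j E(1) unfolding is_solution_def weak_deriv_vec_def g_def F_def by simp
        have "continuous_on {0..T} (\<lambda>t. \<Sum>i<n. sys_E \<Sigma> $$ (j, i) * x t $ i)"
          by (intro continuous_intros xk) simp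
        moreover have "(sys_E \<Sigma> *\<^sub>v x t) $ j = (\<Sum>i<n. sys_E \<Sigma> $$ (j, i) * x t $ i)" if "t \<in> {0..T}" for t
          by (rule mult_mat_vec_nth[OF E(1) xc[OF that] j])
        ultimately show "continuous_on {0..T} (\<lambda>t. (sys_E \<Sigma> *\<^sub>v x t) $ j)"
          by (rule continuous_on_eq[OF _ sym])
      qed
      have inv: "x \<tau> $ k = (\<Sum>j<n. Einv $$ (k, j) * (sys_E \<Sigma> *\<^sub>v x \<tau>) $ j)" if "\<tau> \<in> {0..T}" for \<tau>
      proof -
        have "x \<tau> = (Einv * sys_E \<Sigma>) *\<^sub>v x \<tau>" using E(3) xc[OF that] by simp
        also have "\<dots> = Einv *\<^sub>v (sys_E \<Sigma> *\<^sub>v x \<tau>)"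
          by (rule assoc_mult_mat_vec[OF E(2,1) xc[OF that]])
        finally have "x \<tau> $ k = (Einv *\<^sub>v (sys_E \<Sigma> *\<^sub>v x \<tau>)) $ k" by simp
        then show ?thesis using mult_mat_vec_nth[OF E(2) _ k, of "sys_E \<Sigma> *\<^sub>v x \<tau>"] E(1) xc[OF that] by simp
      qed
      have "x t $ k - x s $ k = (\<Sum>j<n. Einv $$ (k, j) * integral {s..t} (\<lambda>\<tau>. g \<tau> $ j))"
        using st by (subst (1 2) inv) (auto simp: Ek[symmetric] right_diff_distrib sum_subtractf)
      also have "\<dots> = integral {s..t} (\<lambda>\<tau>. \<Sum>j<n. Einv $$ (k, j) * g \<tau> $ j)"
      proof (subst integral_sum)
        fix j assume "j \<in> {..<n}"
        then have "(\<lambda>\<tau>. g \<tau> $ j) integrable_on {0..T}" by (intro integrable_on_lebesgue_on[OF gi]) auto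
        then have "(\<lambda>\<tau>. g \<tau> $ j) integrable_on {s..t}" by (rule integrable_on_subinterval) (use st in auto)
        then show "(\<lambda>\<tau>. Einv $$ (k, j) * g \<tau> $ j) integrable_on {s..t}" by (rule integrable_on_mult_right)
      qed auto
      also have "\<dots> = integral {s..t} (p k)"
        using p_sum[OF k] st by (intro Henstock_Kurzweil_Integration.integral_cong) auto
      finally show ?thesis .
    qed
    have Wincr: "W (x a) - W (x b) \<le> (\<Sum>k<n. - F (x a) $ k * (x a $ k - x b $ k))"
      if "a \<in> {0..T}" "b \<in> {0..T}" for a b
    proof -
      have "F (x a) \<bullet> (x a - x b) = (\<Sum>k<n. F (x a) $ k * (x a $ k - x b $ k))"
        using xc[OF that(1)] xc[OF that(2)]
        by (subst scalar_prod_sum[of _ n]) (auto intro!: sum.cong)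
      then show ?thesis using subgrad[OF xc xc, OF that] by (simp add: sum_negf)
    qed
    \<comment> \<open>The two subgradient inequalities squeeze the storage.\<close>
    have Wcont: "continuous_on {0..T} (\<lambda>t. W (x t))"
      unfolding continuous_on_def
    proof
      fix s assume s: "s \<in> {0..T}"
      have lim: "((\<lambda>t. x t $ k) \<longlongrightarrow> x s $ k) (at s within {0..T})"
        "((\<lambda>t. F (x t) $ k) \<longlongrightarrow> F (x s) $ k) (at s within {0..T})" if "k < n" for k
        using xk[OF that] Fk[OF that] s by (auto simp: continuous_on_def)
      have "((\<lambda>t. W (x t) - W (x s)) \<longlongrightarrow> 0) (at s within {0..T})"
      proof (rule tendsto_sandwich)
        show "\<forall>\<^sub>F t in at s within {0..T}. W (x t) - W (x s) \<le> (\<Sum>k<n. - F (x t) $ k * (x t $ k - x s $ k))"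
          using Wincr s by (auto simp: eventually_at_filter)
        show "\<forall>\<^sub>F t in at s within {0..T}. - (\<Sum>k<n. - F (x s) $ k * (x s $ k - x t $ k)) \<le> W (x t) - W (x s)"
          unfolding eventually_at_filter using Wincr[OF s]
          by (intro always_eventually) (metis add.inverse_inverse minus_diff_eq neg_le_iff_le)
        have "((\<lambda>t. \<Sum>k<n. - F (x t) $ k * (x t $ k - x s $ k)) \<longlongrightarrow> (\<Sum>k<n. - F (x s) $ k * (x s $ k - x s $ k))) (at s within {0..T})"
          by (intro tendsto_intros lim) simp_all
        then show "((\<lambda>t. \<Sum>k<n. - F (x t) $ k * (x t $ k - x s $ k)) \<longlongrightarrow> 0) (at s within {0..T})" by simp
        have "((\<lambda>t. - (\<Sum>k<n. - F (x s) $ k * (x s $ k - x t $ k))) \<longlongrightarrow> - (\<Sum>k<n. - F (x s) $ k * (x s $ k - x s $ k))) (at s within {0..T})"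
          by (intro tendsto_intros lim) simp_all
        then show "((\<lambda>t. - (\<Sum>k<n. - F (x s) $ k * (x s $ k - x t $ k))) \<longlongrightarrow> 0) (at s within {0..T})" by simp
      qed
      then show "((\<lambda>t. W (x t)) \<longlongrightarrow> W (x s)) (at s within {0..T})" by (simp add: LIM_zero_iff)
    qed
    then show "continuous_on {0..T} (\<lambda>t. ennreal (W (x t)))" by (intro continuous_on_ennreal)
    fix s t :: real assume st: "0 \<le> s" "s \<le> t" "t \<le> T"
    have y: "L2_vec m T (\<lambda>t. sys_C \<Sigma> *\<^sub>v x t)" using sol by (simp add: is_solution_def dim)
    have supp_int: "integrable (lebesgue_on {s..t}) (\<lambda>\<tau>. u \<tau> \<bullet> (sys_C \<Sigma> *\<^sub>v x \<tau>))"
    proof (rule integrable_lebesgue_on_subset[of "{0..T}"])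
      have "integrable (lebesgue_on {0..T}) (\<lambda>\<tau>. \<Sum>k<m. u \<tau> $ k * (sys_C \<Sigma> *\<^sub>v x \<tau>) $ k)"
        using y uk unfolding L2_vec_def by (intro Bochner_Integration.integrable_sum L2_on_mult_integrable) auto
      moreover have "u \<tau> \<bullet> (sys_C \<Sigma> *\<^sub>v x \<tau>) = (\<Sum>k<m. u \<tau> $ k * (sys_C \<Sigma> *\<^sub>v x \<tau>) $ k)" if "\<tau> \<in> {0..T}" for \<tau>
        using y that by (intro scalar_prod_sum) (auto simp: L2_vec_def)
      ultimately show "integrable (lebesgue_on {0..T}) (\<lambda>\<tau>. u \<tau> \<bullet> (sys_C \<Sigma> *\<^sub>v x \<tau>))"
        by (subst Bochner_Integration.integrable_cong[OF refl]) auto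
    qed (use st in auto)
    have power: "(\<lambda>\<tau>. \<Sum>k<n. - F (x \<tau>) $ k * p k \<tau>) integrable_on {s..t}"
    proof (rule integrable_on_subinterval[of _ "{0..T}"])
      have "(\<lambda>\<tau>. - F (x \<tau>) $ k * p k \<tau>) absolutely_integrable_on {0..T}" if "k < n" for k
        by (intro absolutely_integrable_bounded_measurable_product_real
          continuous_imp_measurable_on_sets_lebesgue pa that compact_imp_bounded
          compact_continuous_image continuous_intros Fk) auto
      then show "(\<lambda>\<tau>. \<Sum>k<n. - F (x \<tau>) $ k * p k \<tau>) integrable_on {0..T}"
        by (intro integrable_sum) (auto intro: set_lebesgue_integral_eq_integral(1))
    qed (use st in auto)
    have "W (x t) - W (x s) \<le> integral {s..t} (\<lambda>\<tau>. \<Sum>k<n. - F (x \<tau>) $ k * p k \<tau>)"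
    proof (rule integral_ge_of_subgradient_increments[where T = T and x = "\<lambda>k t. x t $ k" and w = "\<lambda>t. W (x t)"])
      show "continuous_on {0..T} (\<lambda>t. - F (x t) $ k)" if "k < n" for k
        by (intro continuous_intros Fk that)
      show "W (x t') - W (x s') \<le> (\<Sum>k<n. - F (x t') $ k * (x t' $ k - x s' $ k))"
        if "0 \<le> s'" "s' \<le> t'" "t' \<le> T" for s' t'
        by (rule Wincr) (use that in auto)
    qed (use incr pa st in auto)
    also have "\<dots> \<le> integral {s..t} (\<lambda>\<tau>. u \<tau> \<bullet> (sys_C \<Sigma> *\<^sub>v x \<tau>))"
    proof (rule integral_le[OF power])
      show "(\<lambda>\<tau>. u \<tau> \<bullet> (sys_C \<Sigma> *\<^sub>v x \<tau>)) integrable_on {s..t}"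
        by (rule integrable_on_lebesgue_on[OF supp_int]) auto
      fix \<tau> assume "\<tau> \<in> {s..t}"
      then have \<tau>: "\<tau> \<in> {0..T}" using st by auto
      have "F (x \<tau>) \<bullet> (Einv *\<^sub>v g \<tau>) = (\<Sum>k<n. F (x \<tau>) $ k * p k \<tau>)"
        unfolding p_def using E(2) gc[OF \<tau>] by (intro scalar_prod_sum) auto
      then show "(\<Sum>k<n. - F (x \<tau>) $ k * p k \<tau>) \<le> u \<tau> \<bullet> (sys_C \<Sigma> *\<^sub>v x \<tau>)"
        using diss[OF xc uc, OF \<tau> \<tau>] by (simp add: g_def sum_negf)
    qed
    also have "\<dots> = integral\<^sup>L (lebesgue_on {s..t}) (\<lambda>\<tau>. u \<tau> \<bullet> (sys_C \<Sigma> *\<^sub>v x \<tau>))"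
      by (rule lebesgue_integral_eq_integral[OF supp_int, symmetric]) auto
    finally show "enn2ereal (ennreal (W (x t))) - enn2ereal (ennreal (W (x s)))
      \<le> ereal (integral\<^sup>L (lebesgue_on {s..t}) (\<lambda>\<tau>. u \<tau> \<bullet> (sys_C \<Sigma> *\<^sub>v x \<tau>)))"
      using nonneg[OF xc] st by (simp add: enn2ereal_ennreal)
  qed
qed

section \<open>Linear algebra of the reduced model\<close>

text \<open>Versions of the laws of matrix-vector algebra whose side conditions are equations between
  dimensions, so that rewriting can discharge them.\<close>

lemma mv_assoc: "dim_col A = dim_row B \<Longrightarrow> dim_col B = dim_vec v \<Longrightarrow> (A * B) *\<^sub>v v = (A :: rmat) *\<^sub>v (B *\<^sub>v v)"
  by (rule assoc_mult_mat_vec[of _ "dim_row A" "dim_col A" _ "dim_col B"]) auto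

lemma mv_add: "dim_vec x = dim_col A \<Longrightarrow> dim_vec y = dim_col A \<Longrightarrow> (A :: rmat) *\<^sub>v (x + y) = A *\<^sub>v x + A *\<^sub>v y"
  by (rule mult_add_distrib_mat_vec[of _ "dim_row A" "dim_col A"]) (auto intro: carrier_vecI)

lemma mv_diff: "dim_vec x = dim_col A \<Longrightarrow> dim_vec y = dim_col A \<Longrightarrow> (A :: rmat) *\<^sub>v (x - y) = A *\<^sub>v x - A *\<^sub>v y"
  by (rule mult_minus_distrib_mat_vec[of _ "dim_row A" "dim_col A"]) (auto intro: carrier_vecI)

lemma mv_uminus: "dim_vec x = dim_col A \<Longrightarrow> (A :: rmat) *\<^sub>v (- x) = - (A *\<^sub>v x)"
  by (intro eq_vecI) (auto simp: scalar_prod_uminus_right)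

lemma add_mv: "dim_row A = dim_row B \<Longrightarrow> dim_col A = dim_vec v \<Longrightarrow> dim_col B = dim_vec v \<Longrightarrow>
    (A + B) *\<^sub>v v = (A :: rmat) *\<^sub>v v + B *\<^sub>v v"
  by (rule add_mult_distrib_mat_vec[of _ "dim_row A" "dim_col A"]) auto

lemma diff_mv: "dim_row A = dim_row B \<Longrightarrow> dim_col A = dim_vec v \<Longrightarrow> dim_col B = dim_vec v \<Longrightarrow>
    (A - B) *\<^sub>v v = (A :: rmat) *\<^sub>v v - B *\<^sub>v v"
  by (rule minus_mult_distrib_mat_vec[of _ "dim_row A" "dim_col A"]) auto

lemma append_rows_mv: "dim_col A = dim_vec v \<Longrightarrow> dim_col B = dim_vec v \<Longrightarrow>
    (A @\<^sub>r B) *\<^sub>v v = ((A :: rmat) *\<^sub>v v) @\<^sub>v (B *\<^sub>v v)"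
  by (rule mat_mult_append[of _ "dim_row A" "dim_col A" _ "dim_row B"]) auto

lemma dim_append_rows [simp]: "dim_row (A @\<^sub>r B) = dim_row A + dim_row B" "dim_col (A @\<^sub>r B) = dim_col A"
  by (simp_all add: append_rows_def)

lemma dim_append_cols [simp]: "dim_row (A @\<^sub>c B) = dim_row A" "dim_col (A @\<^sub>c B) = dim_col A + dim_col B"
  by (simp_all add: append_cols_def)

lemma four_block_mv: "dim_row B = dim_row A \<Longrightarrow> dim_col A = dim_vec x \<Longrightarrow> dim_col B = dim_vec y \<Longrightarrow>
    dim_row D = dim_row C \<Longrightarrow> dim_col C = dim_vec x \<Longrightarrow> dim_col D = dim_vec y \<Longrightarrow>
    four_block_mat A B C D *\<^sub>v (x @\<^sub>v y) = ((A :: rmat) *\<^sub>v x + B *\<^sub>v y) @\<^sub>v (C *\<^sub>v x + D *\<^sub>v y)"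
  by (rule four_block_mat_mult_vec[of _ "dim_row A" "dim_col A" _ "dim_col B" _ "dim_row C"]) auto

lemma append_cols_mv: "dim_row B = dim_row A \<Longrightarrow> dim_col A = dim_vec x \<Longrightarrow> dim_col B = dim_vec y \<Longrightarrow>
    (A @\<^sub>c B) *\<^sub>v (x @\<^sub>v y) = (A :: rmat) *\<^sub>v x + B *\<^sub>v y"
  unfolding append_cols_def by (subst four_block_mv) auto

lemma transpose_mult_dim: "dim_col A = dim_row B \<Longrightarrow> (A * B)\<^sup>T = B\<^sup>T * (A :: rmat)\<^sup>T"
  by (rule transpose_mult[of _ "dim_row A" "dim_col A" _ "dim_col B"]) auto

lemma adjoint_left: "dim_vec x = dim_row A \<Longrightarrow> dim_vec y = dim_col A \<Longrightarrow> ((A :: rmat)\<^sup>T *\<^sub>v x) \<bullet> y = x \<bullet> (A *\<^sub>v y)"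
  by (rule transpose_vec_mult_scalar[of _ "dim_row A" "dim_col A"]) (auto intro: carrier_vecI)

lemma adjoint_right: "dim_vec x = dim_row A \<Longrightarrow> dim_vec y = dim_col A \<Longrightarrow> y \<bullet> ((A :: rmat)\<^sup>T *\<^sub>v x) = (A *\<^sub>v y) \<bullet> x"
  using adjoint_left[of "x" A y] by (metis carrier_dim_vec comm_scalar_prod dim_mult_mat_vec index_transpose_mat(2))

lemma sp_comm: "dim_vec x = dim_vec y \<Longrightarrow> x \<bullet> y = (y :: rvec) \<bullet> x"
  by (rule comm_scalar_prod[of _ "dim_vec y"]) (auto intro: carrier_vecI)

lemma sp_diff_left: "dim_vec x = dim_vec z \<Longrightarrow> dim_vec y = dim_vec z \<Longrightarrow> (x - y) \<bullet> z = x \<bullet> z - (y :: rvec) \<bullet> z"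
  by (rule minus_scalar_prod_distrib[of _ "dim_vec z"]) (auto intro: carrier_vecI)

lemma sp_diff_right: "dim_vec x = dim_vec z \<Longrightarrow> dim_vec y = dim_vec z \<Longrightarrow> z \<bullet> (x - y) = z \<bullet> x - (z :: rvec) \<bullet> y"
  by (rule scalar_prod_minus_distrib[of _ "dim_vec z"]) (auto intro: carrier_vecI)

lemma sp_add_left: "dim_vec x = dim_vec z \<Longrightarrow> dim_vec y = dim_vec z \<Longrightarrow> (x + y) \<bullet> z = x \<bullet> z + (y :: rvec) \<bullet> z"
  by (rule add_scalar_prod_distrib[of _ "dim_vec z"]) (auto intro: carrier_vecI)

lemma sp_append: "dim_vec x = dim_vec x' \<Longrightarrow> dim_vec y = dim_vec y' \<Longrightarrow>
    (x @\<^sub>v y) \<bullet> (x' @\<^sub>v y') = x \<bullet> x' + (y :: rvec) \<bullet> y'"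
  by (rule scalar_prod_append[of _ "dim_vec x'" _ "dim_vec y'"]) (auto intro: carrier_vecI)

lemma mv_zero [simp]: "k = dim_col A \<Longrightarrow> (A :: rmat) *\<^sub>v 0\<^sub>v k = 0\<^sub>v (dim_row A)"
  by (intro eq_vecI) auto

lemma zero_mv [simp]: "k = dim_vec v \<Longrightarrow> (0\<^sub>m l k :: rmat) *\<^sub>v v = 0\<^sub>v l"
  by (intro eq_vecI) auto

lemma one_mv [simp]: "k = dim_vec v \<Longrightarrow> (1\<^sub>m k :: rmat) *\<^sub>v v = v"
  by (rule one_mult_mat_vec) (rule carrier_vecI, rule sym)

lemma zero_sp [simp]: "k = dim_vec v \<Longrightarrow> 0\<^sub>v k \<bullet> v = (0 :: real)"
  by (rule scalar_prod_left_zero) (rule carrier_vecI, rule sym)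

lemma add_zero_vec [simp]: "k = dim_vec v \<Longrightarrow> v + 0\<^sub>v k = (v :: rvec)" "k = dim_vec v \<Longrightarrow> 0\<^sub>v k + v = (v :: rvec)"
  by (intro eq_vecI; auto)+

lemma minv_of_injective:
  assumes A: "A \<in> carrier_mat n n" and inj: "\<And>v. v \<in> carrier_vec n \<Longrightarrow> A *\<^sub>v v = 0\<^sub>v n \<Longrightarrow> v = 0\<^sub>v n"
  shows "minv A \<in> carrier_mat n n" "A * minv A = 1\<^sub>m n" "minv A * A = 1\<^sub>m n"
proof -
  have "det A \<noteq> 0" using det_0_iff_vec_prod_zero_field[OF A] inj by blast
  from det_non_zero_imp_unit[OF A this] mat_inverse(1)[OF A]
  obtain B where B: "mat_inverse A = Some B" by fastforce
  from mat_inverse(2)[OF A this] B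
  show "minv A \<in> carrier_mat n n" "A * minv A = 1\<^sub>m n" "minv A * A = 1\<^sub>m n" by auto
qed

lemma spd_injective:
  assumes "spd n A" "v \<in> carrier_vec n" "A *\<^sub>v v = 0\<^sub>v n"
  shows "v = 0\<^sub>v n"
  using assms unfolding spd_def by (metis less_irrefl scalar_prod_right_zero)

lemma spd_nonneg: "spd n A \<Longrightarrow> v \<in> carrier_vec n \<Longrightarrow> 0 \<le> v \<bullet> (A *\<^sub>v v)"
  unfolding spd_def by (cases "v = 0\<^sub>v n") (auto intro: less_imp_le)

lemma symmetric_minv:
  assumes A: "A \<in> carrier_mat n n" "A\<^sup>T = A" and B: "B \<in> carrier_mat n n" "B * A = 1\<^sub>m n"
  shows "B\<^sup>T = (B :: rmat)"
proof -
  have AB: "A * B = 1\<^sub>m n" using B(2) by (rule mat_mult_left_right_inverse[OF B(1) A(1)])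
  have "B\<^sup>T = B\<^sup>T * (A * B)" using B(1) AB by simp
  also have "\<dots> = (B\<^sup>T * A) * B" using A(1) B(1) by (intro assoc_mult_mat[symmetric]) auto
  also have "B\<^sup>T * A = (A * B)\<^sup>T" using A B(1) by (simp add: transpose_mult_dim)
  finally show ?thesis using AB B(1) by simp
qed

lemma spd_minv:
  assumes "spd n A"
  shows "minv A \<in> carrier_mat n n" "A * minv A = 1\<^sub>m n" "minv A * A = 1\<^sub>m n" "(minv A)\<^sup>T = minv A"
    "v \<in> carrier_vec n \<Longrightarrow> 0 \<le> v \<bullet> (minv A *\<^sub>v v)"
    "v \<in> carrier_vec n \<Longrightarrow> v \<bullet> (minv A *\<^sub>v v) = 0 \<Longrightarrow> v = 0\<^sub>v n"
proof -
  have A: "A \<in> carrier_mat n n" "A\<^sup>T = A" using assms by (auto simp: spd_def)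
  from minv_of_injective[OF A(1) spd_injective[OF assms]]
  show B: "minv A \<in> carrier_mat n n" "A * minv A = 1\<^sub>m n" "minv A * A = 1\<^sub>m n" by auto
  show "(minv A)\<^sup>T = minv A" by (rule symmetric_minv[OF A B(1,3)])
  assume v: "v \<in> carrier_vec n"
  define w where "w = minv A *\<^sub>v v"
  have w: "w \<in> carrier_vec n" using B v by (simp add: w_def)
  have Aw: "A *\<^sub>v w = v" unfolding w_def using A B v by (simp flip: assoc_mult_mat_vec)
  then have eq: "v \<bullet> (minv A *\<^sub>v v) = w \<bullet> (A *\<^sub>v w)"
    using v w by (simp add: w_def[symmetric] sp_comm)
  show "0 \<le> v \<bullet> (minv A *\<^sub>v v)" unfolding eq by (rule spd_nonneg[OF assms w])
  assume "v \<bullet> (minv A *\<^sub>v v) = 0"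
  then have "w = 0\<^sub>v n" using eq assms w unfolding spd_def by force
  then show "v = 0\<^sub>v n" using Aw A by auto
qed

subsection \<open>Continuity of vector-valued functions of time\<close>

lemma continuous_vecI:
  assumes "\<And>t. t \<in> {0..T} \<Longrightarrow> dim_vec (f t) = n"
    and "\<And>i. i < n \<Longrightarrow> \<exists>g. continuous_on {0..T} g \<and> (\<forall>t\<in>{0..T}. f t $ i = g t)"
  shows "continuous_vec n T f"
  unfolding continuous_vec_def
proof (intro conjI ballI allI impI)
  show "f t \<in> carrier_vec n" if "t \<in> {0..T}" for t using assms(1)[OF that] by (rule carrier_vecI)
  fix i assume "i < n"
  from assms(2)[OF this] obtain g where g: "continuous_on {0..T} g" "\<forall>t\<in>{0..T}. f t $ i = g t" by blast
  show "continuous_on {0..T} (\<lambda>t. f t $ i)"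
    by (rule continuous_on_eq[OF g(1)]) (use g(2) in simp)
qed

lemma continuous_vecD:
  assumes "continuous_vec n T f"
  shows "t \<in> {0..T} \<Longrightarrow> dim_vec (f t) = n" "i < n \<Longrightarrow> continuous_on {0..T} (\<lambda>t. f t $ i)"
proof -
  show "dim_vec (f t) = n" if "t \<in> {0..T}"
    using assms that unfolding continuous_vec_def by (blast intro: carrier_vecD)
  show "continuous_on {0..T} (\<lambda>t. f t $ i)" if "i < n"
    using assms that unfolding continuous_vec_def by blast
qed

lemma continuous_vec_mv:
  assumes "continuous_vec n T f" "A \<in> carrier_mat k n"
  shows "continuous_vec k T (\<lambda>t. A *\<^sub>v f t)"
proof (rule continuous_vecI)
  fix i assume i: "i < k"
  have "continuous_on {0..T} (\<lambda>t. \<Sum>j<n. A $$ (i, j) * f t $ j)"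
    using assms(1) by (intro continuous_intros) (simp add: continuous_vecD)
  moreover have "(A *\<^sub>v f t) $ i = (\<Sum>j<n. A $$ (i, j) * f t $ j)" if "t \<in> {0..T}" for t
    using assms(1) that by (intro mult_mat_vec_nth[OF assms(2) _ i]) (simp add: continuous_vec_def)
  ultimately show "\<exists>g. continuous_on {0..T} g \<and> (\<forall>t\<in>{0..T}. (A *\<^sub>v f t) $ i = g t)" by blast
qed (use assms(2) in simp)

lemma continuous_vec_uminus:
  assumes "continuous_vec n T f"
  shows "continuous_vec n T (\<lambda>t. - f t)"
proof (rule continuous_vecI)
  show "\<exists>h. continuous_on {0..T} h \<and> (\<forall>t\<in>{0..T}. (- f t) $ i = h t)" if i: "i < n" for i
    using continuous_vecD[OF assms] i
    by (intro exI[of _ "\<lambda>t. - f t $ i"] conjI continuous_intros) simp_all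
qed (simp add: continuous_vecD[OF assms])

lemma continuous_vec_add:
  assumes "continuous_vec n T f" "continuous_vec n T g"
  shows "continuous_vec n T (\<lambda>t. f t + g t)"
proof (rule continuous_vecI)
  show "\<exists>h. continuous_on {0..T} h \<and> (\<forall>t\<in>{0..T}. (f t + g t) $ i = h t)" if i: "i < n" for i
    using continuous_vecD[OF assms(1)] continuous_vecD[OF assms(2)] i
    by (intro exI[of _ "\<lambda>t. f t $ i + g t $ i"] conjI continuous_intros) simp_all
qed (simp add: continuous_vecD[OF assms(2)])

lemma continuous_vec_diff:
  assumes "continuous_vec n T f" "continuous_vec n T g"
  shows "continuous_vec n T (\<lambda>t. f t - g t)"
proof (rule continuous_vecI)
  show "\<exists>h. continuous_on {0..T} h \<and> (\<forall>t\<in>{0..T}. (f t - g t) $ i = h t)" if i: "i < n" for i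
    using continuous_vecD[OF assms(1)] continuous_vecD[OF assms(2)] i
    by (intro exI[of _ "\<lambda>t. f t $ i - g t $ i"] conjI continuous_intros) simp_all
qed (simp add: continuous_vecD[OF assms(2)])

lemma continuous_vec_append:
  assumes "continuous_vec n T f" "continuous_vec m T g"
  shows "continuous_vec (n + m) T (\<lambda>t. f t @\<^sub>v g t)"
proof (rule continuous_vecI)
  note d = continuous_vecD[OF assms(1)] continuous_vecD[OF assms(2)]
  fix i assume i: "i < n + m"
  show "\<exists>h. continuous_on {0..T} h \<and> (\<forall>t\<in>{0..T}. (f t @\<^sub>v g t) $ i = h t)"
  proof (cases "i < n")
    case True
    then show ?thesis using d by (intro exI[of _ "\<lambda>t. f t $ i"]) simp
  next
    case False
    then show ?thesis using d i by (intro exI[of _ "\<lambda>t. g t $ (i - n)"]) simp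
  qed
qed (simp add: continuous_vecD[OF assms(1)] continuous_vecD[OF assms(2)])

lemma continuous_vec_first: "continuous_vec (n + m) T f \<Longrightarrow> continuous_vec n T (\<lambda>t. vec_first (f t) n)"
proof (rule continuous_vecI)
  assume f: "continuous_vec (n + m) T f"
  show "\<exists>h. continuous_on {0..T} h \<and> (\<forall>t\<in>{0..T}. vec_first (f t) n $ i = h t)" if "i < n" for i
    using continuous_vecD(2)[OF f] that by (intro exI[of _ "\<lambda>t. f t $ i"]) (simp add: vec_first_def)
qed simp

lemma continuous_vec_last:
  assumes "continuous_vec (n + m) T f"
  shows "continuous_vec m T (\<lambda>t. vec_last (f t) m)"
proof (rule continuous_vecI)
  show "\<exists>h. continuous_on {0..T} h \<and> (\<forall>t\<in>{0..T}. vec_last (f t) m $ i = h t)" if "i < m" for i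
    using continuous_vecD[OF assms] that by (intro exI[of _ "\<lambda>t. f t $ (n + i)"]) (simp add: vec_last_def)
qed simp

subsection \<open>The energy balance of the reduced model\<close>

lemma continuous_vec_cong:
  assumes "continuous_vec n T f" "\<And>t. t \<in> {0..T} \<Longrightarrow> g t = f t"
  shows "continuous_vec n T g"
  using continuous_vecD[OF assms(1)] assms(2) by (intro continuous_vecI) auto

lemma sp_add_right: "dim_vec x = dim_vec z \<Longrightarrow> dim_vec y = dim_vec z \<Longrightarrow> z \<bullet> (x + y) = z \<bullet> x + (z :: rvec) \<bullet> y"
  by (rule scalar_prod_add_distrib[of _ "dim_vec z"]) (auto intro: carrier_vecI)

lemma uminus_append: "- (x @\<^sub>v y) = (- x) @\<^sub>v (- y :: rvec)"
  by (intro eq_vecI) auto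

lemma add_append: "dim_vec x = dim_vec x' \<Longrightarrow> dim_vec y = dim_vec y' \<Longrightarrow>
    (x @\<^sub>v y) + (x' @\<^sub>v y') = (x + x') @\<^sub>v (y + y' :: rvec)"
  by (intro eq_vecI) auto

text \<open>What the energy balance uses of the discretisation: \<open>W\<close> is a nonnegative convex function of the
  edge coefficients whose gradient is \<open>K(a) a\<close>, and the matrices that the model inverts are positive
  definite.\<close>

locale reduced_mqs =
  fixes P :: mqs and Yh Y N U :: rmat and d e r :: nat and W :: "rvec \<Rightarrow> rvec \<Rightarrow> real"
  assumes Yh: "Yh \<in> carrier_mat (n2 P) d" and Y: "Y \<in> carrier_mat d e"
    and U: "U \<in> carrier_mat (n1 P) r" "U\<^sup>T * U = 1\<^sub>m r"
    and M11_spd: "spd (n1 P) (M11 P)" and R_spd: "spd (ports P) (Rmat P)"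
    and K12_transpose: "(K12 P)\<^sup>T = K21 P" and K22_sym: "(K22 P)\<^sup>T = K22 P"
    and S_spd: "spd e ((Yh * Y)\<^sup>T * K22 P * (Yh * Y))"
    and gram_spd: "spd (ports P) (gram P Yh)" and N: "inv_sqrt_mat (ports P) (gram P Yh) N"
    and W_nonneg: "\<And>a1 a2. a1 \<in> carrier_vec (n1 P) \<Longrightarrow> a2 \<in> carrier_vec (n2 P) \<Longrightarrow> 0 \<le> W a1 a2"
    and W_subgrad: "\<And>a1 a2 b1 b2. a1 \<in> carrier_vec (n1 P) \<Longrightarrow> a2 \<in> carrier_vec (n2 P) \<Longrightarrow>
      b1 \<in> carrier_vec (n1 P) \<Longrightarrow> b2 \<in> carrier_vec (n2 P) \<Longrightarrow>
      W a1 a2 - W b1 b2 \<le> (K11 P a1 *\<^sub>v a1 + K12 P *\<^sub>v a2) \<bullet> (a1 - b1) + (K21 P *\<^sub>v a1 + K22 P *\<^sub>v a2) \<bullet> (a2 - b2)"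
    and K11_continuous: "\<And>T f. continuous_vec (n1 P) T f \<Longrightarrow> continuous_vec (n1 P) T (\<lambda>t. K11 P (f t) *\<^sub>v f t)"
begin

abbreviation "n \<equiv> n1 P" abbreviation "m \<equiv> ports P"

definition "Z = Z2 P Yh N"
definition "Pr = Y2proj P Yh Y"
definition "Ri = minv (Rmat P)"

lemma dims [simp]:
  "dim_row Yh = n2 P" "dim_col Yh = d" "dim_row Y = d" "dim_col Y = e" "dim_row U = n" "dim_col U = r"
  "dim_row (M11 P) = n" "dim_col (M11 P) = n" "dim_row (K11 P a) = n" "dim_col (K11 P a) = n"
  "dim_row (K12 P) = n" "dim_col (K12 P) = n2 P" "dim_row (K21 P) = n2 P" "dim_col (K21 P) = n"
  "dim_row (K22 P) = n2 P" "dim_col (K22 P) = n2 P" "dim_row (X1 P) = n" "dim_col (X1 P) = m"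
  "dim_row (X2 P) = n2 P" "dim_col (X2 P) = m" "dim_row N = m" "dim_col N = m"
  "dim_row Z = n2 P" "dim_col Z = m" "dim_row Pr = n2 P" "dim_col Pr = n2 P"
  "dim_row Ri = m" "dim_col Ri = m"
  using Yh Y U N spd_minv(1)[OF R_spd] spd_minv(1)[OF S_spd]
  by (auto simp: M11_def K11_def K12_def K21_def K22_def X1_def X2_def inv_sqrt_mat_def spd_def
      Z_def Z2_def Zmat_def Pr_def Y2proj_def Ri_def Let_def)

lemma N_sym: "N\<^sup>T = N" using N by (simp add: inv_sqrt_mat_def spd_def)

lemma gram_dims [simp]: "dim_row (gram P Yh) = m" "dim_col (gram P Yh) = m"
  by (simp_all add: gram_def)

lemma Z_eq: "Z = Yh * (Yh\<^sup>T * X2 P * N)" by (simp add: Z_def Z2_def Zmat_def)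

text \<open>\<open>Z\<^sub>2\<^sup>T X\<^sub>2\<close> is the square root of the Gram matrix and \<open>N\<close> is its inverse.\<close>

lemma NZX_inverse: "v \<in> carrier_vec m \<Longrightarrow> N *\<^sub>v (Z\<^sup>T *\<^sub>v (X2 P *\<^sub>v v)) = v"
proof -
  assume v: "v \<in> carrier_vec m"
  have NN: "N * N = minv (gram P Yh)" using N by (simp add: inv_sqrt_mat_def)
  have "Z\<^sup>T *\<^sub>v (X2 P *\<^sub>v v) = N *\<^sub>v (gram P Yh *\<^sub>v v)"
    using v by (simp add: Z_eq gram_def transpose_mult_dim N_sym mv_assoc)
  then have "N *\<^sub>v (Z\<^sup>T *\<^sub>v (X2 P *\<^sub>v v)) = (N * N) *\<^sub>v (gram P Yh *\<^sub>v v)"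
    using v by (simp add: mv_assoc)
  also have "\<dots> = (minv (gram P Yh) * gram P Yh) *\<^sub>v v"
    using v spd_minv(1)[OF gram_spd] by (simp add: NN mv_assoc)
  finally show ?thesis using spd_minv(3)[OF gram_spd] v by simp
qed

lemma XZ_injective: "z \<in> carrier_vec m \<Longrightarrow> (X2 P)\<^sup>T *\<^sub>v (Z *\<^sub>v z) = 0\<^sub>v m \<Longrightarrow> z = 0\<^sub>v m"
proof -
  assume z: "z \<in> carrier_vec m" and 0: "(X2 P)\<^sup>T *\<^sub>v (Z *\<^sub>v z) = 0\<^sub>v m"
  have "(X2 P)\<^sup>T *\<^sub>v (Z *\<^sub>v z) = gram P Yh *\<^sub>v (N *\<^sub>v z)"
    using z by (simp add: Z_eq gram_def mv_assoc)
  with 0 have g: "gram P Yh *\<^sub>v (N *\<^sub>v z) = 0\<^sub>v m" by simp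
  have "N *\<^sub>v z = 0\<^sub>v m" by (rule spd_injective[OF gram_spd _ g]) (auto intro: carrier_vecI)
  then show ?thesis using N z unfolding inv_sqrt_mat_def by (blast intro: spd_injective)
qed

text \<open>With \<open>S = Y\<^sub>2\<^sup>T K\<^sub>2\<^sub>2 Y\<^sub>2\<close>, the matrix \<open>Pr = Y\<^sub>2 S\<^sup>-\<^sup>1 Y\<^sub>2\<^sup>T\<close> is symmetric and satisfies \<open>Pr K\<^sub>2\<^sub>2 Pr = Pr\<close>.\<close>

lemma Pr_sym: "Pr\<^sup>T = Pr"
proof -
  let ?Y = "Yh * Y" let ?M = "minv (?Y\<^sup>T * K22 P * ?Y)"
  note I = spd_minv(1,4)[OF S_spd]
  have "(?Y * ?M * ?Y\<^sup>T)\<^sup>T = ?Y * (?M\<^sup>T * ?Y\<^sup>T)"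
    using I(1) by (subst transpose_mult_dim, simp, subst transpose_mult_dim) auto
  also have "\<dots> = ?Y * ?M * ?Y\<^sup>T"
    unfolding I(2) using I(1) Yh Y
    by (intro assoc_mult_mat[symmetric, of _ "n2 P" e _ e _ "n2 P"]) auto
  finally show ?thesis by (simp only: Pr_def Y2proj_def Let_def)
qed

lemma Pr_idem: "v \<in> carrier_vec (n2 P) \<Longrightarrow> Pr *\<^sub>v (K22 P *\<^sub>v (Pr *\<^sub>v v)) = Pr *\<^sub>v v"
proof -
  assume v: "v \<in> carrier_vec (n2 P)"
  let ?Y = "Yh * Y" let ?S = "?Y\<^sup>T * K22 P * ?Y" let ?x = "?Y\<^sup>T *\<^sub>v v"
  note I = spd_minv(1,3)[OF S_spd]
  have *: "Pr *\<^sub>v w = ?Y *\<^sub>v (minv ?S *\<^sub>v (?Y\<^sup>T *\<^sub>v w))" if "w \<in> carrier_vec (n2 P)" for w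
    using that I(1) unfolding Pr_def Y2proj_def Let_def by (subst mv_assoc, simp, simp, subst mv_assoc) auto
  have "?Y\<^sup>T *\<^sub>v (K22 P *\<^sub>v (?Y *\<^sub>v (minv ?S *\<^sub>v ?x))) = ?S *\<^sub>v (minv ?S *\<^sub>v ?x)"
    using I(1) by (subst mv_assoc, simp, simp, subst mv_assoc) auto
  also have "\<dots> = (?S * minv ?S) *\<^sub>v ?x"
    using I(1) v by (intro mv_assoc[symmetric]) auto
  also have "\<dots> = ?x" unfolding spd_minv(2)[OF S_spd] by (rule one_mv) simp
  finally have **: "?Y\<^sup>T *\<^sub>v (K22 P *\<^sub>v (Pr *\<^sub>v v)) = ?x" by (subst *[OF v])
  have "Pr *\<^sub>v (K22 P *\<^sub>v (Pr *\<^sub>v v)) = ?Y *\<^sub>v (minv ?S *\<^sub>v (?Y\<^sup>T *\<^sub>v (K22 P *\<^sub>v (Pr *\<^sub>v v))))"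
    by (rule *) (auto intro: carrier_vecI)
  also have "\<dots> = Pr *\<^sub>v v" unfolding ** by (rule *[OF v, symmetric])
  finally show ?thesis .
qed

text \<open>A reduced state \<open>x\<close> stands for the conducting coefficients \<open>cond x\<close> and the non-conducting ones
  \<open>ncond x\<close>.  The latter arise from \<open>Z\<^sub>2\<close> times the last components of \<open>x\<close> by adding the combination
  of the columns of \<open>Y\<^sub>2\<close> that minimises the energy.  The blocks of \<open>K(a) a\<close> at these coefficients are \<open>force1 x\<close> and
  \<open>force2 x\<close>.\<close>

definition "cond x = U *\<^sub>v vec_first x r"
definition "port x = vec_last x m"
definition "rhs2 x = K21 P *\<^sub>v cond x + K22 P *\<^sub>v (Z *\<^sub>v port x)"
definition "ncond x = Z *\<^sub>v port x - Pr *\<^sub>v rhs2 x"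
definition "force1 x = K11 P (cond x) *\<^sub>v cond x + K12 P *\<^sub>v ncond x"
definition "force2 x = K21 P *\<^sub>v cond x + K22 P *\<^sub>v ncond x"

lemma lift_dims [simp]: "dim_vec (cond x) = n" "dim_vec (port x) = m" "dim_vec (rhs2 x) = n2 P"
  "dim_vec (ncond x) = n2 P" "dim_vec (force1 x) = n" "dim_vec (force2 x) = n2 P"
  by (simp_all add: cond_def port_def rhs2_def ncond_def force1_def force2_def)

lemma vec_split: "x \<in> carrier_vec (r + m) \<Longrightarrow> x = vec_first x r @\<^sub>v port x"
  by (simp add: port_def)

lemma lift_diff:
  assumes "x \<in> carrier_vec (r + m)" "y \<in> carrier_vec (r + m)"
  shows "cond (x - y) = cond x - cond y" "ncond (x - y) = ncond x - ncond y"
proof -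
  have "vec_first (x - y) r = vec_first x r - vec_first y r"
    using assms by (intro eq_vecI) (auto simp: vec_first_def)
  then show c: "cond (x - y) = cond x - cond y"
    by (simp add: cond_def mv_diff)
  have "port (x - y) = port x - port y"
    using assms by (intro eq_vecI) (auto simp: vec_last_def port_def)
  then have "Z *\<^sub>v port (x - y) = Z *\<^sub>v port x - Z *\<^sub>v port y" by (simp add: mv_diff)
  moreover from this have "rhs2 (x - y) = rhs2 x - rhs2 y"
    unfolding rhs2_def c by (simp add: mv_diff) (intro eq_vecI; simp)
  ultimately show "ncond (x - y) = ncond x - ncond y"
    unfolding ncond_def by (simp add: mv_diff) (intro eq_vecI; simp)
qed

lemma force2_eq: "force2 x = rhs2 x - K22 P *\<^sub>v (Pr *\<^sub>v rhs2 x)"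
  unfolding force2_def ncond_def rhs2_def by (simp add: mv_diff) (intro eq_vecI; simp)

lemma Pr_force2: "Pr *\<^sub>v force2 x = 0\<^sub>v (n2 P)"
  by (simp add: force2_eq mv_diff Pr_idem carrier_dim_vec)

text \<open>The eliminated components carry no force, so moving them does no work.\<close>

lemma force2_ncond: "force2 x \<bullet> ncond v = (Z\<^sup>T *\<^sub>v force2 x) \<bullet> port v"
proof -
  have "force2 x \<bullet> (Pr *\<^sub>v rhs2 v) = (Pr\<^sup>T *\<^sub>v force2 x) \<bullet> rhs2 v"
    by (simp add: adjoint_left)
  also have "\<dots> = 0" by (simp add: Pr_sym Pr_force2)
  finally show ?thesis unfolding ncond_def by (simp add: sp_diff_right adjoint_left)
qed

abbreviation "sys a10 a21 \<equiv> pod_model P Yh Y N U a10 a21"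
abbreviation "V \<equiv> Ut P U"

lemma V_dims [simp]: "dim_row V = n + m" "dim_col V = r + m" by (simp_all add: Ut_def)

lemma V_mv: "x \<in> carrier_vec (r + m) \<Longrightarrow> V *\<^sub>v x = cond x @\<^sub>v port x"
  by (subst vec_split, assumption, unfold Ut_def, subst four_block_mv) (auto simp: cond_def)

lemma Vt_mv: "dim_vec p = n \<Longrightarrow> dim_vec q = m \<Longrightarrow> V\<^sup>T *\<^sub>v (p @\<^sub>v q) = (U\<^sup>T *\<^sub>v p) @\<^sub>v q"
proof -
  assume d: "dim_vec p = n" "dim_vec q = m"
  have "V\<^sup>T = four_block_mat (U\<^sup>T) (0\<^sub>m r m) (0\<^sub>m m n) (1\<^sub>m m)"
    unfolding Ut_def by (subst transpose_four_block_mat[of _ n r _ m _ m]) (auto simp: U)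
  then show ?thesis using d
    by simp (subst four_block_mv; auto)
qed

lemma A_ode_dims [simp]: "dim_row (A_ode P Yh Y N x) = n + m" "dim_col (A_ode P Yh Y N x) = n + m"
  by (simp_all add: A_ode_def Let_def Z_def[symmetric] Pr_def[symmetric])

lemma E_ode_dims [simp]: "dim_row (E_ode P Yh N) = n + m" "dim_col (E_ode P Yh N) = n + m"
  by (simp_all add: E_ode_def Let_def Z_def[symmetric] Ri_def[symmetric])

lemma B_ode_dims [simp]: "dim_row (B_ode P Yh N) = n + m" "dim_col (B_ode P Yh N) = m"
  by (simp_all add: B_ode_def Let_def Z_def[symmetric] Ri_def[symmetric])

lemma Zhat_eq: "Zhat P Yh = Yh\<^sup>T * X2 P * (N * N)"
  using N by (simp add: Zhat_def inv_sqrt_mat_def)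

lemma C_ode_dims [simp]: "dim_row (C_ode P Yh Y N) = m" "dim_col (C_ode P Yh Y N) = n + m"
  by (simp_all add: C_ode_def Z_def[symmetric] Pr_def[symmetric] Zhat_eq)

text \<open>Eliminating the \<open>Y\<^sub>2\<close> components by the Schur complement amounts to evaluating \<open>K(a) a\<close> at the
  lifted coefficients.\<close>

lemma A_ode_mv:
  assumes x: "x \<in> carrier_vec (r + m)"
  shows "A_ode P Yh Y N (V *\<^sub>v x) *\<^sub>v (V *\<^sub>v x) = - (force1 x @\<^sub>v (Z\<^sup>T *\<^sub>v force2 x))"
proof -
  have f: "vec_first (V *\<^sub>v x) n = cond x" unfolding V_mv[OF x] by (intro eq_vecI) (auto simp: vec_first_def)
  have l: "four_block_mat (K11 P (cond x)) (K12 P * Z) (Z\<^sup>T * K21 P) (Z\<^sup>T * K22 P * Z) *\<^sub>v (cond x @\<^sub>v port x)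
      = (K11 P (cond x) *\<^sub>v cond x + K12 P *\<^sub>v (Z *\<^sub>v port x)) @\<^sub>v (Z\<^sup>T *\<^sub>v rhs2 x)"
    by (subst four_block_mv) (simp_all add: mv_assoc rhs2_def mv_add)
  have q: "((K12 P @\<^sub>r (Z\<^sup>T * K22 P)) * Pr * (K21 P @\<^sub>c (K22 P * Z))) *\<^sub>v (cond x @\<^sub>v port x)
      = (K12 P *\<^sub>v (Pr *\<^sub>v rhs2 x)) @\<^sub>v (Z\<^sup>T *\<^sub>v (K22 P *\<^sub>v (Pr *\<^sub>v rhs2 x)))"
    by (simp add: mv_assoc append_cols_mv append_rows_mv rhs2_def)
  show ?thesis
    unfolding A_ode_def Let_def f Z_def[symmetric] Pr_def[symmetric]
    unfolding V_mv[OF x]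
    apply (subst add_mv; simp?)
    unfolding l q
    apply (simp add: uminus_append add_append)
    unfolding force1_def force2_eq ncond_def
    apply (simp add: mv_diff)
    apply (intro arg_cong2[where f = append_vec]; intro eq_vecI; simp)
    done
qed

lemma sys_A_mv:
  assumes x: "x \<in> carrier_vec (r + m)"
  shows "sys_A (sys a10 a21) x *\<^sub>v x = - ((U\<^sup>T *\<^sub>v force1 x) @\<^sub>v (Z\<^sup>T *\<^sub>v force2 x))"
proof -
  have "sys_A (sys a10 a21) x *\<^sub>v x = V\<^sup>T *\<^sub>v (A_ode P Yh Y N (V *\<^sub>v x) *\<^sub>v (V *\<^sub>v x))"
    using x by (simp add: pod_model_def Let_def mv_assoc)
  also have "\<dots> = - (V\<^sup>T *\<^sub>v (force1 x @\<^sub>v (Z\<^sup>T *\<^sub>v force2 x)))"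
    unfolding A_ode_mv[OF x] by (rule mv_uminus) simp
  finally show ?thesis by (simp add: Vt_mv)
qed

lemma Zhat_dims [simp]: "dim_row (Zhat P Yh) = d" "dim_col (Zhat P Yh) = m"
  by (simp_all add: Zhat_eq)

text \<open>The output is read off from the same forces that drive the last \<open>m\<close> state equations.\<close>

lemma sys_C_mv:
  assumes x: "x \<in> carrier_vec (r + m)"
  shows "sys_C (sys a10 a21) *\<^sub>v x = N *\<^sub>v (Z\<^sup>T *\<^sub>v force2 x)"
proof -
  have f: "(1\<^sub>m (n2 P) - K22 P * Pr) *\<^sub>v rhs2 x = force2 x"
    unfolding force2_eq by (subst diff_mv) (auto simp: mv_assoc)
  have "sys_C (sys a10 a21) *\<^sub>v x = C_ode P Yh Y N *\<^sub>v (cond x @\<^sub>v port x)"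
    using x by (simp add: pod_model_def Let_def mv_assoc V_mv)
  also have "\<dots> = (Zhat P Yh)\<^sup>T *\<^sub>v (Yh\<^sup>T *\<^sub>v ((1\<^sub>m (n2 P) - K22 P * Pr) *\<^sub>v rhs2 x))"
    unfolding C_ode_def Z_def[symmetric] Pr_def[symmetric]
    by (simp add: mv_assoc append_cols_mv rhs2_def)
  also have "\<dots> = (Zhat P Yh)\<^sup>T *\<^sub>v (Yh\<^sup>T *\<^sub>v force2 x)" unfolding f ..
  also have "\<dots> = N *\<^sub>v (Z\<^sup>T *\<^sub>v force2 x)"
    by (simp add: Zhat_eq Z_eq transpose_mult_dim N_sym mv_assoc)
  finally show ?thesis .
qed

text \<open>The derivative of the flux linkage \<open>X\<^sup>T a\<close>, when \<open>v\<close> is the derivative of the state.\<close>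

definition "flux v = (X1 P)\<^sup>T *\<^sub>v cond v + (X2 P)\<^sup>T *\<^sub>v (Z *\<^sub>v port v)"

lemma flux_dim [simp]: "dim_vec (flux v) = m" by (simp add: flux_def)

lemma sys_E_mv:
  assumes v: "v \<in> carrier_vec (r + m)"
  shows "sys_E (sys a10 a21) *\<^sub>v v =
    (U\<^sup>T *\<^sub>v (M11 P *\<^sub>v cond v + X1 P *\<^sub>v (Ri *\<^sub>v flux v))) @\<^sub>v (Z\<^sup>T *\<^sub>v (X2 P *\<^sub>v (Ri *\<^sub>v flux v)))"
proof -
  have "E_ode P Yh N *\<^sub>v (cond v @\<^sub>v port v)
      = (M11 P *\<^sub>v cond v + X1 P *\<^sub>v (Ri *\<^sub>v flux v)) @\<^sub>v (Z\<^sup>T *\<^sub>v (X2 P *\<^sub>v (Ri *\<^sub>v flux v)))"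
    unfolding E_ode_def Let_def Z_def[symmetric] Ri_def[symmetric]
    by (subst four_block_mv) (simp_all add: mv_assoc add_mv mv_add flux_def assoc_add_vec[of _ n] carrier_dim_vec)
  then show ?thesis using v
    by (simp add: pod_model_def Let_def mv_assoc V_mv Vt_mv)
qed

lemma sys_B_mv:
  assumes u: "u \<in> carrier_vec m"
  shows "sys_B (sys a10 a21) *\<^sub>v u = (U\<^sup>T *\<^sub>v (X1 P *\<^sub>v (Ri *\<^sub>v u))) @\<^sub>v (Z\<^sup>T *\<^sub>v (X2 P *\<^sub>v (Ri *\<^sub>v u)))"
  using u by (simp add: pod_model_def Let_def mv_assoc B_ode_def Z_def[symmetric] Ri_def[symmetric] append_rows_mv Vt_mv)

lemma test_power: "v \<in> carrier_vec (r + m) \<Longrightarrow> dim_vec p = n \<Longrightarrow> dim_vec q = n2 P \<Longrightarrow>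
    ((U\<^sup>T *\<^sub>v p) @\<^sub>v (Z\<^sup>T *\<^sub>v q)) \<bullet> v = p \<bullet> cond v + q \<bullet> (Z *\<^sub>v port v)"
  by (subst (1) vec_split[of v], assumption, subst sp_append) (simp_all add: adjoint_left cond_def)

lemma X_power: "dim_vec w = m \<Longrightarrow> (X1 P *\<^sub>v w) \<bullet> cond v + (X2 P *\<^sub>v w) \<bullet> (Z *\<^sub>v port v) = w \<bullet> flux v"
  by (simp add: flux_def adjoint_right sp_add_right)

text \<open>As a quadratic form of the derivative of the state, \<open>E\<close> is the eddy current loss plus the power
  that the induced voltage dissipates in the resistances.\<close>

lemma E_form: "v \<in> carrier_vec (r + m) \<Longrightarrow> (sys_E (sys a10 a21) *\<^sub>v v) \<bullet> v
    = cond v \<bullet> (M11 P *\<^sub>v cond v) + (Ri *\<^sub>v flux v) \<bullet> flux v"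
  by (subst sys_E_mv, assumption, subst test_power)
     (simp_all add: sp_add_left X_power[symmetric] sp_comm[of "M11 P *\<^sub>v cond v"])

lemma E_injective:
  assumes v: "v \<in> carrier_vec (r + m)" and 0: "sys_E (sys a10 a21) *\<^sub>v v = 0\<^sub>v (r + m)"
  shows "v = 0\<^sub>v (r + m)"
proof -
  have c: "cond v \<in> carrier_vec n" "flux v \<in> carrier_vec m" by (simp_all add: carrier_dim_vec)
  have fl: "(Ri *\<^sub>v flux v) \<bullet> flux v = flux v \<bullet> (Ri *\<^sub>v flux v)" by (rule sp_comm) simp
  have "cond v \<bullet> (M11 P *\<^sub>v cond v) + flux v \<bullet> (Ri *\<^sub>v flux v) = 0"
    using E_form[OF v, of a10 a21] v unfolding 0 fl by simp
  then have z: "cond v \<bullet> (M11 P *\<^sub>v cond v) = 0" "flux v \<bullet> (Ri *\<^sub>v flux v) = 0"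
    using spd_nonneg[OF M11_spd c(1)] spd_minv(5)[OF R_spd c(2)] unfolding Ri_def by linarith+
  have cond0: "cond v = 0\<^sub>v n" using z(1) M11_spd c(1) unfolding spd_def by force
  have "flux v = 0\<^sub>v m" using spd_minv(6)[OF R_spd c(2)] z(2) unfolding Ri_def by simp
  then have "(X2 P)\<^sup>T *\<^sub>v (Z *\<^sub>v port v) = 0\<^sub>v m" unfolding flux_def cond0
    by (simp add: carrier_dim_vec)
  then have p: "port v = 0\<^sub>v m" by (rule XZ_injective[rotated]) (simp add: carrier_dim_vec)
  have "vec_first v r = (U\<^sup>T * U) *\<^sub>v vec_first v r" by (simp add: U)
  also have "\<dots> = U\<^sup>T *\<^sub>v cond v" by (subst mv_assoc) (simp_all add: cond_def)
  also have "\<dots> = 0\<^sub>v r" by (simp add: cond0)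
  finally have "v = 0\<^sub>v r @\<^sub>v 0\<^sub>v m" using vec_split[OF v] p by simp
  then show ?thesis by (simp add: append_vec_def zero_vec_def) (intro eq_vecI; auto)
qed

text \<open>With \<open>v = x'\<close> and \<open>w = flux v\<close> the output is \<open>y = R\<^sup>-\<^sup>1 (u - w)\<close>, so that the power balance
  has the slack \<open>(u - w)\<^sup>T R\<^sup>-\<^sup>1 (u - w) + a\<^sub>1'\<^sup>T M\<^sub>1\<^sub>1 a\<^sub>1'\<close>.  Projection onto the POD basis keeps the
  last \<open>m\<close> equations unchanged, which is why the formula for \<open>y\<close> survives the reduction.\<close>

theorem pod_model_passive: "is_passive (sys a10 a21)"
proof -
  let ?s = "sys a10 a21"
  have E: "sys_E ?s \<in> carrier_mat (r + m) (r + m)"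
    by (intro carrier_matI) (simp_all add: pod_model_def Let_def)
  have Bc: "sys_B ?s \<in> carrier_mat (r + m) m"
    by (intro carrier_matI) (simp_all add: pod_model_def Let_def)
  note Einv = minv_of_injective[OF E E_injective[of _ a10 a21]]
  define FF where "FF x = sys_A ?s x *\<^sub>v x" for x
  have FF: "FF x = - ((U\<^sup>T *\<^sub>v force1 x) @\<^sub>v (Z\<^sup>T *\<^sub>v force2 x))" if "x \<in> carrier_vec (r + m)" for x
    unfolding FF_def by (rule sys_A_mv[OF that])
  have FF_sp: "- (FF x \<bullet> v) = force1 x \<bullet> cond v + (Z\<^sup>T *\<^sub>v force2 x) \<bullet> port v"
    if "x \<in> carrier_vec (r + m)" "v \<in> carrier_vec (r + m)" for x v
    using test_power[OF that(2), of "force1 x" "force2 x"] that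
    by (simp add: FF adjoint_left)
  show ?thesis
  proof (rule passive_of_convex_storage[where \<Sigma> = ?s and n = "r + m" and m = m and W = "\<lambda>x. W (cond x) (ncond x)" and Einv = "minv (sys_E ?s)", folded FF_def])
    show "r + m = state_dim ?s" "m = io_dim ?s" by (simp_all add: pod_model_def Let_def)
    show "sys_C ?s \<in> carrier_mat m (r + m)" "sys_A ?s x \<in> carrier_mat (r + m) (r + m)" for x
      by (auto simp: pod_model_def Let_def intro!: carrier_matI)
    show "0 \<le> W (cond x) (ncond x)" for x by (intro W_nonneg) (simp_all add: carrier_dim_vec)
    show "W (cond x) (ncond x) - W (cond y) (ncond y) \<le> - (FF x \<bullet> (x - y))"
      if x: "x \<in> carrier_vec (r + m)" and y: "y \<in> carrier_vec (r + m)" for x y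
    proof -
      have "W (cond x) (ncond x) - W (cond y) (ncond y)
          \<le> force1 x \<bullet> (cond x - cond y) + force2 x \<bullet> (ncond x - ncond y)"
        unfolding force1_def force2_def by (intro W_subgrad) (simp_all add: carrier_dim_vec)
      also have "\<dots> = force1 x \<bullet> cond (x - y) + (Z\<^sup>T *\<^sub>v force2 x) \<bullet> port (x - y)"
        using lift_diff[OF x y] by (simp add: force2_ncond[symmetric])
      also have "\<dots> = - (FF x \<bullet> (x - y))" using FF_sp[of x "x - y"] x y by simp
      finally show ?thesis .
    qed
    show "continuous_vec (r + m) T (\<lambda>t. FF (x t))" if x: "continuous_vec (r + m) T x" for T x
    proof -
      have c1: "continuous_vec n T (\<lambda>t. cond (x t))"
        unfolding cond_def by (rule continuous_vec_mv[OF continuous_vec_first[OF x] U(1)])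
      have z: "continuous_vec (n2 P) T (\<lambda>t. Z *\<^sub>v port (x t))"
        unfolding port_def by (rule continuous_vec_mv[OF continuous_vec_last[OF x]]) (simp add: carrier_matI)
      have c2: "continuous_vec (n2 P) T (\<lambda>t. ncond (x t))"
        unfolding ncond_def rhs2_def
        by (intro continuous_vec_diff z continuous_vec_mv[where n = "n2 P"] continuous_vec_mv[OF c1] continuous_vec_add)
           (simp_all add: carrier_matI)
      have "continuous_vec (r + m) T (\<lambda>t. - ((U\<^sup>T *\<^sub>v force1 (x t)) @\<^sub>v (Z\<^sup>T *\<^sub>v force2 (x t))))"
        unfolding force1_def force2_def
        by (intro continuous_vec_uminus continuous_vec_append continuous_vec_mv[where n = n and k = r]
            continuous_vec_mv[where n = "n2 P" and k = m] continuous_vec_add K11_continuous c1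
            continuous_vec_mv[OF c1] continuous_vec_mv[OF c2]) (simp_all add: carrier_matI)
      then show ?thesis
        by (rule continuous_vec_cong) (use x FF in \<open>simp add: continuous_vec_def\<close>)
    qed
    show "- (FF x \<bullet> (minv (sys_E ?s) *\<^sub>v (FF x + sys_B ?s *\<^sub>v u))) \<le> u \<bullet> (sys_C ?s *\<^sub>v x)"
      if x: "x \<in> carrier_vec (r + m)" and u: "u \<in> carrier_vec m" for x u
    proof -
      define v where "v = minv (sys_E ?s) *\<^sub>v (FF x + sys_B ?s *\<^sub>v u)"
      have g: "FF x + sys_B ?s *\<^sub>v u \<in> carrier_vec (r + m)"
        using Bc u by (auto simp: FF[OF x] intro!: carrier_vecI)
      have v: "v \<in> carrier_vec (r + m)" using Einv(1) g by (simp add: v_def)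
      have Ev: "sys_E ?s *\<^sub>v v = FF x + sys_B ?s *\<^sub>v u"
        unfolding v_def using E Einv(1,2) g by (simp flip: assoc_mult_mat_vec)
      define y where "y = sys_C ?s *\<^sub>v x"
      have y: "y = N *\<^sub>v (Z\<^sup>T *\<^sub>v force2 x)" unfolding y_def by (rule sys_C_mv[OF x])
      \<comment> \<open>The last \<open>m\<close> equations express the output as \<open>R\<^sup>-\<^sup>1 (u - w)\<close>, where \<open>w\<close> is the flux derivative.\<close>
      have "(U\<^sup>T *\<^sub>v (M11 P *\<^sub>v cond v + X1 P *\<^sub>v (Ri *\<^sub>v flux v))) @\<^sub>v (Z\<^sup>T *\<^sub>v (X2 P *\<^sub>v (Ri *\<^sub>v flux v)))
        = - ((U\<^sup>T *\<^sub>v force1 x) @\<^sub>v (Z\<^sup>T *\<^sub>v force2 x)) + ((U\<^sup>T *\<^sub>v (X1 P *\<^sub>v (Ri *\<^sub>v u))) @\<^sub>v (Z\<^sup>T *\<^sub>v (X2 P *\<^sub>v (Ri *\<^sub>v u))))"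
        (is "?a @\<^sub>v ?b = - (?p @\<^sub>v ?q) + (?c @\<^sub>v ?d)")
        using Ev unfolding sys_E_mv[OF v] FF[OF x] sys_B_mv[OF u] .
      also have "\<dots> = (- ?p + ?c) @\<^sub>v (- ?q + ?d)"
        by (simp add: uminus_append add_append)
      finally have "?b = - ?q + ?d"
        by (subst (asm) append_vec_eq[of _ r]) (simp_all add: carrier_dim_vec)
      then have "N *\<^sub>v ?b = - y + N *\<^sub>v ?d"
        by (simp add: mv_add mv_uminus y)
      then have "Ri *\<^sub>v flux v = - y + Ri *\<^sub>v u"
        by (simp add: NZX_inverse carrier_dim_vec)
      then have "y = Ri *\<^sub>v u - Ri *\<^sub>v flux v"
        by (intro eq_vecI) (auto simp: y)
      then have yR: "y = Ri *\<^sub>v (u - flux v)" using u by (simp add: mv_diff)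
      have c: "cond v \<in> carrier_vec n" "u - flux v \<in> carrier_vec m" "flux v \<in> carrier_vec m"
        by (rule carrier_vecI; simp)+
      have "(sys_B ?s *\<^sub>v u) \<bullet> v = (Ri *\<^sub>v u) \<bullet> flux v"
        unfolding sys_B_mv[OF u] by (subst test_power[OF v]) (simp_all add: X_power)
      moreover have "(sys_E ?s *\<^sub>v v) \<bullet> v = FF x \<bullet> v + (sys_B ?s *\<^sub>v u) \<bullet> v"
        unfolding Ev using FF[OF x] Bc u v by (intro sp_add_left) auto
      ultimately have "- (FF x \<bullet> v) = (Ri *\<^sub>v u) \<bullet> flux v - (Ri *\<^sub>v flux v) \<bullet> flux v - cond v \<bullet> (M11 P *\<^sub>v cond v)"
        using E_form[OF v, of a10 a21] by linarith
      also have "\<dots> \<le> y \<bullet> flux v"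
        using spd_nonneg[OF M11_spd c(1)] u by (simp add: yR mv_diff sp_diff_left)
      also have "\<dots> = u \<bullet> y - (u - flux v) \<bullet> y"
        using u by (simp add: sp_diff_left y sp_comm[of _ "flux v"])
      also have "\<dots> \<le> u \<bullet> y"
        using spd_minv(5)[OF R_spd c(2)] by (simp add: yR Ri_def)
      finally show ?thesis unfolding v_def y_def .
    qed
    show "minv (sys_E ?s) \<in> carrier_mat (r + m) (r + m)" "minv (sys_E ?s) * sys_E ?s = 1\<^sub>m (r + m)"
      using Einv(1,3) by auto
  qed (fact E, fact Bc)
qed

end

section \<open>Matrices whose columns form a basis\<close>

lemma (in vec_space) rank_le_card_cols:
  assumes A: "A \<in> carrier_mat n d"
  shows "rank A \<le> card (set (cols A))"
proof -
  have fin: "finite S \<and> card S \<le> card (set (cols A))" if "S \<subseteq> set (cols A) \<and> lin_indpt S" for S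
    using that by (meson List.finite_set card_mono rev_finite_subset)
  have empty: "{} \<subseteq> set (cols A) \<and> lin_indpt {}" by (auto simp: lin_dep_def)
  obtain S where S: "maximal S (\<lambda>S. S \<subseteq> set (cols A) \<and> lin_indpt S)"
    using maximal_exists[of "\<lambda>S. S \<subseteq> set (cols A) \<and> lin_indpt S" "card (set (cols A))" "{}"] fin empty
    by meson
  then have "card S \<le> card (set (cols A))" by (simp add: card_mono maximal_def)
  then show ?thesis using rank_card_indpt[OF A S] by simp
qed

text \<open>Full rank makes the columns distinct, so that they form a linearly independent set of the right
  size.\<close>

lemma full_column_rank_injective:
  assumes A: "A \<in> carrier_mat n d" and rank: "vec_space.rank n (A :: rmat) = d"
    and v: "v \<in> carrier_vec d" "A *\<^sub>v v = 0\<^sub>v n"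
  shows "v = 0\<^sub>v d"
proof (rule ccontr)
  assume "v \<noteq> 0\<^sub>v d"
  have dist: "distinct (cols A)"
    using vec_space.rank_le_card_cols[OF A] card_distinct[of "cols A"] card_length[of "cols A"] rank A
    by (metis carrier_matD(2) cols_length le_antisym)
  have "\<not> LinearCombinations.module.lin_dep class_ring (module_vec TYPE(real) n) (set (cols A))"
    using vec_space.full_rank_lin_indpt[OF A rank dist] .
  then show False using vec_space.lin_depI[OF A v(1) \<open>v \<noteq> 0\<^sub>v d\<close> v(2) dist] by simp
qed

lemma cols_basis_injective:
  assumes A: "A \<in> carrier_mat n d" "cols_basis n A W" and v: "v \<in> carrier_vec d" "A *\<^sub>v v = 0\<^sub>v n"
  shows "v = 0\<^sub>v d"
  using vec_space.lin_depI[OF A(1) v(1) _ v(2)] A(2) unfolding cols_basis_def by blast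

lemma cols_basis_image:
  assumes A: "A \<in> carrier_mat n d" "cols_basis n A W"
  shows "W = {A *\<^sub>v v | v. v \<in> carrier_vec d}"
proof -
  have "W = vec_space.col_space n A"
    using A(2) by (simp add: cols_basis_def vec_space.col_space_def)
  also have "\<dots> = {y\<in>carrier_vec n. \<exists>x\<in>carrier_vec d. A *\<^sub>v x = y}"
    using vec_space.col_space_eq[OF A(1)] A(1) by simp
  finally show ?thesis using A(1) by auto
qed

section \<open>Barycentric coordinates on a tetrahedron\<close>

locale tetrahedron =
  fixes T :: "R3 set"
  assumes simplex: "3 simplex T"
begin

lemma verts: "\<not> affine_dependent (verts T)" "card (verts T) = 4" "T = convex hull (verts T)" "finite (verts T)"
proof -
  obtain C where C: "\<not> affine_dependent C" "int (card C) = 4" "T = convex hull C"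
    using simplex unfolding simplex_def by auto
  have "verts T = C"
    using extreme_point_of_convex_hull_affine_independent[OF C(1)] by (auto simp: verts_def C(3))
  with C show "\<not> affine_dependent (verts T)" "card (verts T) = 4" "T = convex hull (verts T)" "finite (verts T)"
    by (auto simp: aff_independent_finite)
qed

lemma convex: "convex T" by (subst verts(3)) (rule convex_convex_hull)

lemma compact: "compact T" by (subst verts(3)) (simp add: finite_imp_compact_convex_hull verts(4))

lemma interior_nonempty: "interior T \<noteq> {}"
proof -
  have "aff_dim T = 3"
    using aff_dim_affine_independent[OF verts(1)] verts(2) by (subst verts(3)) (simp add: aff_dim_convex_hull)
  then have "interior T = rel_interior T" using interior_rel_interior_gen[of T] by simp
  moreover have "verts T \<noteq> {}" using verts(2) by force
  then have "T \<noteq> {}" using verts(3) by (metis convex_hull_eq_empty)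
  ultimately show ?thesis using rel_interior_eq_empty[OF convex] by simp
qed

lemma edge_basis:
  assumes "v \<in> verts T"
  shows "independent ((\<lambda>w. w - v) ` (verts T - {v}))" "span ((\<lambda>w. w - v) ` (verts T - {v})) = UNIV"
proof -
  have eq: "(\<lambda>w. w - v) ` (verts T - {v}) = (\<lambda>w. - v + w) ` (verts T - {v})" by simp
  show ind: "independent ((\<lambda>w. w - v) ` (verts T - {v}))"
    unfolding eq using affine_dependent_iff_dependent2[OF assms] verts(1) by blast
  have "card ((\<lambda>w. w - v) ` (verts T - {v})) = 3"
    using assms verts(2,4) by (subst card_image) (auto simp: inj_on_def card_Diff_singleton)
  then have "UNIV \<subseteq> span ((\<lambda>w. w - v) ` (verts T - {v}))"
    by (intro card_ge_dim_independent ind) (auto simp: dim_UNIV)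
  then show "span ((\<lambda>w. w - v) ` (verts T - {v})) = UNIV" by blast
qed

text \<open>The edge vectors at \<open>v\<close> form a basis, so the functional with value \<open>- 1\<close> on them exists and is
  unique; this justifies the definite description in the definition of the gradient.\<close>

lemma bary_grad_opposite:
  assumes v: "v \<in> verts T" and w: "w \<in> verts T - {v}"
  shows "inner (bary_grad T v) (v - w) = 1"
proof -
  let ?B = "(\<lambda>w. w - v) ` (verts T - {v})"
  have "\<exists>f. linear f \<and> (\<forall>x\<in>?B. f x = (- 1 :: real))"
    by (rule linear_independent_extend[OF edge_basis(1)[OF v]])
  then obtain f :: "R3 \<Rightarrow> real" where f: "linear f" "\<And>w. w \<in> verts T - {v} \<Longrightarrow> f (w - v) = - 1" by auto
  define g where "g = adjoint f 1"
  have fg: "f x = inner g x" for x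
    using adjoint_works[OF f(1), of x 1] by (simp add: g_def inner_commute)
  have "\<forall>w\<in>verts T - {v}. inner (bary_grad T v) (v - w) = 1"
    unfolding bary_grad_def
  proof (rule theI2)
    show g: "\<forall>w\<in>verts T - {v}. inner g (v - w) = 1"
      using f(2) fg by (metis inner_minus_right minus_diff_eq add.inverse_inverse)
    show "h = g" if h: "\<forall>w\<in>verts T - {v}. inner h (v - w) = 1" for h
    proof -
      have "inner (h - g) x = 0" if "x \<in> span ?B" for x
      proof (rule linear_eq_0_on_span[OF _ _ that])
        show "linear (inner (h - g))" by (rule bounded_linear.linear[OF bounded_linear_inner_right])
        show "inner (h - g) x = 0" if x: "x \<in> ?B" for x
        proof -
          obtain w where w: "w \<in> verts T - {v}" "x = - (v - w)" using x by auto
          then show ?thesis using h g by (simp add: inner_diff_left del: minus_diff_eq)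
        qed
      qed
      then have "inner (h - g) (h - g) = 0" using edge_basis(2)[OF v] by blast
      then show ?thesis by simp
    qed
  qed
  with w show ?thesis by blast
qed

lemma bary_grad_inner:
  assumes v: "v \<in> verts T" and p: "p \<in> verts T" and q: "q \<in> verts T"
  shows "inner (bary_grad T v) (p - q) = of_bool (p = v) - of_bool (q = v)"
proof -
  have *: "inner (bary_grad T v) (v - w) = of_bool (w \<noteq> v)" if "w \<in> verts T" for w
    using bary_grad_opposite[OF v] that by (cases "w = v") auto
  have "inner (bary_grad T v) (p - q) = inner (bary_grad T v) (v - q) - inner (bary_grad T v) (v - p)"
    by (simp add: inner_diff_right)
  then show ?thesis using *[OF p] *[OF q] by auto
qed

lemma bary_vertex: "v \<in> verts T \<Longrightarrow> p \<in> verts T \<Longrightarrow> bary T v p = of_bool (p = v)"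
  unfolding bary_def by (simp add: bary_grad_inner)

subsection \<open>Edge functions on a single tetrahedron\<close>

definition nedelec :: "R3 \<times> R3 \<Rightarrow> R3 \<Rightarrow> R3" where
  "nedelec e x = (if fst e \<in> verts T \<and> snd e \<in> verts T
     then bary T (fst e) x *\<^sub>R bary_grad T (snd e) - bary T (snd e) x *\<^sub>R bary_grad T (fst e) else 0)"

definition nedelec_curl :: "R3 \<times> R3 \<Rightarrow> R3" where
  "nedelec_curl e = (if fst e \<in> verts T \<and> snd e \<in> verts T
     then 2 *\<^sub>R cross3 (bary_grad T (fst e)) (bary_grad T (snd e)) else 0)"

definition nedelec_deriv :: "R3 \<times> R3 \<Rightarrow> R3 \<Rightarrow> R3" where
  "nedelec_deriv e h = (if fst e \<in> verts T \<and> snd e \<in> verts T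
     then inner (bary_grad T (fst e)) h *\<^sub>R bary_grad T (snd e) - inner (bary_grad T (snd e)) h *\<^sub>R bary_grad T (fst e) else 0)"

lemma nedelec_has_derivative: "(nedelec e has_derivative nedelec_deriv e) (at x)"
proof (cases "fst e \<in> verts T \<and> snd e \<in> verts T")
  case True
  have "(bary T v has_derivative inner (bary_grad T v)) (at x)" for v
    unfolding bary_def by (auto intro!: derivative_eq_intros)
  with True show ?thesis
    unfolding nedelec_def[abs_def] nedelec_deriv_def[abs_def]
    by (auto intro!: derivative_eq_intros)
next
  case False
  then have "nedelec e = (\<lambda>x. 0)" "nedelec_deriv e = (\<lambda>h. 0)"
    by (auto simp: nedelec_def[abs_def] nedelec_deriv_def[abs_def])
  then show ?thesis by simp
qed

text \<open>The edge functions are dual to the tangential integrals along the edges.  The tangential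
  component is constant along an edge, so the integral can be read off at a vertex.\<close>

lemma nedelec_at_vertex:
  assumes v: "v \<in> verts T" and w: "w \<in> verts T" and vw: "v \<noteq> w"
  shows "inner (nedelec (p, q) v) (w - v) = (if (p, q) = (v, w) then 1 else if (q, p) = (v, w) then - 1 else 0)"
proof (cases "p \<in> verts T \<and> q \<in> verts T")
  case True
  then show ?thesis using assms
    by (auto simp: nedelec_def inner_diff_left bary_vertex bary_grad_inner)
qed (use assms in \<open>auto simp: nedelec_def\<close>)

text \<open>Stokes' theorem on a face: \<open>(q - p) \<times> (s - p)\<close> is twice the area vector of the triangle, and
  the circulation of an edge function along the boundary of the triangle is an incidence number.\<close>

lemma nedelec_curl_flux:
  assumes F: "p \<in> verts T" "q \<in> verts T" "s \<in> verts T" "p \<noteq> q" "q \<noteq> s" "p \<noteq> s" and e: "fst e \<noteq> snd e"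
  shows "inner (nedelec_curl e) (cross3 (q - p) (s - p)) = 2 * incidence (p, q, s) e"
proof (cases "fst e \<in> verts T \<and> snd e \<in> verts T")
  case True
  obtain v w where [simp]: "e = (v, w)" by (cases e)
  have dc: "inner (cross3 a b) (cross3 c d) = inner a c * inner b d - inner a d * inner b (c :: R3)" for a b c d
    by (simp add: cross3_simps inner_vec_def sum_3)
  have "inner (nedelec_curl e) (cross3 (q - p) (s - p)) =
     2 * ((of_bool (q = v) - of_bool (p = v)) * (of_bool (s = w) - of_bool (p = w))
       - (of_bool (s = v) - of_bool (p = v)) * (of_bool (q = w) - of_bool (p = w)))"
    using True F by (simp add: nedelec_curl_def dc bary_grad_inner)
  also have "\<dots> = 2 * incidence (p, q, s) e"
    using F e True by (cases "v = p"; cases "v = q"; cases "v = s"; cases "w = p"; cases "w = q"; cases "w = s") auto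
  finally show ?thesis .
next
  case False
  then show ?thesis using F by (cases e) (auto simp: nedelec_curl_def)
qed

text \<open>The normals of three faces with a common vertex span the space, as the three edge vectors at that
  vertex do.\<close>

lemma zero_of_zero_face_fluxes:
  assumes c: "\<And>p q s. p \<in> verts T \<Longrightarrow> q \<in> verts T \<Longrightarrow> s \<in> verts T \<Longrightarrow> p \<noteq> q \<Longrightarrow> q \<noteq> s \<Longrightarrow> p \<noteq> s \<Longrightarrow>
    inner c (cross3 (q - p) (s - p)) = 0"
  shows "c = 0"
proof -
  have "verts T \<noteq> {}" using verts(2) by force
  then obtain p where p: "p \<in> verts T" by blast
  let ?B = "(\<lambda>w. w - p) ` (verts T - {p})"
  have lin: "linear (\<lambda>x. inner c (cross3 x y))" "linear (\<lambda>y. inner c (cross3 x y))" for x y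
    by (auto intro!: linearI simp: cross_add_left cross_add_right cross_mult_left cross_mult_right inner_add_right)
  have B: "inner c (cross3 x y) = 0" if "x \<in> ?B" "y \<in> ?B" for x y
  proof (cases "x = y")
    case False
    then show ?thesis using that c[OF p] by auto
  qed simp
  have "inner c (cross3 x y) = 0" if "x \<in> ?B" "y \<in> span ?B" for x y
    by (rule linear_eq_0_on_span[OF lin(2) _ that(2)]) (use B that(1) in auto)
  then have "inner c (cross3 x y) = 0" if "x \<in> span ?B" "y \<in> span ?B" for x y
    by (intro linear_eq_0_on_span[OF lin(1) _ that(1)]) (use that(2) in auto)
  then have all: "inner c (cross3 x y) = 0" for x y using edge_basis(2)[OF p] by simp
  have "vec_nth c 1 = 0" "vec_nth c 2 = 0" "vec_nth c 3 = 0"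
    using all[of "axis 2 1" "axis 3 1"] all[of "axis 3 1" "axis 1 1"] all[of "axis 1 1" "axis 2 1"]
    by (simp_all add: cross3_def inner_vec_def sum_3 axis_def)
  then show ?thesis by (simp add: Finite_Cartesian_Product.vec_eq_iff forall_3)
qed

end

subsection \<open>The curl of a differentiable field\<close>

text \<open>The curl as a function of the derivative, which makes its linearity evident.\<close>

definition rot :: "(R3 \<Rightarrow> R3) \<Rightarrow> R3" where
  "rot D = vector [vec_nth (D (axis 2 1)) 3 - vec_nth (D (axis 3 1)) 2,
     vec_nth (D (axis 3 1)) 1 - vec_nth (D (axis 1 1)) 3,
     vec_nth (D (axis 1 1)) 2 - vec_nth (D (axis 2 1)) 1]"

lemma curl_has_derivative:
  assumes "(f has_derivative D) (at x)"
  shows "curl f x = rot D"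
  using frechet_derivative_at[OF assms] by (simp add: curl_def rot_def Let_def)

lemma rot_zero: "rot (\<lambda>h. 0) = 0"
  by (simp add: rot_def Finite_Cartesian_Product.vec_eq_iff forall_3)

lemma rot_sum: "finite I \<Longrightarrow> rot (\<lambda>h. \<Sum>i\<in>I. a i *\<^sub>R D i h) = (\<Sum>i\<in>I. a i *\<^sub>R rot (D i))"
  by (simp add: rot_def Finite_Cartesian_Product.vec_eq_iff forall_3 right_diff_distrib sum_subtractf)

lemma (in tetrahedron) rot_nedelec: "rot (nedelec_deriv e) = nedelec_curl e"
  by (auto simp: rot_def nedelec_curl_def nedelec_deriv_def cross3_def Finite_Cartesian_Product.vec_eq_iff forall_3 inner_vec_def sum_3 axis_def algebra_simps)

section \<open>Fields on a tetrahedral mesh\<close>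

lemma AE_lebesgue_on_iff:
  assumes "S \<in> sets lebesgue"
  shows "(AE x in lebesgue_on S. Q x) \<longleftrightarrow> negligible {x \<in> S. \<not> Q x}"
proof -
  have "(AE x in lebesgue_on S. Q x) \<longleftrightarrow> (AE x in lebesgue. x \<in> S \<longrightarrow> Q x)"
    using assms by (subst AE_restrict_space_iff) auto
  also have "\<dots> \<longleftrightarrow> negligible {x. \<not> (x \<in> S \<longrightarrow> Q x)}"
    by (simp add: completion.AE_iff_null_sets negligible_iff_null_sets)
  also have "{x. \<not> (x \<in> S \<longrightarrow> Q x)} = {x \<in> S. \<not> Q x}" by auto
  finally show ?thesis .
qed

lemma AE_open_nonempty_witness:
  fixes S G :: "'a::euclidean_space set"
  assumes "AE x in lebesgue_on S. Q x" "S \<in> sets lebesgue" "open G" "G \<subseteq> S" "G \<noteq> {}"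
  obtains x where "x \<in> G" "Q x"
proof -
  have "\<not> G \<subseteq> {x \<in> S. \<not> Q x}"
    using open_not_negligible[OF assms(3,5)] AE_lebesgue_on_iff[OF assms(2)] assms(1) negligible_subset by blast
  with assms(4) that show thesis by blast
qed

text \<open>As Lebesgue measure is complete, measurability of one side suffices.\<close>

lemma integral_lebesgue_on_cong_AE:
  fixes f g :: "'a::euclidean_space \<Rightarrow> real"
  assumes S: "S \<in> sets lebesgue" and f: "f \<in> borel_measurable (lebesgue_on S)"
    and eq: "AE x in lebesgue_on S. f x = g x"
  shows "integral\<^sup>L (lebesgue_on S) g = integral\<^sup>L (lebesgue_on S) f"
proof -
  have "(\<lambda>x. if x \<in> S then f x else 0) \<in> borel_measurable lebesgue"
    using f S by (simp add: borel_measurable_if)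
  moreover have "AE x in lebesgue. (if x \<in> S then f x else 0) = (if x \<in> S then g x else 0)"
    using eq S by (subst (asm) AE_restrict_space_iff) (auto elim: eventually_mono)
  ultimately have "(\<lambda>x. if x \<in> S then g x else 0) \<in> borel_measurable lebesgue"
    by (rule borel_measurable_AE)
  then have "g \<in> borel_measurable (lebesgue_on S)" using S by (simp add: borel_measurable_if)
  then show ?thesis using f eq by (intro integral_cong_AE) auto
qed

locale mqs_problem =
  fixes P :: mqs
  assumes domain: "mqs_domain P" and material: "mqs_material P"
    and winding: "mqs_winding P" and fem: "mqs_fem P"
begin

lemma Om: "open (Om P)" "Om P \<in> sets lebesgue"
  using domain by (auto simp: mqs_domain_def lipschitz_domain_def)

lemma OmC: "open (OmC P)" "closure (OmC P) \<subseteq> Om P" "OmC P \<subseteq> Om P"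
  using domain closure_subset by (auto simp: mqs_domain_def)

lemma mesh: "finite (mesh P)" "\<And>T. T \<in> mesh P \<Longrightarrow> tetrahedron T" "\<Union>(mesh P) = closure (Om P)"
  "\<And>T T'. T \<in> mesh P \<Longrightarrow> T' \<in> mesh P \<Longrightarrow> (T \<inter> T') face_of T"
  "\<Union>{T \<in> mesh P. T \<subseteq> closure (OmC P)} = closure (OmC P)" "n1 P \<le> ne P"
  using fem by (auto simp: mqs_fem_def triangulation_def tetrahedron_def)

text \<open>Two elements of the triangulation meet in a common face, and the only face of \<open>T\<close> that meets
  its interior is \<open>T\<close>.\<close>

lemma mesh_interior_subset: "T \<in> mesh P \<Longrightarrow> T' \<in> mesh P \<Longrightarrow> x \<in> interior T \<Longrightarrow> x \<in> T' \<Longrightarrow> T \<subseteq> T'"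
  using face_of_disjoint_interior[OF mesh(4), of T T'] interior_subset by blast

lemma mesh_interior_unique: "T \<in> mesh P \<Longrightarrow> T' \<in> mesh P \<Longrightarrow> x \<in> interior T \<Longrightarrow> x \<in> interior T' \<Longrightarrow> T = T'"
  using mesh_interior_subset[of T T' x] mesh_interior_subset[of T' T x] interior_subset by blast

lemma fem_lists:
  "bij_betw (\<lambda>j. case edges P ! j of (v, w) \<Rightarrow> {v, w}) {..<ne P}
     {e. card e = 2 \<and> (\<exists>T\<in>mesh P. e \<subseteq> verts T) \<and> \<not> convex hull e \<subseteq> frontier (Om P)}"
  "bij_betw (\<lambda>k. case faces P ! k of (p, q, s) \<Rightarrow> {p, q, s}) {..<nf P}
     {F. card F = 3 \<and> (\<exists>T\<in>mesh P. F \<subseteq> verts T)}"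
  "\<forall>j<ne P. j < n1 P \<longleftrightarrow> (\<exists>T\<in>mesh P. T \<subseteq> closure (OmC P) \<and>
     fst (edges P ! j) \<in> verts T \<and> snd (edges P ! j) \<in> verts T)"
  "\<forall>j<ne P. H0_curl (Om P) (phi P j) (curl (phi P j))"
  by (rule fem[unfolded mqs_fem_def, THEN conjunct2, THEN conjunct2, THEN conjunct2, THEN conjunct2, THEN conjunct1],
      rule fem[unfolded mqs_fem_def, THEN conjunct2, THEN conjunct2, THEN conjunct2, THEN conjunct2, THEN conjunct2, THEN conjunct1],
      rule fem[unfolded mqs_fem_def, THEN conjunct2, THEN conjunct2, THEN conjunct2, THEN conjunct2, THEN conjunct2, THEN conjunct2, THEN conjunct2, THEN conjunct1],
      rule fem[unfolded mqs_fem_def, THEN conjunct2, THEN conjunct2, THEN conjunct2, THEN conjunct2, THEN conjunct2, THEN conjunct2, THEN conjunct2, THEN conjunct2])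

lemma edge: assumes "j < ne P" shows "fst (edges P ! j) \<noteq> snd (edges P ! j)"
proof -
  obtain v w where e: "edges P ! j = (v, w)" by (cases "edges P ! j") auto
  have "(case edges P ! j of (v, w) \<Rightarrow> {v, w}) \<in> {e. card e = 2 \<and> (\<exists>T\<in>mesh P. e \<subseteq> verts T) \<and> \<not> convex hull e \<subseteq> frontier (Om P)}"
    by (rule bij_betwE[OF fem_lists(1), rule_format]) (use assms in simp)
  then have "card {v, w} = 2" by (simp add: e)
  then show ?thesis by (cases "v = w") (simp_all add: e)
qed

lemma edge_unique:
  assumes "i < ne P" "j < ne P" "{fst (edges P ! i), snd (edges P ! i)} = {fst (edges P ! j), snd (edges P ! j)}"
  shows "i = j"
  by (rule inj_onD[OF bij_betw_imp_inj_on[OF fem_lists(1)]])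
     (use assms in \<open>simp_all only: case_prod_unfold lessThan_iff\<close>)

lemma conducting_edge: "j < ne P \<Longrightarrow> j < n1 P \<longleftrightarrow> (\<exists>T\<in>mesh P. T \<subseteq> closure (OmC P) \<and>
    fst (edges P ! j) \<in> verts T \<and> snd (edges P ! j) \<in> verts T)"
  using fem_lists(3) by (elim allE impE)

lemma face: assumes "k < nf P"
  obtains p q s T where "faces P ! k = (p, q, s)" "p \<noteq> q" "q \<noteq> s" "p \<noteq> s" "T \<in> mesh P" "{p, q, s} \<subseteq> verts T"
proof -
  obtain p q s where f: "faces P ! k = (p, q, s)" by (cases "faces P ! k") auto
  have "(case faces P ! k of (p, q, s) \<Rightarrow> {p, q, s}) \<in> {F. card F = 3 \<and> (\<exists>T\<in>mesh P. F \<subseteq> verts T)}"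
    by (rule bij_betwE[OF fem_lists(2), rule_format]) (use assms in simp)
  then have *: "card {p, q, s} = 3" "\<exists>T\<in>mesh P. {p, q, s} \<subseteq> verts T" by (simp_all add: f)
  have "p \<noteq> q" "q \<noteq> s" "p \<noteq> s" using *(1) by (auto simp: card_insert_if split: if_splits)
  with *(2) that[OF f] show thesis by blast
qed

text \<open>A face is listed with an arbitrary ordering of its vertices.\<close>

lemma triple_cases:
  assumes "{p', q', s'} = {p, q, s}" "p \<noteq> q" "q \<noteq> s" "p \<noteq> s"
  shows "(p', q', s') \<in> {(p, q, s), (q, s, p), (s, p, q), (p, s, q), (s, q, p), (q, p, s)}"
proof -
  have "card {p', q', s'} = 3" unfolding assms(1) using assms(2-4) by simp
  then have "p' \<noteq> q'" "q' \<noteq> s'" "p' \<noteq> s'" by (auto simp: card_insert_if split: if_splits)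
  moreover have "p' \<in> {p, q, s}" "q' \<in> {p, q, s}" "s' \<in> {p, q, s}"
    using assms(1) by blast+
  ultimately show ?thesis by (elim insertE emptyE; simp)
qed

lemma face_listed:
  assumes "T \<in> mesh P" "p \<in> verts T" "q \<in> verts T" "s \<in> verts T" "p \<noteq> q" "q \<noteq> s" "p \<noteq> s"
  obtains k where "k < nf P" "faces P ! k \<in> {(p, q, s), (q, s, p), (s, p, q), (p, s, q), (s, q, p), (q, p, s)}"
proof -
  have "{p, q, s} \<in> {F. card F = 3 \<and> (\<exists>T\<in>mesh P. F \<subseteq> verts T)}" using assms by auto
  also have "\<dots> = (\<lambda>k. case faces P ! k of (p, q, s) \<Rightarrow> {p, q, s}) ` {..<nf P}"
    by (rule bij_betw_imp_surj_on[OF fem_lists(2), symmetric])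
  finally obtain k where k: "k < nf P" "{p, q, s} = (case faces P ! k of (p, q, s) \<Rightarrow> {p, q, s})" by blast
  obtain p' q' s' where f: "faces P ! k = (p', q', s')" by (cases "faces P ! k") auto
  have "{p', q', s'} = {p, q, s}" using k(2) by (simp add: f)
  from triple_cases[OF this assms(5-7)] that[OF k(1)] show thesis by (simp only: f)
qed

subsection \<open>Edge functions element by element\<close>

lemma phi_on_tetrahedron:
  assumes T: "T \<in> mesh P" and x: "x \<in> interior T"
  shows "edge_fun (mesh P) e x = tetrahedron.nedelec T e x"
proof -
  interpret tetrahedron T by (rule mesh(2)[OF T])
  obtain v w where e: "e = (v, w)" by (cases e)
  let ?M = "{T \<in> mesh P. v \<in> verts T \<and> w \<in> verts T}"
  let ?f = "\<lambda>T. indicat_real (interior T) x *\<^sub>R (bary T v x *\<^sub>R bary_grad T w - bary T w x *\<^sub>R bary_grad T v)"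
  have 0: "?f T' = 0" if "T' \<in> mesh P" "T' \<noteq> T" for T'
    using mesh_interior_unique[OF T that(1) x] that(2) by (auto simp: indicator_def)
  show ?thesis
  proof (cases "T \<in> ?M")
    case True
    have "sum ?f ?M = sum ?f {T}"
      using mesh(1) True 0 by (intro sum.mono_neutral_right) auto
    then show ?thesis using True x by (simp add: e nedelec_def)
  next
    case False
    then have "sum ?f ?M = 0" by (intro sum.neutral) (use 0 in blast)
    then show ?thesis using False T by (auto simp: e nedelec_def)
  qed
qed

lemma phi_has_derivative:
  assumes T: "T \<in> mesh P" and x: "x \<in> interior T"
  shows "(edge_fun (mesh P) e has_derivative tetrahedron.nedelec_deriv T e) (at x)"
  by (rule has_derivative_transform_within_open[OF tetrahedron.nedelec_has_derivative[OF mesh(2)[OF T]] open_interior x])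
     (simp add: phi_on_tetrahedron[OF T])

lemma curl_phi:
  assumes T: "T \<in> mesh P" and x: "x \<in> interior T"
  shows "curl (phi P j) x = tetrahedron.nedelec_curl T (edges P ! j)"
  using curl_has_derivative[OF phi_has_derivative[OF assms]] tetrahedron.rot_nedelec[OF mesh(2)[OF T]] by simp

definition curl_field :: "rvec \<Rightarrow> R3 \<Rightarrow> R3" where
  "curl_field a x = (\<Sum>j<ne P. (a $ j) *\<^sub>R curl (phi P j) x)"

lemma curl_of_sum:
  assumes T: "T \<in> mesh P" and x: "x \<in> interior T"
  shows "curl (\<lambda>x. \<Sum>j<ne P. (a $ j) *\<^sub>R phi P j x) x = curl_field a x"
proof -
  have "((\<lambda>x. \<Sum>j<ne P. (a $ j) *\<^sub>R phi P j x) has_derivative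
      (\<lambda>h. \<Sum>j<ne P. (a $ j) *\<^sub>R tetrahedron.nedelec_deriv T (edges P ! j) h)) (at x)"
    by (intro has_derivative_sum has_derivative_scaleR_right phi_has_derivative[OF T x])
  from curl_has_derivative[OF this] show ?thesis
    using tetrahedron.rot_nedelec[OF mesh(2)[OF T]]
    by (simp add: rot_sum curl_field_def curl_phi[OF T x])
qed

text \<open>Points in the interior of an element, which has to be a conducting one if the point belongs to the
  closure of the conductor.  There all edge functions are smooth, and in the conductor the
  non-conducting ones vanish.\<close>

definition resolved :: "R3 \<Rightarrow> bool" where
  "resolved x \<longleftrightarrow> (\<exists>T\<in>mesh P. x \<in> interior T \<and> (x \<in> closure (OmC P) \<longrightarrow> T \<subseteq> closure (OmC P)))"

text \<open>Frontiers of tetrahedra are null sets, being frontiers of convex sets.\<close>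

lemma AE_resolved: "AE x in lebesgue_on (Om P). resolved x"
proof -
  have "negligible (\<Union>T\<in>mesh P. frontier T)"
    using mesh(1,2) by (auto intro!: negligible_Union negligible_convex_frontier tetrahedron.convex)
  moreover have "{x \<in> Om P. \<not> resolved x} \<subseteq> (\<Union>T\<in>mesh P. frontier T)"
  proof clarify
    fix x assume x: "x \<in> Om P" "\<not> resolved x"
    have "\<exists>T\<in>mesh P. x \<in> T \<and> (x \<in> closure (OmC P) \<longrightarrow> T \<subseteq> closure (OmC P))"
    proof (cases "x \<in> closure (OmC P)")
      case True
      then show ?thesis using mesh(5) by blast
    next
      case False
      have "x \<in> closure (Om P)" using x(1) closure_subset by blast
      then show ?thesis using mesh(3) False by blast
    qed
    then obtain T where T: "T \<in> mesh P" "x \<in> T" "x \<in> closure (OmC P) \<longrightarrow> T \<subseteq> closure (OmC P)" by blast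
    then have "x \<notin> interior T" using x(2) unfolding resolved_def by blast
    with T(2) have "x \<in> frontier T" unfolding frontier_def using closure_subset by blast
    with T(1) show "x \<in> (\<Union>T\<in>mesh P. frontier T)" by blast
  qed
  ultimately show ?thesis unfolding AE_lebesgue_on_iff[OF Om(2)] by (rule negligible_subset)
qed

lemma resolved_curl_of_sum: "resolved x \<Longrightarrow> curl (\<lambda>x. \<Sum>j<ne P. (a $ j) *\<^sub>R phi P j x) x = curl_field a x"
  unfolding resolved_def using curl_of_sum by blast

text \<open>Non-conducting edge functions vanish in the conductor.\<close>

lemma resolved_nonconducting_curl:
  assumes "resolved x" "x \<in> closure (OmC P)" "n1 P \<le> j" "j < ne P"
  shows "curl (phi P j) x = 0"
proof -
  obtain T where T: "T \<in> mesh P" "x \<in> interior T" "T \<subseteq> closure (OmC P)"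
    using assms(1,2) unfolding resolved_def by blast
  have "\<not> (fst (edges P ! j) \<in> verts T \<and> snd (edges P ! j) \<in> verts T)"
    using conducting_edge[OF assms(4)] assms(3) T by auto
  then show ?thesis
    by (simp only: curl_phi[OF T(1,2)] tetrahedron.nedelec_curl_def[OF mesh(2)[OF T(1)]] if_False)
qed

subsection \<open>The kernel of the discrete curl\<close>

lemma face_normal_permute:
  fixes p q s :: R3
  shows "cross3 (s - q) (p - q) = cross3 (q - p) (s - p)" "cross3 (p - s) (q - s) = cross3 (q - p) (s - p)"
    "cross3 (s - p) (q - p) = - cross3 (q - p) (s - p)" "cross3 (q - s) (p - s) = - cross3 (q - p) (s - p)"
    "cross3 (p - q) (s - q) = - cross3 (q - p) (s - p)"
  by (simp_all add: cross3_def Finite_Cartesian_Product.vec_eq_iff forall_3 algebra_simps)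

lemma Cd_flux:
  assumes T: "T \<in> mesh P" and x: "x \<in> interior T" and k: "k < nf P" "faces P ! k = (p, q, s)"
    and F: "p \<in> verts T" "q \<in> verts T" "s \<in> verts T" "p \<noteq> q" "q \<noteq> s" "p \<noteq> s"
  shows "inner (curl_field a x) (cross3 (q - p) (s - p)) = 2 * (\<Sum>j<ne P. Cd P $$ (k, j) * a $ j)"
proof -
  have "inner (curl_field a x) (cross3 (q - p) (s - p)) = (\<Sum>j<ne P. a $ j * (2 * incidence (p, q, s) (edges P ! j)))"
    unfolding curl_field_def inner_sum_left
    by (intro sum.cong refl)
       (use edge in \<open>simp add: curl_phi[OF T x] tetrahedron.nedelec_curl_flux[OF mesh(2)[OF T] F]\<close>)
  also have "\<dots> = 2 * (\<Sum>j<ne P. Cd P $$ (k, j) * a $ j)"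
    using k by (simp add: Cd_def sum_distrib_left mult_ac)
  finally show ?thesis .
qed

text \<open>The discrete curl has the same kernel as the curl: on an element the curl is a constant, and by
  Stokes' theorem the rows of \<open>C\<^sub>d\<close> give its fluxes through the faces, which determine it.\<close>

lemma Cd_zero_iff:
  "(\<forall>k<nf P. (\<Sum>j<ne P. Cd P $$ (k, j) * a $ j) = 0) \<longleftrightarrow> (AE x in lebesgue_on (Om P). curl_field a x = 0)"
proof
  assume 0: "\<forall>k<nf P. (\<Sum>j<ne P. Cd P $$ (k, j) * a $ j) = 0"
  have "curl_field a x = 0" if "resolved x" for x
  proof -
    obtain T where T: "T \<in> mesh P" "x \<in> interior T" using \<open>resolved x\<close> unfolding resolved_def by blast
    show ?thesis
    proof (rule tetrahedron.zero_of_zero_face_fluxes[OF mesh(2)[OF T(1)]])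
      fix p q s assume F: "p \<in> verts T" "q \<in> verts T" "s \<in> verts T" "p \<noteq> q" "q \<noteq> s" "p \<noteq> s"
      from face_listed[OF T(1) F] obtain k where k: "k < nf P"
        "faces P ! k \<in> {(p, q, s), (q, s, p), (s, p, q), (p, s, q), (s, q, p), (q, p, s)}" .
      obtain p' q' s' where f: "faces P ! k = (p', q', s')" by (cases "faces P ! k") auto
      have "inner (curl_field a x) (cross3 (q' - p') (s' - p')) = 0"
      proof -
        have F': "p' \<in> verts T" "q' \<in> verts T" "s' \<in> verts T" "p' \<noteq> q'" "q' \<noteq> s'" "p' \<noteq> s'"
          using k(2) F unfolding f by (elim insertE emptyE; simp)+
        show ?thesis using Cd_flux[OF T k(1) f F'] 0 k(1) by simp
      qed
      moreover have "cross3 (q' - p') (s' - p') = cross3 (q - p) (s - p) \<or> cross3 (q' - p') (s' - p') = - cross3 (q - p) (s - p)"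
        using k(2) face_normal_permute[where p = p and q = q and s = s]
        unfolding f by (elim insertE emptyE) simp_all
      ultimately show "inner (curl_field a x) (cross3 (q - p) (s - p)) = 0" by auto
    qed
  qed
  then show "AE x in lebesgue_on (Om P). curl_field a x = 0"
    using AE_resolved by (auto elim: eventually_mono)
next
  assume ae: "AE x in lebesgue_on (Om P). curl_field a x = 0"
  show "\<forall>k<nf P. (\<Sum>j<ne P. Cd P $$ (k, j) * a $ j) = 0"
  proof (intro allI impI)
    fix k assume k: "k < nf P"
    obtain p q s T where F: "faces P ! k = (p, q, s)" "p \<noteq> q" "q \<noteq> s" "p \<noteq> s" "T \<in> mesh P" "{p, q, s} \<subseteq> verts T"
      using face[OF k] .
    have "interior T \<noteq> {}" "interior T \<subseteq> closure (Om P)"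
      using tetrahedron.interior_nonempty[OF mesh(2)[OF F(5)]] mesh(3) F(5) interior_subset by blast+
    then have "interior T \<inter> Om P \<noteq> {}"
      using open_Int_closure_eq_empty[of "interior T" "Om P"] by auto
    then obtain x where x: "x \<in> interior T \<inter> Om P" "curl_field a x = 0"
      using AE_open_nonempty_witness[OF ae Om(2), of "interior T \<inter> Om P"] Om(1) by (metis Int_lower2 open_Int open_interior)
    then show "(\<Sum>j<ne P. Cd P $$ (k, j) * a $ j) = 0"
      using Cd_flux[OF F(5) _ k F(1), of x a] F by simp
  qed
qed

end

section \<open>Square-integrable fields\<close>

lemma L2_inner_integrable:
  fixes f g :: "'a::euclidean_space \<Rightarrow> 'b::euclidean_space"
  assumes f: "L2_on S f" and g: "L2_on S g" and h: "h \<in> borel_measurable (lebesgue_on S)" "\<And>x. \<bar>h x\<bar> \<le> (C :: real)"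
  shows "integrable (lebesgue_on S) (\<lambda>x. h x * inner (f x) (g x))"
proof (rule Bochner_Integration.integrable_bound)
  show "integrable (lebesgue_on S) (\<lambda>x. C * ((norm (f x))\<^sup>2 + (norm (g x))\<^sup>2))"
    using f g unfolding L2_on_def by (intro integrable_mult_right Bochner_Integration.integrable_add) auto
  show "(\<lambda>x. h x * inner (f x) (g x)) \<in> borel_measurable (lebesgue_on S)"
    using f g h unfolding L2_on_def by (intro borel_measurable_times borel_measurable_inner) auto
  show "AE x in lebesgue_on S. norm (h x * inner (f x) (g x)) \<le> norm (C * ((norm (f x))\<^sup>2 + (norm (g x))\<^sup>2))"
  proof (rule AE_I2)
    fix x
    have "0 \<le> (norm (f x) - norm (g x))\<^sup>2" by simp
    then have "2 * (norm (f x) * norm (g x)) \<le> (norm (f x))\<^sup>2 + (norm (g x))\<^sup>2"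
      by (simp add: power2_diff mult.assoc)
    moreover have "0 \<le> norm (f x) * norm (g x)" by simp
    ultimately have "\<bar>inner (f x) (g x)\<bar> \<le> (norm (f x))\<^sup>2 + (norm (g x))\<^sup>2"
      using Cauchy_Schwarz_ineq2[of "f x" "g x"] by linarith
    then have "\<bar>h x\<bar> * \<bar>inner (f x) (g x)\<bar> \<le> C * ((norm (f x))\<^sup>2 + (norm (g x))\<^sup>2)"
      using h(2)[of x] by (intro mult_mono) auto
    then show "norm (h x * inner (f x) (g x)) \<le> norm (C * ((norm (f x))\<^sup>2 + (norm (g x))\<^sup>2))"
      unfolding real_norm_def abs_mult[of "h x"] by (rule order_trans[OF _ abs_ge_self])
  qed
qed

lemma L2_inner_integrable':
  fixes f g :: "'a::euclidean_space \<Rightarrow> 'b::euclidean_space"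
  assumes "L2_on S f" "L2_on S g"
  shows "integrable (lebesgue_on S) (\<lambda>x. inner (f x) (g x))"
  using L2_inner_integrable[OF assms, of "\<lambda>x. 1" 1] by simp

lemma L2_norm_integrable:
  fixes f g :: "'a::euclidean_space \<Rightarrow> 'b::euclidean_space"
  assumes f: "L2_on S f" and g: "L2_on S g"
  shows "integrable (lebesgue_on S) (\<lambda>x. norm (f x) * norm (g x))"
proof -
  have "L2_on S (\<lambda>x. norm (f x))" "L2_on S (\<lambda>x. norm (g x))"
    using f g by (auto simp: L2_on_def)
  then show ?thesis by (rule L2_on_mult_integrable)
qed

lemma L2_on_sum:
  fixes f :: "'i \<Rightarrow> 'a::euclidean_space \<Rightarrow> 'b::euclidean_space"
  assumes f: "\<And>i. i \<in> I \<Longrightarrow> L2_on S (f i)"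
  shows "L2_on S (\<lambda>x. \<Sum>i\<in>I. a i *\<^sub>R f i x)"
proof -
  have "integrable (lebesgue_on S) (\<lambda>x. \<Sum>i\<in>I. \<Sum>j\<in>I. a i * a j * inner (f i x) (f j x))"
    by (intro Bochner_Integration.integrable_sum integrable_mult_right L2_inner_integrable' f)
  moreover have "(norm (\<Sum>i\<in>I. a i *\<^sub>R f i x))\<^sup>2 = (\<Sum>i\<in>I. \<Sum>j\<in>I. a i * a j * inner (f i x) (f j x))" for x
    by (simp add: power2_norm_eq_inner inner_sum_left inner_sum_right sum_distrib_left mult_ac inner_commute)
  moreover have "(\<lambda>x. \<Sum>i\<in>I. a i *\<^sub>R f i x) \<in> borel_measurable (lebesgue_on S)"
    using f by (intro borel_measurable_sum borel_measurable_scaleR) (auto simp: L2_on_def)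
  ultimately show ?thesis by (simp add: L2_on_def)
qed

lemma L2_on_diff:
  fixes f g :: "'a::euclidean_space \<Rightarrow> 'b::euclidean_space"
  assumes "L2_on S f" "L2_on S g"
  shows "L2_on S (\<lambda>x. f x - g x)"
  using L2_on_sum[of "{True, False}" S "\<lambda>b. if b then f else g" "\<lambda>b. if b then 1 else - 1"] assms by simp

lemma sum_lessThan_add: "(\<Sum>l<a + (b::nat). f l) = (\<Sum>l<a. f l) + (\<Sum>l<b. f (a + l) :: 'a::comm_monoid_add)"
  by (induction b) (auto simp: add.assoc)

section \<open>The magnetic energy\<close>

context mqs_problem
begin

lemma curl_L2: "j < ne P \<Longrightarrow> L2_on (Om P) (curl (phi P j))"
  and phi_L2: "j < ne P \<Longrightarrow> L2_on (Om P) (phi P j)"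
  using fem_lists(4) by (auto simp: H0_curl_def)

lemma curl_field_L2: "L2_on (Om P) (curl_field a)"
  unfolding curl_field_def[abs_def] by (rule L2_on_sum) (simp add: curl_L2)

lemma curl_field_measurable: "curl_field a \<in> borel_measurable (lebesgue_on (Om P))"
  "(\<lambda>x. norm (curl_field a x)) \<in> borel_measurable (lebesgue_on (Om P))"
  using curl_field_L2[of a] by (auto simp: L2_on_def)

lemma curl_field_diff: "a \<in> carrier_vec (ne P) \<Longrightarrow> b \<in> carrier_vec (ne P) \<Longrightarrow>
    curl_field (a - b) x = curl_field a x - curl_field b x"
  by (simp add: curl_field_def scaleR_diff_left sum_subtractf)

subsection \<open>Material law\<close>

abbreviation "bh s \<equiv> nuC P s * s"

text \<open>A Lipschitz constant of \<open>\<nu>\<^sub>C(s) s\<close>, hence also a bound of \<open>\<nu>\<^sub>C(s)\<close> for \<open>s > 0\<close>.\<close>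

definition "Lnu = (SOME L. 0 < L \<and> L-lipschitz_on {0..} bh)"

lemma Lnu: "0 < Lnu" "Lnu-lipschitz_on {0..} bh"
proof -
  have "\<exists>L. 0 < L \<and> L-lipschitz_on {0..} bh" using material unfolding mqs_material_def by blast
  from someI_ex[OF this] show "0 < Lnu" "Lnu-lipschitz_on {0..} bh" by (simp_all add: Lnu_def)
qed

lemma nu_pos: "0 < nuI P" "0 < sigC P" "0 \<le> s \<Longrightarrow> 0 \<le> nuC P s"
  using material by (auto simp: mqs_material_def)

lemma bh_lipschitz: "0 \<le> s \<Longrightarrow> 0 \<le> t \<Longrightarrow> \<bar>bh s - bh t\<bar> \<le> Lnu * \<bar>s - t\<bar>"
  using lipschitz_onD[OF Lnu(2), of s t] by (simp add: dist_real_def)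

lemma bh_bound: "0 \<le> s \<Longrightarrow> bh s \<le> Lnu * s"
  using bh_lipschitz[of s 0] by simp

lemma bh_mono: assumes "0 \<le> s" "s \<le> t" shows "bh s \<le> bh t"
proof (cases "s = t")
  case False
  obtain mm where "mm > 0" "\<forall>s\<ge>0. \<forall>t\<ge>0. (bh s - bh t) * (s - t) \<ge> mm * (s - t)\<^sup>2"
    using material unfolding mqs_material_def by blast
  with assms have "(bh t - bh s) * (t - s) \<ge> mm * (t - s)\<^sup>2" "mm * (t - s)\<^sup>2 \<ge> 0" by auto
  then have "0 \<le> (bh t - bh s) * (t - s)" by linarith
  then show ?thesis using False assms by (auto simp: zero_le_mult_iff)
qed simp

lemma OmC_OmI_disjoint: "x \<in> OmC P \<Longrightarrow> x \<notin> OmI P"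
  using closure_subset by (auto simp: OmI_def)

definition "numax = Lnu + nuC P 0 + nuI P"

lemma nu_bounds: assumes "0 \<le> s" shows "0 \<le> nu P x s" "nu P x s \<le> numax"
proof -
  show "0 \<le> nu P x s" using nu_pos(1) nu_pos(3)[OF assms] by (simp add: nu_def)
  have "nuC P s \<le> Lnu + nuC P 0"
  proof (cases "s = 0")
    case False
    then have "nuC P s * s \<le> Lnu * s" "0 < s" using bh_bound assms by auto
    then show ?thesis using nu_pos(3)[of 0] by simp
  qed (use Lnu in simp)
  moreover have "0 \<le> Lnu + nuC P 0" using Lnu(1) nu_pos(3)[of 0] by simp
  ultimately show "nu P x s \<le> numax"
    using nu_pos(1) by (auto simp: nu_def numax_def indicator_def OmC_OmI_disjoint)
qed

lemma indicator_measurable: "indicat_real (OmC P) \<in> borel_measurable (lebesgue_on (Om P))"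
  "indicat_real (OmI P) \<in> borel_measurable (lebesgue_on (Om P))"
proof -
  have "OmC P \<in> sets lebesgue" "OmI P \<in> sets lebesgue"
    using OmC(1) Om by (auto simp: OmI_def)
  then show "indicat_real (OmC P) \<in> borel_measurable (lebesgue_on (Om P))"
    "indicat_real (OmI P) \<in> borel_measurable (lebesgue_on (Om P))"
    by (intro measurable_restrict_space1 borel_measurable_indicator; simp)+
qed

lemma nu_measurable: "(\<lambda>x. nu P x (norm (curl_field a x))) \<in> borel_measurable (lebesgue_on (Om P))"
proof -
  have "(\<lambda>x. norm (curl_field a x)) \<in> lebesgue_on (Om P) \<rightarrow>\<^sub>M restrict_space borel {0..}"
    by (intro measurable_restrict_space2 curl_field_measurable) simp
  moreover have "nuC P \<in> borel_measurable (restrict_space borel {0..})"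
    using material by (simp add: mqs_material_def)
  ultimately have "(\<lambda>x. nuC P (norm (curl_field a x))) \<in> borel_measurable (lebesgue_on (Om P))"
    by (rule measurable_compose)
  then show ?thesis unfolding nu_def
    by (intro borel_measurable_add borel_measurable_times indicator_measurable) auto
qed

text \<open>The magnetic field as a function of the flux density \<open>v\<close> at the point \<open>x\<close>.\<close>

definition "H x v = nu P x (norm v) *\<^sub>R (v :: R3)"

text \<open>In the conductor, with \<open>s = |v|\<close> and \<open>t = |w| > 0\<close>, the difference is \<open>\<nu>\<^sub>C(t) (v - w) + (\<nu>\<^sub>C(s) - \<nu>\<^sub>C(t)) v\<close>.
  The first factor is at most \<open>Lnu\<close>, and \<open>(\<nu>\<^sub>C(s) - \<nu>\<^sub>C(t)) s\<close> is the increment of \<open>\<nu>\<^sub>C(s) s\<close> minus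
  \<open>\<nu>\<^sub>C(t) (s - t)\<close>.\<close>

lemma H_lipschitz: "norm (H x v - H x w) \<le> (3 * Lnu + nuI P) * norm (v - w)"
proof -
  have C: "norm (nuC P (norm v) *\<^sub>R v - nuC P (norm w) *\<^sub>R w) \<le> 3 * Lnu * norm (v - w)" if "w \<noteq> 0"
  proof -
    define s t where "s = norm v" and "t = norm w"
    have t: "0 < t" "0 \<le> s" using that by (auto simp: s_def t_def)
    have st: "\<bar>s - t\<bar> \<le> norm (v - w)" unfolding s_def t_def by (rule norm_triangle_ineq3)
    have le: "nuC P t \<le> Lnu" using bh_bound[of t] t by simp
    have "nuC P s *\<^sub>R v - nuC P t *\<^sub>R w = nuC P t *\<^sub>R (v - w) + (nuC P s - nuC P t) *\<^sub>R v"
      by (simp add: algebra_simps)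
    then have 1: "norm (nuC P s *\<^sub>R v - nuC P t *\<^sub>R w) \<le> nuC P t * norm (v - w) + \<bar>nuC P s - nuC P t\<bar> * s"
      using norm_triangle_ineq[of "nuC P t *\<^sub>R (v - w)" "(nuC P s - nuC P t) *\<^sub>R v"] nu_pos(3)[of t] t
      by (simp add: s_def)
    have "\<bar>nuC P s - nuC P t\<bar> * s = \<bar>(nuC P s - nuC P t) * s\<bar>" using t by (simp add: abs_mult)
    also have "(nuC P s - nuC P t) * s = (bh s - bh t) - nuC P t * (s - t)" by (simp add: algebra_simps)
    also have "\<bar>\<dots>\<bar> \<le> \<bar>bh s - bh t\<bar> + \<bar>nuC P t * (s - t)\<bar>" by (rule abs_triangle_ineq4)
    also have "\<bar>nuC P t * (s - t)\<bar> = nuC P t * \<bar>s - t\<bar>" using nu_pos(3)[of t] t by (simp add: abs_mult)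
    finally have "\<bar>nuC P s - nuC P t\<bar> * s \<le> Lnu * \<bar>s - t\<bar> + Lnu * \<bar>s - t\<bar>"
      using bh_lipschitz[of s t] t mult_right_mono[OF le, of "\<bar>s - t\<bar>"] by linarith
    moreover have "Lnu * \<bar>s - t\<bar> \<le> Lnu * norm (v - w)" using st Lnu(1) by simp
    moreover have "nuC P t * norm (v - w) \<le> Lnu * norm (v - w)" using le by (rule mult_right_mono) simp
    ultimately show ?thesis using 1 unfolding s_def t_def by linarith
  qed
  have C': "norm (nuC P (norm v) *\<^sub>R v - nuC P (norm w) *\<^sub>R w) \<le> 3 * Lnu * norm (v - w)"
  proof (cases "w = 0")
    case True
    have "norm (nuC P (norm v) *\<^sub>R v) \<le> Lnu * norm v"
      using bh_bound[of "norm v"] nu_pos(3)[of "norm v"] by simp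
    also have "\<dots> \<le> 3 * Lnu * norm v" using Lnu(1) by (simp add: mult_right_mono)
    finally show ?thesis using True by simp
  qed (rule C)
  have nonneg: "0 \<le> 3 * Lnu * norm (v - w)" "0 \<le> nuI P * norm (v - w)" using Lnu(1) nu_pos(1) by auto
  consider "x \<in> OmC P" "x \<notin> OmI P" | "x \<notin> OmC P" "x \<in> OmI P" | "x \<notin> OmC P" "x \<notin> OmI P"
    using OmC_OmI_disjoint by blast
  then show ?thesis
  proof cases
    case 1
    then show ?thesis using C' nonneg by (simp add: H_def nu_def distrib_right)
  next
    case 2
    have "norm (nuI P *\<^sub>R v - nuI P *\<^sub>R w) = nuI P * norm (v - w)"
      using nu_pos(1) by (simp flip: scaleR_diff_right)
    then show ?thesis using 2 nonneg by (simp add: H_def nu_def distrib_right)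
  next
    case 3
    then show ?thesis using nonneg by (simp add: H_def nu_def distrib_right)
  qed
qed

text \<open>The energy density in the conductor, as a function of the modulus of the flux density.\<close>

definition "thC s = integral {0..s} bh"

lemma bh_integrable: "0 \<le> s \<Longrightarrow> bh integrable_on {s..t}"
  using continuous_on_subset[OF lipschitz_on_continuous_on[OF Lnu(2)], of "{s..t}"]
  by (intro integrable_continuous_real) auto

lemma thC_diff: "0 \<le> s \<Longrightarrow> s \<le> t \<Longrightarrow> thC t - thC s = integral {s..t} bh"
  unfolding thC_def
  using Henstock_Kurzweil_Integration.integral_combine[of 0 s t bh] bh_integrable[of 0 t] by simp

lemma thC_subgrad: assumes "0 \<le> s" "0 \<le> t" shows "thC t - thC s \<le> bh t * (t - s)"
proof (cases "s \<le> t")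
  case True
  have "integral {s..t} bh \<le> integral {s..t} (\<lambda>_. bh t)"
    using assms True by (intro integral_le bh_integrable) (auto intro: bh_mono)
  then show ?thesis using thC_diff[OF assms(1) True] True by (simp add: mult_ac)
next
  case False
  have "integral {t..s} (\<lambda>_. bh t) \<le> integral {t..s} bh"
    using assms False by (intro integral_le bh_integrable) (auto intro: bh_mono)
  then show ?thesis using thC_diff[OF assms(2), of s] False by (simp add: algebra_simps)
qed

lemma thC_mono: "0 \<le> s \<Longrightarrow> s \<le> t \<Longrightarrow> thC s \<le> thC t"
  using thC_subgrad[of t s] nu_pos(3)[of s] by (smt (verit) mult_nonneg_nonpos mult_nonneg_nonneg)

lemma thC_0: "thC 0 = 0" by (simp add: thC_def)

lemma thC_bounds: assumes "0 \<le> s" shows "0 \<le> thC s" "thC s \<le> Lnu * s\<^sup>2"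
proof -
  show "0 \<le> thC s" using thC_mono[of 0 s] assms by (simp add: thC_0)
  have "thC s \<le> bh s * s" using thC_subgrad[of 0 s] assms by (simp add: thC_0)
  also have "\<dots> \<le> Lnu * s * s" using bh_bound[OF assms] assms by (rule mult_right_mono)
  finally show "thC s \<le> Lnu * s\<^sup>2" by (simp add: power2_eq_square mult.assoc)
qed

definition "theta x v = thC (norm v) * indicat_real (OmC P) x + nuI P / 2 * (norm (v :: R3))\<^sup>2 * indicat_real (OmI P) x"

text \<open>\<open>H\<close> is the gradient of the energy density.  In the conductor the density depends on the modulus
  only, so convexity in the modulus and the Cauchy-Schwarz inequality suffice.\<close>

lemma theta_subgrad: "theta x v - theta x w \<le> inner (H x v) (v - w)"
proof -
  have CS: "inner v w \<le> norm v * norm w" by (rule norm_cauchy_schwarz)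
  have C: "thC (norm v) - thC (norm w) \<le> inner (nuC P (norm v) *\<^sub>R v) (v - w)"
  proof -
    have "thC (norm v) - thC (norm w) \<le> nuC P (norm v) * (norm v * (norm v - norm w))"
      using thC_subgrad[of "norm w" "norm v"] by (simp add: mult.assoc)
    also have "\<dots> \<le> nuC P (norm v) * inner v (v - w)"
      using CS nu_pos(3)[of "norm v"]
      by (intro mult_left_mono) (auto simp: inner_diff_right right_diff_distrib power2_norm_eq_inner[symmetric] power2_eq_square)
    finally show ?thesis by simp
  qed
  have I: "nuI P / 2 * (norm v)\<^sup>2 - nuI P / 2 * (norm w)\<^sup>2 \<le> inner (nuI P *\<^sub>R v) (v - w)"
  proof -
    have "0 \<le> inner (v - w) (v - w)" by simp
    then have "(norm v)\<^sup>2 - (norm w)\<^sup>2 \<le> 2 * inner v (v - w)"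
      by (simp add: power2_norm_eq_inner inner_diff_left inner_diff_right inner_commute[of w v])
    then have "nuI P / 2 * ((norm v)\<^sup>2 - (norm w)\<^sup>2) \<le> nuI P / 2 * (2 * inner v (v - w))"
      using nu_pos(1) by (intro mult_left_mono) auto
    then show ?thesis by (simp add: right_diff_distrib)
  qed
  consider "x \<in> OmC P" "x \<notin> OmI P" | "x \<notin> OmC P" "x \<in> OmI P" | "x \<notin> OmC P" "x \<notin> OmI P"
    using OmC_OmI_disjoint by blast
  then show ?thesis
    by cases (use C I in \<open>simp_all add: theta_def H_def nu_def\<close>)
qed

lemma theta_nonneg: "0 \<le> theta x v"
  using thC_bounds(1)[of "norm v"] nu_pos(1) by (simp add: theta_def)

text \<open>The density grows at most quadratically and the field is square integrable.\<close>

lemma theta_integrable: "integrable (lebesgue_on (Om P)) (\<lambda>x. theta x (curl_field a x))"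
proof (rule Bochner_Integration.integrable_bound)
  show "integrable (lebesgue_on (Om P)) (\<lambda>x. (Lnu + nuI P) * (norm (curl_field a x))\<^sup>2)"
    using curl_field_L2[of a] by (intro integrable_mult_right) (auto simp: L2_on_def)
  have "mono (\<lambda>s. thC (max 0 s))" by (intro monoI thC_mono) auto
  then have "(\<lambda>s. thC (max 0 s)) \<in> borel_measurable borel" by (rule borel_measurable_mono)
  moreover have n: "(\<lambda>x. norm (curl_field a x)) \<in> borel_measurable (lebesgue_on (Om P))"
    by (rule curl_field_measurable)
  ultimately have "(\<lambda>x. thC (max 0 (norm (curl_field a x)))) \<in> borel_measurable (lebesgue_on (Om P))"
    by (rule measurable_compose[rotated])
  then show "(\<lambda>x. theta x (curl_field a x)) \<in> borel_measurable (lebesgue_on (Om P))"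
    unfolding theta_def
    by (intro borel_measurable_add borel_measurable_times indicator_measurable borel_measurable_power n) auto
  show "AE x in lebesgue_on (Om P). norm (theta x (curl_field a x)) \<le> norm ((Lnu + nuI P) * (norm (curl_field a x))\<^sup>2)"
  proof (rule AE_I2)
    fix x
    have "thC (norm (curl_field a x)) \<le> Lnu * (norm (curl_field a x))\<^sup>2" by (simp add: thC_bounds)
    moreover have "nuI P / 2 * (norm (curl_field a x))\<^sup>2 \<le> nuI P * (norm (curl_field a x))\<^sup>2"
      using nu_pos(1) by (intro mult_right_mono) auto
    moreover have "0 \<le> Lnu * (norm (curl_field a x))\<^sup>2" "0 \<le> nuI P * (norm (curl_field a x))\<^sup>2"
      using Lnu(1) nu_pos(1) by auto
    ultimately have "theta x (curl_field a x) \<le> (Lnu + nuI P) * (norm (curl_field a x))\<^sup>2"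
      unfolding theta_def distrib_right by (intro add_mono) (auto simp: indicator_def)
    then show "norm (theta x (curl_field a x)) \<le> norm ((Lnu + nuI P) * (norm (curl_field a x))\<^sup>2)"
      using theta_nonneg[of x "curl_field a x"] by simp
  qed
qed

subsection \<open>The stiffness matrix as a form\<close>

definition "Kform a b c = integral\<^sup>L (lebesgue_on (Om P))
    (\<lambda>x. nu P x (norm (curl_field a x)) * inner (curl_field b x) (curl_field c x))"

lemma nu_inner_integrable:
  assumes "L2_on (Om P) f" "L2_on (Om P) g"
  shows "integrable (lebesgue_on (Om P)) (\<lambda>x. nu P x (norm (curl_field a x)) * inner (f x) (g x))"
  by (rule L2_inner_integrable[OF assms nu_measurable, of _ numax]) (use nu_bounds in auto)

lemma Kmat_entry:
  assumes "k < ne P" "l < ne P"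
  shows "Kmat P a $$ (k, l) = integral\<^sup>L (lebesgue_on (Om P))
    (\<lambda>x. nu P x (norm (curl_field a x)) * inner (curl (phi P l) x) (curl (phi P k) x))"
proof -
  have "Kmat P a $$ (k, l) = integral\<^sup>L (lebesgue_on (Om P)) (\<lambda>x.
       nu P x (norm (curl (\<lambda>x. \<Sum>j<ne P. (a $ j) *\<^sub>R phi P j x) x)) * inner (curl (phi P l) x) (curl (phi P k) x))"
    using assms by (simp add: Kmat_def)
  also have "\<dots> = integral\<^sup>L (lebesgue_on (Om P))
    (\<lambda>x. nu P x (norm (curl_field a x)) * inner (curl (phi P l) x) (curl (phi P k) x))"
  proof (rule integral_lebesgue_on_cong_AE[OF Om(2)])
    show "(\<lambda>x. nu P x (norm (curl_field a x)) * inner (curl (phi P l) x) (curl (phi P k) x))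
        \<in> borel_measurable (lebesgue_on (Om P))"
      by (rule borel_measurable_integrable[OF nu_inner_integrable[OF curl_L2 curl_L2, OF assms(2,1)]])
    show "AE x in lebesgue_on (Om P). nu P x (norm (curl_field a x)) * inner (curl (phi P l) x) (curl (phi P k) x) =
      nu P x (norm (curl (\<lambda>x. \<Sum>j<ne P. (a $ j) *\<^sub>R phi P j x) x)) * inner (curl (phi P l) x) (curl (phi P k) x)"
      using AE_resolved by (rule eventually_mono) (simp only: resolved_curl_of_sum)
  qed
  finally show ?thesis .
qed

lemma Kform_eq_sum: "Kform a b c = (\<Sum>k<ne P. (\<Sum>l<ne P. Kmat P a $$ (k, l) * b $ l) * c $ k)"
proof -
  have "nu P x (norm (curl_field a x)) * inner (curl_field b x) (curl_field c x) =
      (\<Sum>k<ne P. \<Sum>l<ne P. (b $ l * c $ k) * (nu P x (norm (curl_field a x)) * inner (curl (phi P l) x) (curl (phi P k) x)))" for x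
  proof -
    have "inner (curl_field b x) (curl_field c x) =
        (\<Sum>k<ne P. \<Sum>l<ne P. (b $ l * c $ k) * inner (curl (phi P l) x) (curl (phi P k) x))"
      unfolding curl_field_def inner_sum_right inner_sum_left by (simp add: mult_ac)
    then show ?thesis by (simp add: sum_distrib_left mult_ac)
  qed
  then have "Kform a b c = integral\<^sup>L (lebesgue_on (Om P)) (\<lambda>x. \<Sum>k<ne P. \<Sum>l<ne P.
      (b $ l * c $ k) * (nu P x (norm (curl_field a x)) * inner (curl (phi P l) x) (curl (phi P k) x)))"
    by (simp only: Kform_def)
  also have "\<dots> = (\<Sum>k<ne P. \<Sum>l<ne P. integral\<^sup>L (lebesgue_on (Om P))
      (\<lambda>x. (b $ l * c $ k) * (nu P x (norm (curl_field a x)) * inner (curl (phi P l) x) (curl (phi P k) x))))"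
    by (subst Bochner_Integration.integral_sum, intro Bochner_Integration.integrable_sum integrable_mult_right nu_inner_integrable curl_L2, simp, simp,
        intro sum.cong refl Bochner_Integration.integral_sum integrable_mult_right nu_inner_integrable curl_L2) simp_all
  also have "\<dots> = (\<Sum>k<ne P. \<Sum>l<ne P. (b $ l * c $ k) * Kmat P a $$ (k, l))"
    by (intro sum.cong refl) (simp add: Kmat_entry)
  finally have "Kform a b c = (\<Sum>k<ne P. \<Sum>l<ne P. (b $ l * c $ k) * Kmat P a $$ (k, l))" .
  then show ?thesis by (simp add: sum_distrib_left mult_ac)
qed

text \<open>The field strength influences the reluctivity in the conductor only.\<close>

lemma Kmat_cong:
  assumes kl: "k < ne P" "l < ne P"
    and eq: "\<And>x. resolved x \<Longrightarrow> x \<in> OmC P \<Longrightarrow> norm (curl_field a x) = norm (curl_field b x) \<or>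
      curl (phi P l) x = 0 \<or> curl (phi P k) x = 0"
  shows "Kmat P a $$ (k, l) = Kmat P b $$ (k, l)"
  unfolding Kmat_entry[OF kl]
proof (rule integral_lebesgue_on_cong_AE[OF Om(2)])
  show "AE x in lebesgue_on (Om P). nu P x (norm (curl_field b x)) * inner (curl (phi P l) x) (curl (phi P k) x) =
      nu P x (norm (curl_field a x)) * inner (curl (phi P l) x) (curl (phi P k) x)"
    using AE_resolved
  proof (rule eventually_mono)
    fix x assume r: "resolved x"
    show "nu P x (norm (curl_field b x)) * inner (curl (phi P l) x) (curl (phi P k) x) =
      nu P x (norm (curl_field a x)) * inner (curl (phi P l) x) (curl (phi P k) x)"
    proof (cases "x \<in> OmC P")
      case True
      from eq[OF r True] show ?thesis by auto
    qed (simp add: nu_def)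
  qed
qed (rule borel_measurable_integrable[OF nu_inner_integrable[OF curl_L2 curl_L2, OF kl(2,1)]])

text \<open>Only the first block of \<open>K(a)\<close> depends on \<open>a\<close>, since non-conducting edge functions do not
  contribute in the conductor.\<close>

lemma Kmat_nonconducting:
  assumes "k < ne P" "l < ne P" "n1 P \<le> k \<or> n1 P \<le> l"
  shows "Kmat P a $$ (k, l) = Kmat P b $$ (k, l)"
  using assms resolved_nonconducting_curl closure_subset by (intro Kmat_cong) blast+

text \<open>For the same reason the field in the conductor depends on the conducting coefficients only.\<close>

lemma curl_field_conducting:
  assumes "resolved x" "x \<in> OmC P" "\<And>j. j < n1 P \<Longrightarrow> a $ j = b $ j"
  shows "curl_field a x = curl_field b x"
  unfolding curl_field_def
proof (intro sum.cong refl)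
  fix j assume "j \<in> {..<ne P}"
  then show "(a $ j) *\<^sub>R curl (phi P j) x = (b $ j) *\<^sub>R curl (phi P j) x"
    using assms resolved_nonconducting_curl[OF assms(1), of j] closure_subset by (cases "j < n1 P") auto
qed

lemma Kmat_conducting:
  assumes "k < ne P" "l < ne P" "\<And>j. j < n1 P \<Longrightarrow> a $ j = b $ j"
  shows "Kmat P a $$ (k, l) = Kmat P b $$ (k, l)"
  using assms curl_field_conducting[of _ a b] by (intro Kmat_cong) auto

lemma Kmat_sym: "k < ne P \<Longrightarrow> l < ne P \<Longrightarrow> Kmat P a $$ (k, l) = Kmat P a $$ (l, k)"
  by (simp add: Kmat_def inner_commute)

lemma n12: "n1 P + n2 P = ne P" using mesh(6) by simp

lemma K12_transpose: "(K12 P)\<^sup>T = K21 P"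
  by (intro eq_matI) (auto simp: K12_def K21_def intro!: Kmat_sym)

lemma K22_sym: "(K22 P)\<^sup>T = K22 P"
  by (intro eq_matI) (auto simp: K22_def intro!: Kmat_sym)

lemma block_force1:
  assumes a: "a1 \<in> carrier_vec (n1 P)" "a2 \<in> carrier_vec (n2 P)" and k: "k < n1 P"
  shows "(K11 P a1 *\<^sub>v a1 + K12 P *\<^sub>v a2) $ k = (\<Sum>l<ne P. Kmat P (a1 @\<^sub>v a2) $$ (k, l) * (a1 @\<^sub>v a2) $ l)"
proof -
  have c: "K11 P a1 \<in> carrier_mat (n1 P) (n1 P)" "K12 P \<in> carrier_mat (n1 P) (n2 P)" by (auto simp: K11_def K12_def)
  have "(K11 P a1 *\<^sub>v a1 + K12 P *\<^sub>v a2) $ k = (\<Sum>l<n1 P. K11 P a1 $$ (k, l) * a1 $ l) + (\<Sum>l<n2 P. K12 P $$ (k, l) * a2 $ l)"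
    using mult_mat_vec_nth[OF c(1) a(1) k] mult_mat_vec_nth[OF c(2) a(2) k] c k by simp
  also have "(\<Sum>l<n1 P. K11 P a1 $$ (k, l) * a1 $ l) = (\<Sum>l<n1 P. Kmat P (a1 @\<^sub>v a2) $$ (k, l) * (a1 @\<^sub>v a2) $ l)"
  proof (intro sum.cong refl arg_cong2[where f = "(*)"])
    fix l assume l: "l \<in> {..<n1 P}"
    have "K11 P a1 $$ (k, l) = Kmat P (a1 @\<^sub>v 0\<^sub>v (n2 P)) $$ (k, l)" using k l by (simp add: K11_def)
    also have "\<dots> = Kmat P (a1 @\<^sub>v a2) $$ (k, l)"
      using k l a mesh(6) by (intro Kmat_conducting) auto
    finally show "K11 P a1 $$ (k, l) = Kmat P (a1 @\<^sub>v a2) $$ (k, l)" .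
  qed (use a in auto)
  also have "(\<Sum>l<n2 P. K12 P $$ (k, l) * a2 $ l) = (\<Sum>l<n2 P. Kmat P (a1 @\<^sub>v a2) $$ (k, n1 P + l) * (a1 @\<^sub>v a2) $ (n1 P + l))"
  proof (intro sum.cong refl arg_cong2[where f = "(*)"])
    fix l assume l: "l \<in> {..<n2 P}"
    have "K12 P $$ (k, l) = Kmat P (0\<^sub>v (ne P)) $$ (k, n1 P + l)" using k l by (simp add: K12_def)
    also have "\<dots> = Kmat P (a1 @\<^sub>v a2) $$ (k, n1 P + l)"
      using k l mesh(6) by (intro Kmat_nonconducting) auto
    finally show "K12 P $$ (k, l) = Kmat P (a1 @\<^sub>v a2) $$ (k, n1 P + l)" .
  qed (use a in auto)
  also note sum_lessThan_add[of "\<lambda>l. Kmat P (a1 @\<^sub>v a2) $$ (k, l) * (a1 @\<^sub>v a2) $ l" "n1 P" "n2 P", symmetric]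
  finally show ?thesis by (simp only: n12)
qed

lemma block_force2:
  assumes a: "a1 \<in> carrier_vec (n1 P)" "a2 \<in> carrier_vec (n2 P)" and k: "k < n2 P"
  shows "(K21 P *\<^sub>v a1 + K22 P *\<^sub>v a2) $ k = (\<Sum>l<ne P. Kmat P (a1 @\<^sub>v a2) $$ (n1 P + k, l) * (a1 @\<^sub>v a2) $ l)"
proof -
  have c: "K21 P \<in> carrier_mat (n2 P) (n1 P)" "K22 P \<in> carrier_mat (n2 P) (n2 P)" by (auto simp: K21_def K22_def)
  have "(K21 P *\<^sub>v a1 + K22 P *\<^sub>v a2) $ k = (\<Sum>l<n1 P. K21 P $$ (k, l) * a1 $ l) + (\<Sum>l<n2 P. K22 P $$ (k, l) * a2 $ l)"
    using mult_mat_vec_nth[OF c(1) a(1) k] mult_mat_vec_nth[OF c(2) a(2) k] c k by simp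
  also have "(\<Sum>l<n1 P. K21 P $$ (k, l) * a1 $ l) = (\<Sum>l<n1 P. Kmat P (a1 @\<^sub>v a2) $$ (n1 P + k, l) * (a1 @\<^sub>v a2) $ l)"
  proof (intro sum.cong refl arg_cong2[where f = "(*)"])
    fix l assume l: "l \<in> {..<n1 P}"
    have "K21 P $$ (k, l) = Kmat P (0\<^sub>v (ne P)) $$ (n1 P + k, l)" using k l by (simp add: K21_def)
    also have "\<dots> = Kmat P (a1 @\<^sub>v a2) $$ (n1 P + k, l)"
      using k l mesh(6) by (intro Kmat_nonconducting) auto
    finally show "K21 P $$ (k, l) = Kmat P (a1 @\<^sub>v a2) $$ (n1 P + k, l)" .
  qed (use a in auto)
  also have "(\<Sum>l<n2 P. K22 P $$ (k, l) * a2 $ l) = (\<Sum>l<n2 P. Kmat P (a1 @\<^sub>v a2) $$ (n1 P + k, n1 P + l) * (a1 @\<^sub>v a2) $ (n1 P + l))"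
  proof (intro sum.cong refl arg_cong2[where f = "(*)"])
    fix l assume l: "l \<in> {..<n2 P}"
    have "K22 P $$ (k, l) = Kmat P (0\<^sub>v (ne P)) $$ (n1 P + k, n1 P + l)" using k l by (simp add: K22_def)
    also have "\<dots> = Kmat P (a1 @\<^sub>v a2) $$ (n1 P + k, n1 P + l)"
      using k l mesh(6) by (intro Kmat_nonconducting) auto
    finally show "K22 P $$ (k, l) = Kmat P (a1 @\<^sub>v a2) $$ (n1 P + k, n1 P + l)" .
  qed (use a in auto)
  also note sum_lessThan_add[of "\<lambda>l. Kmat P (a1 @\<^sub>v a2) $$ (n1 P + k, l) * (a1 @\<^sub>v a2) $ l" "n1 P" "n2 P", symmetric]
  finally show ?thesis by (simp only: n12)
qed

text \<open>The block form of the model is the stiffness form of the whole mesh.\<close>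

lemma block_power:
  assumes a: "a1 \<in> carrier_vec (n1 P)" "a2 \<in> carrier_vec (n2 P)"
    and b: "b1 \<in> carrier_vec (n1 P)" "b2 \<in> carrier_vec (n2 P)"
  shows "(K11 P a1 *\<^sub>v a1 + K12 P *\<^sub>v a2) \<bullet> b1 + (K21 P *\<^sub>v a1 + K22 P *\<^sub>v a2) \<bullet> b2
    = Kform (a1 @\<^sub>v a2) (a1 @\<^sub>v a2) (b1 @\<^sub>v b2)"
proof -
  have "(K11 P a1 *\<^sub>v a1 + K12 P *\<^sub>v a2) \<bullet> b1 =
      (\<Sum>k<n1 P. (\<Sum>l<ne P. Kmat P (a1 @\<^sub>v a2) $$ (k, l) * (a1 @\<^sub>v a2) $ l) * (b1 @\<^sub>v b2) $ k)"
    unfolding scalar_prod_sum[OF b(1)] using b by (intro sum.cong refl) (simp only: block_force1[OF a] lessThan_iff, auto)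
  moreover have "(K21 P *\<^sub>v a1 + K22 P *\<^sub>v a2) \<bullet> b2 =
      (\<Sum>k<n2 P. (\<Sum>l<ne P. Kmat P (a1 @\<^sub>v a2) $$ (n1 P + k, l) * (a1 @\<^sub>v a2) $ l) * (b1 @\<^sub>v b2) $ (n1 P + k))"
    unfolding scalar_prod_sum[OF b(2)] using b by (intro sum.cong refl) (simp only: block_force2[OF a] lessThan_iff, auto)
  ultimately show ?thesis
    unfolding Kform_eq_sum
    using sum_lessThan_add[of "\<lambda>k. (\<Sum>l<ne P. Kmat P (a1 @\<^sub>v a2) $$ (k, l) * (a1 @\<^sub>v a2) $ l) * (b1 @\<^sub>v b2) $ k" "n1 P" "n2 P"]
    by (simp only: n12)
qed

definition "energy a1 a2 = integral\<^sup>L (lebesgue_on (Om P)) (\<lambda>x. theta x (curl_field (a1 @\<^sub>v a2) x))"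

lemma energy_nonneg: "0 \<le> energy a1 a2"
  unfolding energy_def by (intro integral_nonneg_AE AE_I2 theta_nonneg)

text \<open>Integrate the pointwise subgradient inequality of the energy density.\<close>

lemma energy_subgrad:
  assumes a: "a1 \<in> carrier_vec (n1 P)" "a2 \<in> carrier_vec (n2 P)"
    and b: "b1 \<in> carrier_vec (n1 P)" "b2 \<in> carrier_vec (n2 P)"
  shows "energy a1 a2 - energy b1 b2 \<le> (K11 P a1 *\<^sub>v a1 + K12 P *\<^sub>v a2) \<bullet> (a1 - b1) + (K21 P *\<^sub>v a1 + K22 P *\<^sub>v a2) \<bullet> (a2 - b2)"
proof -
  let ?a = "a1 @\<^sub>v a2" and ?b = "b1 @\<^sub>v b2"
  have c: "?a \<in> carrier_vec (ne P)" "?b \<in> carrier_vec (ne P)"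
    using append_carrier_vec[OF a] append_carrier_vec[OF b] unfolding n12 .
  have d: "(a1 - b1) @\<^sub>v (a2 - b2) = ?a - ?b" using a b by (intro eq_vecI) auto
  have "energy a1 a2 - energy b1 b2 = integral\<^sup>L (lebesgue_on (Om P)) (\<lambda>x. theta x (curl_field ?a x) - theta x (curl_field ?b x))"
    unfolding energy_def by (rule Bochner_Integration.integral_diff[symmetric]) (rule theta_integrable)+
  also have "\<dots> \<le> Kform ?a ?a (?a - ?b)"
    unfolding Kform_def
  proof (rule integral_mono)
    show "theta x (curl_field ?a x) - theta x (curl_field ?b x)
        \<le> nu P x (norm (curl_field ?a x)) * inner (curl_field ?a x) (curl_field (?a - ?b) x)" for x
      using theta_subgrad[of x "curl_field ?a x" "curl_field ?b x"] curl_field_diff[OF c] by (simp add: H_def)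
  qed (intro Bochner_Integration.integrable_diff theta_integrable nu_inner_integrable curl_field_L2)+
  finally show ?thesis using block_power[OF a, of "a1 - b1" "a2 - b2"] a b by (simp add: d)
qed

text \<open>The entries of \<open>K\<^sub>1\<^sub>1(a) a\<close> are integrals of \<open>H\<close> against fixed fields, hence Lipschitz continuous in
  \<open>a\<close>.\<close>

lemma K11_continuous:
  assumes f: "continuous_vec (n1 P) T f"
  shows "continuous_vec (n1 P) T (\<lambda>t. K11 P (f t) *\<^sub>v f t)"
proof (rule continuous_vecI)
  show "dim_vec (K11 P (f t) *\<^sub>v f t) = n1 P" for t by (simp add: K11_def)
  fix k assume k: "k < n1 P"
  then have kne: "k < ne P" using mesh(6) by simp
  let ?z = "0\<^sub>v (n2 P)"
  define G where "G a = integral\<^sup>L (lebesgue_on (Om P)) (\<lambda>x. inner (H x (curl_field (a @\<^sub>v ?z) x)) (curl (phi P k) x))" for a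
  have Hi: "integrable (lebesgue_on (Om P)) (\<lambda>x. inner (H x (curl_field a x)) (curl (phi P k) x))" for a
    using nu_inner_integrable[OF curl_field_L2[of a] curl_L2[OF kne], of a] by (simp add: H_def)
  have eq: "(K11 P a *\<^sub>v a) $ k = G a" if a: "a \<in> carrier_vec (n1 P)" for a
  proof -
    have "(K11 P a *\<^sub>v a) $ k = (K11 P a *\<^sub>v a + K12 P *\<^sub>v ?z) $ k"
      using k a by (simp add: K11_def K12_def)
    also have "\<dots> = (\<Sum>l<ne P. Kmat P (a @\<^sub>v ?z) $$ (k, l) * (a @\<^sub>v ?z) $ l)" by (rule block_force1[OF a _ k]) simp
    also have "\<dots> = Kform (a @\<^sub>v ?z) (a @\<^sub>v ?z) (unit_vec (ne P) k)"
      unfolding Kform_eq_sum using kne by (subst sum.remove[of _ k]) (auto intro!: sum.neutral)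
    also have "curl_field (unit_vec (ne P) k) = curl (phi P k)"
    proof
      fix x
      show "curl_field (unit_vec (ne P) k) x = curl (phi P k) x"
        unfolding curl_field_def using kne by (subst sum.remove[of _ k]) (auto intro!: sum.neutral)
    qed
    then have "Kform (a @\<^sub>v ?z) (a @\<^sub>v ?z) (unit_vec (ne P) k) = G a" by (simp add: Kform_def G_def H_def)
    finally show ?thesis .
  qed
  define c where "c j = (3 * Lnu + nuI P) * integral\<^sup>L (lebesgue_on (Om P)) (\<lambda>x. norm (curl (phi P j) x) * norm (curl (phi P k) x))" for j
  have lip: "\<bar>G a - G b\<bar> \<le> (\<Sum>j<n1 P. c j * \<bar>a $ j - b $ j\<bar>)"
    if a: "a \<in> carrier_vec (n1 P)" and b: "b \<in> carrier_vec (n1 P)" for a b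
  proof -
    let ?a = "a @\<^sub>v ?z" and ?b = "b @\<^sub>v ?z"
    have L0: "0 \<le> 3 * Lnu + nuI P" using Lnu(1) nu_pos(1) by simp
    have cd: "curl_field ?a x - curl_field ?b x = (\<Sum>j<n1 P. (a $ j - b $ j) *\<^sub>R curl (phi P j) x)" for x
    proof -
      have "curl_field ?a x - curl_field ?b x = (\<Sum>j<n1 P + n2 P. (?a $ j - ?b $ j) *\<^sub>R curl (phi P j) x)"
        unfolding n12 by (simp add: curl_field_def scaleR_diff_left sum_subtractf)
      also have "\<dots> = (\<Sum>j<n1 P. (?a $ j - ?b $ j) *\<^sub>R curl (phi P j) x)"
        unfolding sum_lessThan_add using a b by simp
      also have "\<dots> = (\<Sum>j<n1 P. (a $ j - b $ j) *\<^sub>R curl (phi P j) x)" using a b by (intro sum.cong) auto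
      finally show ?thesis .
    qed
    have ii: "integrable (lebesgue_on (Om P)) (\<lambda>x. norm (curl (phi P j) x) * norm (curl (phi P k) x))" if "j < n1 P" for j
      using that mesh(6) by (intro L2_norm_integrable curl_L2 kne) simp
    have Gd: "G a - G b = integral\<^sup>L (lebesgue_on (Om P)) (\<lambda>x. inner (H x (curl_field ?a x)) (curl (phi P k) x) - inner (H x (curl_field ?b x)) (curl (phi P k) x))"
      unfolding G_def by (rule Bochner_Integration.integral_diff[symmetric]) (rule Hi)+
    have "norm (G a - G b) \<le> integral\<^sup>L (lebesgue_on (Om P)) (\<lambda>x. \<Sum>j<n1 P. ((3 * Lnu + nuI P) * \<bar>a $ j - b $ j\<bar>) * (norm (curl (phi P j) x) * norm (curl (phi P k) x)))"
      unfolding Gd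
    proof (rule Bochner_Integration.integral_norm_bound_integral)
      show "integrable (lebesgue_on (Om P)) (\<lambda>x. inner (H x (curl_field ?a x)) (curl (phi P k) x) - inner (H x (curl_field ?b x)) (curl (phi P k) x))"
        by (rule Bochner_Integration.integrable_diff[OF Hi Hi])
      show "integrable (lebesgue_on (Om P)) (\<lambda>x. \<Sum>j<n1 P. ((3 * Lnu + nuI P) * \<bar>a $ j - b $ j\<bar>) * (norm (curl (phi P j) x) * norm (curl (phi P k) x)))"
        by (rule Bochner_Integration.integrable_sum, rule integrable_mult_right, rule ii) simp
    next
      fix x
      have "norm (inner (H x (curl_field ?a x)) (curl (phi P k) x) - inner (H x (curl_field ?b x)) (curl (phi P k) x))
          \<le> norm (H x (curl_field ?a x) - H x (curl_field ?b x)) * norm (curl (phi P k) x)"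
        unfolding inner_diff_left[symmetric] real_norm_def by (rule Cauchy_Schwarz_ineq2)
      also have "\<dots> \<le> ((3 * Lnu + nuI P) * norm (curl_field ?a x - curl_field ?b x)) * norm (curl (phi P k) x)"
        by (intro mult_right_mono H_lipschitz) simp
      also have "\<dots> \<le> ((3 * Lnu + nuI P) * (\<Sum>j<n1 P. \<bar>a $ j - b $ j\<bar> * norm (curl (phi P j) x))) * norm (curl (phi P k) x)"
        unfolding cd using L0 by (intro mult_right_mono mult_left_mono order_trans[OF norm_sum]) auto
      also have "\<dots> = (\<Sum>j<n1 P. ((3 * Lnu + nuI P) * \<bar>a $ j - b $ j\<bar>) * (norm (curl (phi P j) x) * norm (curl (phi P k) x)))"
        by (simp add: sum_distrib_left sum_distrib_right mult_ac)
      finally show "norm (inner (H x (curl_field ?a x)) (curl (phi P k) x) - inner (H x (curl_field ?b x)) (curl (phi P k) x)) \<le> \<dots>" .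
    qed
    also have "\<dots> = (\<Sum>j<n1 P. integral\<^sup>L (lebesgue_on (Om P)) (\<lambda>x. ((3 * Lnu + nuI P) * \<bar>a $ j - b $ j\<bar>) * (norm (curl (phi P j) x) * norm (curl (phi P k) x))))"
      by (rule Bochner_Integration.integral_sum, rule integrable_mult_right, rule ii) simp
    also have "\<dots> = (\<Sum>j<n1 P. c j * \<bar>a $ j - b $ j\<bar>)"
      unfolding integral_mult_right_zero c_def by (intro sum.cong refl) (simp only: mult_ac)
    finally show ?thesis by (simp only: real_norm_def)
  qed
  have "continuous_on {0..T} (\<lambda>t. G (f t))"
    unfolding continuous_on_def
  proof
    fix s assume s: "s \<in> {0..T}"
    have "((\<lambda>t. \<Sum>j<n1 P. c j * \<bar>f t $ j - f s $ j\<bar>) \<longlongrightarrow> (\<Sum>j<n1 P. c j * \<bar>f s $ j - f s $ j\<bar>)) (at s within {0..T})"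
      using continuous_vecD(2)[OF f] s by (intro tendsto_intros) (auto simp: continuous_on_def)
    then have lim: "((\<lambda>t. \<Sum>j<n1 P. c j * \<bar>f t $ j - f s $ j\<bar>) \<longlongrightarrow> 0) (at s within {0..T})" by simp
    have "((\<lambda>t. G (f t) - G (f s)) \<longlongrightarrow> 0) (at s within {0..T})"
    proof (rule Lim_null_comparison[OF _ lim])
      show "\<forall>\<^sub>F t in at s within {0..T}. norm (G (f t) - G (f s)) \<le> (\<Sum>j<n1 P. c j * \<bar>f t $ j - f s $ j\<bar>)"
        unfolding eventually_at_filter
      proof (intro always_eventually allI impI)
        fix t assume "t \<in> {0..T}"
        then show "norm (G (f t) - G (f s)) \<le> (\<Sum>j<n1 P. c j * \<bar>f t $ j - f s $ j\<bar>)"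
          using lip[of "f t" "f s"] f s by (auto simp: continuous_vec_def)
      qed
    qed
    then show "((\<lambda>t. G (f t)) \<longlongrightarrow> G (f s)) (at s within {0..T})" by (simp add: LIM_zero_iff)
  qed
  moreover have "\<forall>t\<in>{0..T}. (K11 P (f t) *\<^sub>v f t) $ k = G (f t)"
    using eq f by (auto simp: continuous_vec_def)
  ultimately show "\<exists>g. continuous_on {0..T} g \<and> (\<forall>t\<in>{0..T}. (K11 P (f t) *\<^sub>v f t) $ k = g t)" by blast
qed

end

section \<open>Integration by parts for the curl\<close>

lemma L2_on_compact_support:
  fixes f :: "'a::euclidean_space \<Rightarrow> 'b::euclidean_space"
  assumes f: "continuous_on UNIV f" and K: "compact K" "\<And>x. x \<notin> K \<Longrightarrow> f x = 0" and S: "S \<in> sets lebesgue"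
  shows "L2_on S f"
proof -
  have "integrable lborel (\<lambda>x. indicator K x *\<^sub>R (norm (f x))\<^sup>2)"
    by (intro borel_integrable_compact K continuous_intros continuous_on_subset[OF f]) auto
  moreover have "(\<lambda>x. indicator K x *\<^sub>R (norm (f x))\<^sup>2) = (\<lambda>x. (norm (f x))\<^sup>2)"
    using K(2) by (auto simp: indicator_def fun_eq_iff)
  ultimately have "integrable lborel (\<lambda>x. (norm (f x))\<^sup>2)" by simp
  then have "integrable lebesgue (\<lambda>x. (norm (f x))\<^sup>2)"
    by (subst integrable_completion) auto
  then have "integrable (lebesgue_on UNIV) (\<lambda>x. (norm (f x))\<^sup>2)" by (simp add: lebesgue_on_UNIV_eq)
  then have "integrable (lebesgue_on S) (\<lambda>x. (norm (f x))\<^sup>2)"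
    by (rule integrable_lebesgue_on_subset) (simp_all add: S)
  moreover have "f \<in> borel_measurable (lebesgue_on S)"
    using continuous_on_subset[OF f subset_UNIV] S by (rule continuous_imp_measurable_on_sets_lebesgue)
  ultimately show ?thesis by (simp add: L2_on_def)
qed

lemma L2_on_componentwise:
  fixes f :: "'a::euclidean_space \<Rightarrow> 'b::euclidean_space"
  assumes "\<And>b. b \<in> Basis \<Longrightarrow> L2_on S (\<lambda>x. inner (f x) b)"
  shows "L2_on S f"
proof -
  have "(\<lambda>x. \<Sum>b\<in>Basis. (norm (inner (f x) b))\<^sup>2) = (\<lambda>x. (norm (f x))\<^sup>2)"
    unfolding power2_norm_eq_inner euclidean_inner[of "f _" "f _"] by (simp add: power2_eq_square)
  moreover have "integrable (lebesgue_on S) (\<lambda>x. \<Sum>b\<in>Basis. (norm (inner (f x) b))\<^sup>2)"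
    using assms by (intro Bochner_Integration.integrable_sum) (simp add: L2_on_def)
  ultimately have "integrable (lebesgue_on S) (\<lambda>x. (norm (f x))\<^sup>2)" by simp
  moreover have "f \<in> borel_measurable (lebesgue_on S)"
    unfolding borel_measurable_euclidean_space[of f] using assms by (auto simp: L2_on_def)
  ultimately show ?thesis by (simp add: L2_on_def)
qed

lemma rot_axis: "rot D = (inner (D (axis 2 1)) (axis 3 1) - inner (D (axis 3 1)) (axis 2 1)) *\<^sub>R axis 1 1
    + (inner (D (axis 3 1)) (axis 1 1) - inner (D (axis 1 1)) (axis 3 1)) *\<^sub>R axis 2 1
    + (inner (D (axis 1 1)) (axis 2 1) - inner (D (axis 2 1)) (axis 1 1)) *\<^sub>R axis 3 1"
  by (simp add: rot_def Finite_Cartesian_Product.vec_eq_iff forall_3 inner_axis) (simp add: axis_def)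

text \<open>Test fields and their curls are continuous with compact support.\<close>

lemma test_field_L2:
  assumes \<psi>: "test_field S \<psi>" and A: "A \<in> sets lebesgue"
  shows "L2_on A \<psi>" "L2_on A (curl \<psi>)"
proof -
  have t: "test_fun S (\<lambda>x. inner (\<psi> x) b)" if "b \<in> Basis" for b
    using \<psi> that by (simp add: test_field_def)
  define K where "K = (\<Union>b\<in>Basis. closure {x. inner (\<psi> x) b \<noteq> 0})"
  have K: "compact K"
    unfolding K_def using t by (intro compact_UN) (auto simp: test_fun_def)
  have off: "\<psi> x = 0" if "x \<notin> K" for x
  proof (rule euclidean_eqI)
    fix b :: R3 assume "b \<in> Basis"
    then have "x \<notin> closure {x. inner (\<psi> x) b \<noteq> 0}" using that by (auto simp: K_def)
    then have "inner (\<psi> x) b = 0" using closure_subset[of "{x. inner (\<psi> x) b \<noteq> 0}"] by blast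
    then show "inner (\<psi> x) b = inner 0 b" by simp
  qed
  have cont: "continuous_on UNIV (\<lambda>x. inner (\<psi> x) b)" if "b \<in> Basis" for b
    using t[OF that] unfolding test_fun_def using Ck.simps(1) by blast
  have "continuous_on UNIV (\<lambda>x. \<Sum>b\<in>Basis. inner (\<psi> x) b *\<^sub>R b)"
    by (intro continuous_intros cont)
  then have "continuous_on UNIV \<psi>" by (simp add: euclidean_representation)
  then show "L2_on A \<psi>" by (rule L2_on_compact_support[OF _ K off A])
  have "\<exists>g. (\<forall>x. ((\<lambda>x. inner (\<psi> x) b) has_derivative (\<lambda>h. inner (g x) h)) (at x)) \<and>
      (\<forall>c\<in>Basis. continuous_on UNIV (\<lambda>x. inner (g x) c))" if "b \<in> Basis" for b
  proof -
    have "Ck (Suc 0) (\<lambda>x. inner (\<psi> x) b)" using t[OF that] by (simp only: test_fun_def)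
    then show ?thesis by (simp only: Ck.simps)
  qed
  then obtain g where g: "\<And>b x. b \<in> Basis \<Longrightarrow> ((\<lambda>x. inner (\<psi> x) b) has_derivative (\<lambda>h. inner (g b x) h)) (at x)"
    "\<And>b c. b \<in> Basis \<Longrightarrow> c \<in> Basis \<Longrightarrow> continuous_on UNIV (\<lambda>x. inner (g b x) c)" by metis
  define D where "D x h = (\<Sum>b\<in>Basis. inner (g b x) h *\<^sub>R b)" for x h
  have "((\<lambda>x. \<Sum>b\<in>Basis. inner (\<psi> x) b *\<^sub>R b) has_derivative D x) (at x)" for x
    unfolding D_def by (intro has_derivative_sum has_derivative_scaleR_left g)
  then have D: "(\<psi> has_derivative D x) (at x)" for x by (simp add: euclidean_representation)
  have Db: "inner (D x h) b = inner (g b x) h" if "b \<in> Basis" for x h b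
    using that by (simp add: D_def inner_sum_left inner_Basis if_distrib cong: if_cong)
  have ax: "axis i 1 \<in> (Basis :: R3 set)" for i by (simp add: axis_in_Basis_iff)
  have "curl \<psi> = (\<lambda>x. rot (D x))" using curl_has_derivative[OF D] by blast
  moreover have "continuous_on UNIV (\<lambda>x. rot (D x))"
    unfolding rot_axis Db[OF ax] by (intro continuous_intros g(2) ax)
  ultimately have cc: "continuous_on UNIV (curl \<psi>)" by simp
  have "curl \<psi> x = 0" if "x \<notin> K" for x
  proof -
    have "(\<psi> has_derivative (\<lambda>h. 0)) (at x)"
      by (rule has_derivative_transform_within_open[OF has_derivative_const, of "- K"])
         (use that K off compact_imp_closed in auto)
    then show ?thesis using curl_has_derivative rot_zero by metis
  qed
  then show "L2_on A (curl \<psi>)" by (rule L2_on_compact_support[OF cc K _ A])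
qed

text \<open>Young's inequality \<open>2 |u| |d| \<le> c |u|\<^sup>2 + |d|\<^sup>2 / c\<close> takes the place of the Cauchy-Schwarz inequality for
  integrals; \<open>c\<close> is chosen so that the first term contributes at most \<open>e/2\<close>.\<close>

lemma L2_inner_tendsto_0:
  fixes u :: "'a::euclidean_space \<Rightarrow> 'b::euclidean_space"
  assumes u: "L2_on S u" and d: "\<And>n. L2_on S (d n)"
    and lim: "(\<lambda>n. integral\<^sup>L (lebesgue_on S) (\<lambda>x. (norm (d n x))\<^sup>2)) \<longlonglongrightarrow> 0"
  shows "(\<lambda>n. integral\<^sup>L (lebesgue_on S) (\<lambda>x. inner (u x) (d n x))) \<longlonglongrightarrow> 0"
proof (rule LIMSEQ_I)
  fix e :: real assume e: "0 < e"
  define I where "I = integral\<^sup>L (lebesgue_on S) (\<lambda>x. (norm (u x))\<^sup>2)"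
  have I: "0 \<le> I" unfolding I_def by (intro integral_nonneg_AE AE_I2) simp
  define c where "c = e / (I + 1)"
  have c: "0 < c" "c * I \<le> e"
  proof -
    show "0 < c" using e I by (simp add: c_def)
    show "c * I \<le> e" using e I by (simp add: c_def pos_divide_le_eq mult_left_mono)
  qed
  have bound: "\<bar>integral\<^sup>L (lebesgue_on S) (\<lambda>x. inner (u x) (d n x))\<bar>
      \<le> c / 2 * I + 1 / (2 * c) * integral\<^sup>L (lebesgue_on S) (\<lambda>x. (norm (d n x))\<^sup>2)" for n
  proof -
    have i: "integrable (lebesgue_on S) (\<lambda>x. (norm (u x))\<^sup>2)" "integrable (lebesgue_on S) (\<lambda>x. (norm (d n x))\<^sup>2)"
      using u d by (auto simp: L2_on_def)
    have "norm (integral\<^sup>L (lebesgue_on S) (\<lambda>x. inner (u x) (d n x)))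
        \<le> integral\<^sup>L (lebesgue_on S) (\<lambda>x. c / 2 * (norm (u x))\<^sup>2 + 1 / (2 * c) * (norm (d n x))\<^sup>2)"
    proof (rule Bochner_Integration.integral_norm_bound_integral)
      show "integrable (lebesgue_on S) (\<lambda>x. inner (u x) (d n x))" by (rule L2_inner_integrable'[OF u d])
      show "integrable (lebesgue_on S) (\<lambda>x. c / 2 * (norm (u x))\<^sup>2 + 1 / (2 * c) * (norm (d n x))\<^sup>2)"
        by (intro Bochner_Integration.integrable_add integrable_mult_right i)
      fix x
      have "(c * norm (u x) - norm (d n x))\<^sup>2 =
          c * (c * (norm (u x))\<^sup>2) - 2 * c * (norm (u x) * norm (d n x)) + (norm (d n x))\<^sup>2"
        by (simp add: power2_eq_square algebra_simps)
      moreover have "0 \<le> (c * norm (u x) - norm (d n x))\<^sup>2" by simp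
      ultimately have "2 * c * (norm (u x) * norm (d n x)) \<le> c * (c * (norm (u x))\<^sup>2) + (norm (d n x))\<^sup>2"
        by linarith
      then have "2 * c * (norm (u x) * norm (d n x)) / (2 * c) \<le> (c * (c * (norm (u x))\<^sup>2) + (norm (d n x))\<^sup>2) / (2 * c)"
        using c(1) by (intro divide_right_mono) auto
      moreover have "2 * c * (norm (u x) * norm (d n x)) / (2 * c) = norm (u x) * norm (d n x)" using c(1) by simp
      moreover have "(c * (c * (norm (u x))\<^sup>2) + (norm (d n x))\<^sup>2) / (2 * c) = c / 2 * (norm (u x))\<^sup>2 + 1 / (2 * c) * (norm (d n x))\<^sup>2"
        using c(1) by (simp add: add_divide_distrib)
      ultimately have "norm (u x) * norm (d n x) \<le> c / 2 * (norm (u x))\<^sup>2 + 1 / (2 * c) * (norm (d n x))\<^sup>2"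
        by (simp only:)
      then show "norm (inner (u x) (d n x)) \<le> c / 2 * (norm (u x))\<^sup>2 + 1 / (2 * c) * (norm (d n x))\<^sup>2"
        using Cauchy_Schwarz_ineq2[of "u x" "d n x"] by simp
    qed
    also have "\<dots> = c / 2 * I + 1 / (2 * c) * integral\<^sup>L (lebesgue_on S) (\<lambda>x. (norm (d n x))\<^sup>2)"
      unfolding I_def by (subst Bochner_Integration.integral_add[OF integrable_mult_right integrable_mult_right, OF i]) simp
    finally show ?thesis by (simp only: real_norm_def)
  qed
  have "0 < c * e" using c e by simp
  from LIMSEQ_D[OF lim this] obtain N where N: "\<And>n. n \<ge> N \<Longrightarrow> norm (integral\<^sup>L (lebesgue_on S) (\<lambda>x. (norm (d n x))\<^sup>2)) < c * e"
    by auto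
  show "\<exists>N. \<forall>n\<ge>N. norm (integral\<^sup>L (lebesgue_on S) (\<lambda>x. inner (u x) (d n x)) - 0) < e"
  proof (intro exI[of _ N] allI impI)
    fix n assume "n \<ge> N"
    then have "integral\<^sup>L (lebesgue_on S) (\<lambda>x. (norm (d n x))\<^sup>2) < c * e" using N by force
    then have "1 / (2 * c) * integral\<^sup>L (lebesgue_on S) (\<lambda>x. (norm (d n x))\<^sup>2) < 1 / (2 * c) * (c * e)"
      using c(1) by (intro mult_strict_left_mono) auto
    also have "\<dots> = e / 2" using c(1) by simp
    finally show "norm (integral\<^sup>L (lebesgue_on S) (\<lambda>x. inner (u x) (d n x)) - 0) < e"
      using bound[of n] c(2) unfolding real_norm_def diff_zero by linarith
  qed
qed

text \<open>The defining identity of the weak curl extends from test fields to their closure in the graph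
  norm.\<close>

lemma weak_curl_H0_curl:
  assumes S: "S \<in> sets lebesgue" and L2: "L2_on S \<gamma>" "L2_on S \<eta>"
    and weak: "weak_curl S \<gamma> \<eta>" and f: "H0_curl S f g"
  shows "integral\<^sup>L (lebesgue_on S) (\<lambda>x. inner (\<eta> x) (f x)) = integral\<^sup>L (lebesgue_on S) (\<lambda>x. inner (\<gamma> x) (g x))"
proof -
  obtain \<psi> where fg: "L2_on S f" "L2_on S g" and \<psi>: "\<And>n. test_field S (\<psi> n)"
    and lf: "(\<lambda>n. integral\<^sup>L (lebesgue_on S) (\<lambda>x. (norm (\<psi> n x - f x))\<^sup>2)) \<longlonglongrightarrow> 0"
    and lg: "(\<lambda>n. integral\<^sup>L (lebesgue_on S) (\<lambda>x. (norm (curl (\<psi> n) x - g x))\<^sup>2)) \<longlonglongrightarrow> 0"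
    using f unfolding H0_curl_def by blast
  note \<psi>L2 = test_field_L2[OF \<psi> S]
  have "(\<lambda>n. integral\<^sup>L (lebesgue_on S) (\<lambda>x. inner (\<eta> x) (\<psi> n x - f x))) \<longlonglongrightarrow> 0"
    by (rule L2_inner_tendsto_0[OF L2(2) L2_on_diff[OF \<psi>L2(1) fg(1)] lf])
  moreover have "integral\<^sup>L (lebesgue_on S) (\<lambda>x. inner (\<eta> x) (\<psi> n x - f x))
      = integral\<^sup>L (lebesgue_on S) (\<lambda>x. inner (\<eta> x) (\<psi> n x)) - integral\<^sup>L (lebesgue_on S) (\<lambda>x. inner (\<eta> x) (f x))" for n
    unfolding inner_diff_right
    by (rule Bochner_Integration.integral_diff; rule L2_inner_integrable') (rule L2 \<psi>L2 fg)+
  ultimately have 1: "(\<lambda>n. integral\<^sup>L (lebesgue_on S) (\<lambda>x. inner (\<eta> x) (\<psi> n x))) \<longlonglongrightarrow> integral\<^sup>L (lebesgue_on S) (\<lambda>x. inner (\<eta> x) (f x))"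
    using LIM_zero_cancel by auto
  have "(\<lambda>n. integral\<^sup>L (lebesgue_on S) (\<lambda>x. inner (\<gamma> x) (curl (\<psi> n) x - g x))) \<longlonglongrightarrow> 0"
    by (rule L2_inner_tendsto_0[OF L2(1) L2_on_diff[OF \<psi>L2(2) fg(2)] lg])
  moreover have "integral\<^sup>L (lebesgue_on S) (\<lambda>x. inner (\<gamma> x) (curl (\<psi> n) x - g x))
      = integral\<^sup>L (lebesgue_on S) (\<lambda>x. inner (\<gamma> x) (curl (\<psi> n) x)) - integral\<^sup>L (lebesgue_on S) (\<lambda>x. inner (\<gamma> x) (g x))" for n
    unfolding inner_diff_right
    by (rule Bochner_Integration.integral_diff; rule L2_inner_integrable') (rule L2 \<psi>L2 fg)+
  ultimately have 2: "(\<lambda>n. integral\<^sup>L (lebesgue_on S) (\<lambda>x. inner (\<gamma> x) (curl (\<psi> n) x))) \<longlonglongrightarrow> integral\<^sup>L (lebesgue_on S) (\<lambda>x. inner (\<gamma> x) (g x))"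
    using LIM_zero_cancel by auto
  have "integral\<^sup>L (lebesgue_on S) (\<lambda>x. inner (\<gamma> x) (curl (\<psi> n) x)) = integral\<^sup>L (lebesgue_on S) (\<lambda>x. inner (\<eta> x) (\<psi> n x))" for n
    using weak \<psi> unfolding weak_curl_def by blast
  with 1 2 show ?thesis using LIMSEQ_unique by auto
qed

section \<open>Definiteness of the block matrices\<close>

context tetrahedron
begin

lemma nedelec_affine: "nedelec e x = nedelec e y + nedelec_deriv e (x - y)"
  by (simp add: nedelec_def nedelec_deriv_def bary_def inner_diff_right algebra_simps)

text \<open>Edge functions are affine on a tetrahedron, and an affine field that vanishes on an open set
  vanishes everywhere.\<close>

lemma nedelec_sum_zero_imp:
  assumes G: "open G" "G \<noteq> {}" and 0: "\<And>x. x \<in> G \<Longrightarrow> (\<Sum>i\<in>I. a i *\<^sub>R nedelec (e i) x) = 0"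
  shows "(\<Sum>i\<in>I. a i *\<^sub>R nedelec (e i) y) = 0"
proof -
  obtain x0 where x0: "x0 \<in> G" using G(2) by blast
  then obtain d where d: "d > 0" "ball x0 d \<subseteq> G" using G(1) open_contains_ball by blast
  define g where "g x = (\<Sum>i\<in>I. a i *\<^sub>R nedelec (e i) x)" for x
  define D where "D h = (\<Sum>i\<in>I. a i *\<^sub>R nedelec_deriv (e i) h)" for h
  have aff: "g x = g x0 + D (x - x0)" for x
    unfolding g_def D_def sum.distrib[symmetric] scaleR_add_right[symmetric] using nedelec_affine by simp
  have scale: "D (t *\<^sub>R h) = t *\<^sub>R D h" for t h
    unfolding D_def scaleR_sum_right
    by (intro sum.cong refl) (simp add: nedelec_deriv_def algebra_simps)
  define m where "m = norm (y - x0) + 1"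
  have m: "0 < m" "norm (y - x0) \<le> m" by (simp_all add: m_def add_nonneg_pos)
  define t where "t = d / (2 * m)"
  have t: "0 < t" using d(1) m by (simp add: t_def)
  have "t * norm (y - x0) \<le> t * m" using t m by simp
  also have "\<dots> = d / 2" using m by (simp add: t_def)
  also have "\<dots> < d" using d(1) by simp
  finally have "norm (t *\<^sub>R (y - x0)) < d" using t by simp
  then have "x0 + t *\<^sub>R (y - x0) \<in> ball x0 d" by (simp add: dist_norm)
  then have "g (x0 + t *\<^sub>R (y - x0)) = 0" "g x0 = 0" using d(2) 0 x0 by (auto simp: g_def)
  then have "t *\<^sub>R D (y - x0) = 0" using aff[of "x0 + t *\<^sub>R (y - x0)"] by (simp add: scale)
  then have "D (y - x0) = 0" using t by simp
  then show ?thesis using aff[of y] \<open>g x0 = 0\<close> by (simp add: g_def)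
qed

lemma continuous_nedelec_sum: "continuous_on A (\<lambda>x. \<Sum>i\<in>I. a i *\<^sub>R nedelec (e i) x)"
proof -
  have "continuous_on A (nedelec e)" for e
    by (intro continuous_at_imp_continuous_on ballI has_derivative_continuous[OF nedelec_has_derivative])
  then show ?thesis by (intro continuous_intros)
qed

end

context mqs_problem
begin

lemma sig_bounds: "sig P \<in> borel_measurable (lebesgue_on (Om P))" "\<bar>sig P x\<bar> \<le> sigC P" "0 \<le> sig P x"
proof -
  show "sig P \<in> borel_measurable (lebesgue_on (Om P))"
    unfolding sig_def[abs_def] by (intro borel_measurable_times borel_measurable_const indicator_measurable)
  show "\<bar>sig P x\<bar> \<le> sigC P" "0 \<le> sig P x" using nu_pos(2) by (auto simp: sig_def indicator_def)
qed

definition edge_field :: "rvec \<Rightarrow> R3 \<Rightarrow> R3" where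
  "edge_field v x = (\<Sum>j<n1 P. (v $ j) *\<^sub>R phi P j x)"

lemma edge_field_L2: "L2_on (Om P) (edge_field v)"
  unfolding edge_field_def[abs_def] using mesh(6) by (intro L2_on_sum phi_L2) simp

lemma M11_form:
  assumes v: "v \<in> carrier_vec (n1 P)"
  shows "v \<bullet> (M11 P *\<^sub>v v) = integral\<^sup>L (lebesgue_on (Om P)) (\<lambda>x. sig P x * inner (edge_field v x) (edge_field v x))"
proof -
  have M: "M11 P \<in> carrier_mat (n1 P) (n1 P)" by (simp add: M11_def)
  have i: "integrable (lebesgue_on (Om P)) (\<lambda>x. (v $ k * v $ l) * (sig P x * inner (phi P l x) (phi P k x)))"
    if "k < n1 P" "l < n1 P" for k l
    using that mesh(6) by (intro integrable_mult_right L2_inner_integrable[where C = "sigC P"] phi_L2 sig_bounds) auto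
  have "v \<bullet> (M11 P *\<^sub>v v) = (\<Sum>k<n1 P. v $ k * (\<Sum>l<n1 P. M11 P $$ (k, l) * v $ l))"
    unfolding scalar_prod_sum[OF mult_mat_vec_carrier[OF M v]]
    by (intro sum.cong refl) (simp only: mult_mat_vec_nth[OF M v] lessThan_iff)
  also have "\<dots> = (\<Sum>k<n1 P. \<Sum>l<n1 P. (v $ k * v $ l) * M11 P $$ (k, l))"
    by (simp add: sum_distrib_left mult_ac)
  also have "\<dots> = (\<Sum>k<n1 P. \<Sum>l<n1 P. integral\<^sup>L (lebesgue_on (Om P)) (\<lambda>x. (v $ k * v $ l) * (sig P x * inner (phi P l x) (phi P k x))))"
    unfolding integral_mult_right_zero using mesh(6) by (intro sum.cong refl arg_cong2[where f = "(*)"]) (simp add: M11_def Msig_def)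
  also have "\<dots> = integral\<^sup>L (lebesgue_on (Om P)) (\<lambda>x. \<Sum>k<n1 P. \<Sum>l<n1 P. (v $ k * v $ l) * (sig P x * inner (phi P l x) (phi P k x)))"
    by (subst Bochner_Integration.integral_sum, intro Bochner_Integration.integrable_sum i, simp, simp,
        intro sum.cong refl Bochner_Integration.integral_sum[symmetric] i) simp_all
  also have "(\<lambda>x. \<Sum>k<n1 P. \<Sum>l<n1 P. (v $ k * v $ l) * (sig P x * inner (phi P l x) (phi P k x))) =
      (\<lambda>x. sig P x * inner (edge_field v x) (edge_field v x))"
  proof
    fix x
    have "inner (edge_field v x) (edge_field v x) = (\<Sum>k<n1 P. \<Sum>l<n1 P. (v $ k * v $ l) * inner (phi P l x) (phi P k x))"
      unfolding edge_field_def inner_sum_right inner_sum_left by (simp add: mult_ac)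
    then show "(\<Sum>k<n1 P. \<Sum>l<n1 P. (v $ k * v $ l) * (sig P x * inner (phi P l x) (phi P k x))) =
        sig P x * inner (edge_field v x) (edge_field v x)"
      by (simp add: sum_distrib_left mult_ac)
  qed
  finally show ?thesis .
qed

text \<open>A field that vanishes in the conductor vanishes, as an affine field, on some conducting element
  that contains the edge; its tangential component along the edge is the coefficient.\<close>

lemma edge_field_zero_imp:
  assumes ae: "AE x in lebesgue_on (Om P). x \<in> OmC P \<longrightarrow> edge_field v x = 0" and j: "j < n1 P"
  shows "v $ j = 0"
proof -
  have jne: "j < ne P" using j mesh(6) by simp
  obtain T where T: "T \<in> mesh P" "T \<subseteq> closure (OmC P)" and vw: "fst (edges P ! j) \<in> verts T" "snd (edges P ! j) \<in> verts T"
    using conducting_edge[OF jne] j by blast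
  interpret tetrahedron T by (rule mesh(2)[OF T(1)])
  let ?g = "\<lambda>x. \<Sum>i<n1 P. (v $ i) *\<^sub>R nedelec (edges P ! i) x"
  define G where "G = interior T \<inter> OmC P"
  have G: "open G" using OmC(1) by (auto simp: G_def)
  have "interior T \<inter> closure (OmC P) \<noteq> {}" using interior_nonempty T(2) interior_subset by blast
  then have "G \<noteq> {}" unfolding G_def using open_Int_closure_eq_empty[OF open_interior] by blast
  have g0: "?g x = 0" if x: "x \<in> G" for x
  proof (rule ccontr)
    assume "?g x \<noteq> 0"
    then have ne: "G \<inter> {x. ?g x \<noteq> 0} \<noteq> {}" using x by blast
    have op: "open (G \<inter> {x. ?g x \<noteq> 0})"
      by (intro open_Int G open_Collect_neq continuous_nedelec_sum continuous_on_const)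
    have sub: "G \<inter> {x. ?g x \<noteq> 0} \<subseteq> Om P" using OmC(3) by (auto simp: G_def)
    obtain y where y: "y \<in> G \<inter> {x. ?g x \<noteq> 0}" "y \<in> OmC P \<longrightarrow> edge_field v y = 0"
      using AE_open_nonempty_witness[OF ae Om(2) op sub ne] .
    then have "edge_field v y = ?g y"
      unfolding edge_field_def by (simp add: G_def phi_on_tetrahedron[OF T(1)])
    with y show False by (auto simp: G_def)
  qed
  define p q where "p = fst (edges P ! j)" and "q = snd (edges P ! j)"
  have pq: "p \<in> verts T" "q \<in> verts T" "p \<noteq> q" using vw edge[OF jne] by (simp_all add: p_def q_def)
  have "inner (?g p) (q - p) = (\<Sum>i<n1 P. v $ i * of_bool (i = j))"
    unfolding inner_sum_left
  proof (intro sum.cong refl)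
    fix i assume "i \<in> {..<n1 P}"
    then have i: "i < ne P" using mesh(6) by simp
    obtain p' q' where e: "edges P ! i = (p', q')" by (cases "edges P ! i") auto
    have "i = j" if "{p', q'} = {p, q}"
      by (rule edge_unique[OF i jne]) (use that in \<open>simp add: e p_def q_def\<close>)
    moreover have "(p', q') = (p, q)" if "i = j" using that e by (simp add: p_def q_def)
    ultimately show "inner ((v $ i) *\<^sub>R nedelec (edges P ! i) p) (q - p) = v $ i * of_bool (i = j)"
      unfolding e inner_scaleR_left nedelec_at_vertex[OF pq] by (cases "i = j") auto
  qed
  also have "\<dots> = v $ j" using j by simp
  finally show ?thesis using nedelec_sum_zero_imp[OF G \<open>G \<noteq> {}\<close> g0] by simp
qed

lemma M11_spd: "spd (n1 P) (M11 P)"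
  unfolding spd_def
proof (intro conjI ballI impI)
  show "M11 P \<in> carrier_mat (n1 P) (n1 P)" by (simp add: M11_def)
  show "(M11 P)\<^sup>T = M11 P"
    using mesh(6) by (intro eq_matI) (auto simp: M11_def Msig_def inner_commute)
  fix v :: rvec assume v: "v \<in> carrier_vec (n1 P)" "v \<noteq> 0\<^sub>v (n1 P)"
  let ?f = "\<lambda>x. sig P x * inner (edge_field v x) (edge_field v x)"
  have int: "integrable (lebesgue_on (Om P)) ?f"
    by (rule L2_inner_integrable[where C = "sigC P"]) (intro edge_field_L2 sig_bounds)+
  have nonneg: "AE x in lebesgue_on (Om P). 0 \<le> ?f x" using sig_bounds(3) by simp
  have "integral\<^sup>L (lebesgue_on (Om P)) ?f \<noteq> 0"
  proof
    assume "integral\<^sup>L (lebesgue_on (Om P)) ?f = 0"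
    then have "AE x in lebesgue_on (Om P). ?f x = 0" using integral_nonneg_eq_0_iff_AE[OF int nonneg] by blast
    then have "AE x in lebesgue_on (Om P). x \<in> OmC P \<longrightarrow> edge_field v x = 0"
      by (rule eventually_mono) (use nu_pos(2) in \<open>auto simp: sig_def\<close>)
    then have "v = 0\<^sub>v (n1 P)" using v(1) edge_field_zero_imp by (intro eq_vecI) auto
    with v(2) show False by simp
  qed
  moreover have "0 \<le> integral\<^sup>L (lebesgue_on (Om P)) ?f" using nonneg by (rule integral_nonneg_AE)
  ultimately show "0 < v \<bullet> (M11 P *\<^sub>v v)" unfolding M11_form[OF v(1)] by linarith
qed

abbreviation "ext v \<equiv> 0\<^sub>v (n1 P) @\<^sub>v v"

lemma K22_form: "v \<in> carrier_vec (n2 P) \<Longrightarrow> v \<bullet> (K22 P *\<^sub>v v) = Kform (ext v) (ext v) (ext v)"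
proof -
  assume v: "v \<in> carrier_vec (n2 P)"
  have c: "K21 P *\<^sub>v 0\<^sub>v (n1 P) + K22 P *\<^sub>v v = K22 P *\<^sub>v v"
    using v by (simp add: K21_def K22_def)
  have d: "K22 P *\<^sub>v v \<in> carrier_vec (n2 P)" by (rule carrier_vecI) (simp add: K22_def)
  have z: "w \<in> carrier_vec (n1 P) \<Longrightarrow> w \<bullet> 0\<^sub>v (n1 P) = 0" for w :: rvec by simp
  have w: "K11 P (0\<^sub>v (n1 P)) *\<^sub>v 0\<^sub>v (n1 P) + K12 P *\<^sub>v v \<in> carrier_vec (n1 P)"
    by (rule carrier_vecI) (simp add: K12_def)
  show ?thesis
    using block_power[of "0\<^sub>v (n1 P)" v "0\<^sub>v (n1 P)" v] v comm_scalar_prod[OF d v] unfolding c z[OF w] by simp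
qed

lemma C2_kernel:
  assumes v: "v \<in> carrier_vec (n2 P)"
  shows "C2 P *\<^sub>v v = 0\<^sub>v (nf P) \<longleftrightarrow> (AE x in lebesgue_on (Om P). curl_field (ext v) x = 0)"
proof -
  have C: "C2 P \<in> carrier_mat (nf P) (n2 P)" by (simp add: C2_def)
  have eq: "(C2 P *\<^sub>v v) $ k = (\<Sum>j<ne P. Cd P $$ (k, j) * ext v $ j)" if k: "k < nf P" for k
  proof -
    have "(\<Sum>j<n1 P + n2 P. Cd P $$ (k, j) * ext v $ j) = (\<Sum>j<n2 P. Cd P $$ (k, n1 P + j) * v $ j)"
      unfolding sum_lessThan_add using v by simp
    also have "\<dots> = (C2 P *\<^sub>v v) $ k"
      unfolding mult_mat_vec_nth[OF C v k] using k by (simp add: C2_def)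
    finally show ?thesis by (simp only: n12)
  qed
  have "C2 P *\<^sub>v v = 0\<^sub>v (nf P) \<longleftrightarrow> (\<forall>k<nf P. (C2 P *\<^sub>v v) $ k = 0)"
  proof
    assume "\<forall>k<nf P. (C2 P *\<^sub>v v) $ k = 0"
    then show "C2 P *\<^sub>v v = 0\<^sub>v (nf P)" using C by (intro eq_vecI) auto
  qed simp
  then show ?thesis using eq Cd_zero_iff[of "ext v"] by simp
qed

lemma K22_nonneg: "v \<in> carrier_vec (n2 P) \<Longrightarrow> 0 \<le> v \<bullet> (K22 P *\<^sub>v v)"
  unfolding K22_form Kform_def by (intro integral_nonneg_AE AE_I2 mult_nonneg_nonneg nu_bounds(1)) auto

text \<open>If the energy in the insulator is zero, so is the curl there; in the closure of the conductor the
  curl of non-conducting edge functions vanishes anyway.\<close>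

lemma K22_zero_imp:
  assumes v: "v \<in> carrier_vec (n2 P)" and 0: "v \<bullet> (K22 P *\<^sub>v v) = 0"
  shows "C2 P *\<^sub>v v = 0\<^sub>v (nf P)"
proof -
  let ?f = "\<lambda>x. nu P x (norm (curl_field (ext v) x)) * inner (curl_field (ext v) x) (curl_field (ext v) x)"
  have "AE x in lebesgue_on (Om P). ?f x = 0"
    using 0 unfolding K22_form[OF v] Kform_def
    by (subst (asm) integral_nonneg_eq_0_iff_AE)
       (auto intro!: nu_inner_integrable curl_field_L2 AE_I2 mult_nonneg_nonneg nu_bounds(1))
  moreover have "AE x in lebesgue_on (Om P). x \<in> Om P" by (rule AE_I2) simp
  ultimately have "AE x in lebesgue_on (Om P). curl_field (ext v) x = 0"
    using AE_resolved
  proof eventually_elim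
    case (elim x)
    show ?case
    proof (cases "x \<in> closure (OmC P)")
      case True
      show ?thesis unfolding curl_field_def
      proof (intro sum.neutral ballI)
        fix j assume "j \<in> {..<ne P}"
        then show "(ext v $ j) *\<^sub>R curl (phi P j) x = 0"
          using resolved_nonconducting_curl[OF elim(3) True, of j] v n12 by (cases "j < n1 P") auto
      qed
    next
      case False
      then have "x \<in> OmI P" "x \<notin> OmC P" using elim(2) closure_subset by (auto simp: OmI_def)
      then show ?thesis using elim(1) nu_pos(1) by (simp add: nu_def)
    qed
  qed
  then show ?thesis using C2_kernel[OF v] by simp
qed

end

section \<open>Passivity of the reduced model\<close>

lemma scalar_prod_self_pos: "v \<in> carrier_vec n \<Longrightarrow> v \<noteq> 0\<^sub>v n \<Longrightarrow> 0 < v \<bullet> (v :: rvec)"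
proof -
  assume v: "v \<in> carrier_vec n" "v \<noteq> 0\<^sub>v n"
  then obtain i where i: "i < n" "v $ i \<noteq> 0" by (metis carrier_vecD eq_vecI index_zero_vec)
  have "0 < v $ i * v $ i" using i(2) by (metis not_real_square_gt_zero)
  also have "\<dots> \<le> (\<Sum>k<n. v $ k * v $ k)"
    by (rule member_le_sum[of i "{..<n}" "\<lambda>k. v $ k * v $ k"]) (use i in auto)
  finally show ?thesis unfolding scalar_prod_sum[OF v(1)] .
qed

lemma symmetric_congruence:
  assumes A: "A \<in> carrier_mat n k" and K: "K \<in> carrier_mat n n" "K\<^sup>T = (K :: rmat)"
  shows "(A\<^sup>T * K * A)\<^sup>T = A\<^sup>T * K * A"
proof -
  have "(A\<^sup>T * K * A)\<^sup>T = A\<^sup>T * (K\<^sup>T * A)"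
    using A K by (simp add: transpose_mult_dim del: transpose_mult)
  then show ?thesis using A K by simp
qed

lemma congruence_form:
  assumes A: "A \<in> carrier_mat n k" and K: "K \<in> carrier_mat n n" and v: "v \<in> carrier_vec k"
  shows "v \<bullet> ((A\<^sup>T * K * A) *\<^sub>v v) = (A *\<^sub>v v) \<bullet> ((K :: rmat) *\<^sub>v (A *\<^sub>v v))"
proof -
  have "(A\<^sup>T * K * A) *\<^sub>v v = A\<^sup>T *\<^sub>v (K *\<^sub>v (A *\<^sub>v v))"
    using A K v by (simp only: mv_assoc index_mult_mat index_transpose_mat dim_mult_mat_vec carrier_matD carrier_vecD)
  then show ?thesis using A K v by (simp add: adjoint_right)
qed

lemma leading_left_singular_orthonormal:
  assumes "leading_left_singular r M U"
  shows "U \<in> carrier_mat (dim_row M) r" "U\<^sup>T * U = 1\<^sub>m r"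
proof -
  obtain W where r: "r \<le> dim_row M" and W: "W \<in> carrier_mat (dim_row M) (dim_row M)" "W\<^sup>T * W = 1\<^sub>m (dim_row M)"
    and U: "U = Matrix.mat (dim_row M) r (\<lambda>(i, j). W $$ (i, j))"
    using assms unfolding leading_left_singular_def Let_def by blast
  show "U \<in> carrier_mat (dim_row M) r" by (simp add: U)
  show "U\<^sup>T * U = 1\<^sub>m r"
  proof (rule eq_matI)
    fix i j assume ij: "i < dim_row (1\<^sub>m r :: rmat)" "j < dim_col (1\<^sub>m r :: rmat)"
    have "(U\<^sup>T * U) $$ (i, j) = (\<Sum>k<dim_row M. W $$ (k, i) * W $$ (k, j))"
      using ij by (auto simp: U scalar_prod_def atLeast0LessThan intro!: sum.cong)
    also have "\<dots> = (W\<^sup>T * W) $$ (i, j)"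
      using ij r W(1) by (auto simp: scalar_prod_def atLeast0LessThan intro!: sum.cong)
    also have "\<dots> = (1\<^sub>m r :: rmat) $$ (i, j)" using ij r by (simp add: W(2))
    finally show "(U\<^sup>T * U) $$ (i, j) = (1\<^sub>m r :: rmat) $$ (i, j)" .
  qed (simp_all add: U)
qed

context mqs_problem
begin

lemma winding_L2: assumes "j < ports P" shows "L2_on (Om P) (chi P j)" "L2_on (Om P) (gam P j)"
proof -
  show "L2_on (Om P) (chi P j)" using winding assms by (simp add: mqs_winding_def)
  show "L2_on (Om P) (gam P j)"
  proof (rule L2_on_componentwise)
    fix b :: R3 assume "b \<in> Basis"
    then have "H1_on (Om P) (\<lambda>x. inner (gam P j x) b)"
      using winding assms unfolding mqs_winding_def by blast
    then show "L2_on (Om P) (\<lambda>x. inner (gam P j x) b)" by (simp only: H1_on_def)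
  qed
qed

text \<open>Integration by parts moves the curl from the winding potential \<open>\<gamma>\<^sub>j\<close> to the edge functions, and
  coefficients in the kernel of \<open>C\<^sub>2\<close> have no curl.  In other words, the columns of \<open>X\<^sub>2\<close> lie in the image
  of \<open>C\<^sub>2\<^sup>T\<close>.\<close>

lemma X2_kernel:
  assumes v: "v \<in> carrier_vec (n2 P)" and 0: "C2 P *\<^sub>v v = 0\<^sub>v (nf P)"
  shows "(X2 P)\<^sup>T *\<^sub>v v = 0\<^sub>v (ports P)"
proof (rule eq_vecI)
  fix j assume "j < dim_vec (0\<^sub>v (ports P) :: rvec)"
  then have j: "j < ports P" by simp
  have X: "(X2 P)\<^sup>T \<in> carrier_mat (ports P) (n2 P)" by (simp add: X2_def)
  have entry: "(X2 P)\<^sup>T $$ (j, k) = integral\<^sup>L (lebesgue_on (Om P)) (\<lambda>x. inner (gam P j x) (curl (phi P (n1 P + k)) x))"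
    if k: "k < n2 P" for k
  proof -
    have ne: "n1 P + k < ne P" using k by simp
    have "(X2 P)\<^sup>T $$ (j, k) = integral\<^sup>L (lebesgue_on (Om P)) (\<lambda>x. inner (chi P j x) (phi P (n1 P + k) x))"
      using j k ne by (simp add: X2_def Xmat_def)
    also have "\<dots> = integral\<^sup>L (lebesgue_on (Om P)) (\<lambda>x. inner (gam P j x) (curl (phi P (n1 P + k)) x))"
    proof (rule weak_curl_H0_curl[OF Om(2) winding_L2(2,1)[OF j]])
      show "weak_curl (Om P) (gam P j) (chi P j)" using winding j by (simp add: mqs_winding_def)
      show "H0_curl (Om P) (phi P (n1 P + k)) (curl (phi P (n1 P + k)))" using fem_lists(4) ne by blast
    qed
    finally show ?thesis .
  qed
  have "((X2 P)\<^sup>T *\<^sub>v v) $ j = (\<Sum>k<n2 P. v $ k * integral\<^sup>L (lebesgue_on (Om P)) (\<lambda>x. inner (gam P j x) (curl (phi P (n1 P + k)) x)))"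
    unfolding mult_mat_vec_nth[OF X v j] by (intro sum.cong refl) (simp only: entry lessThan_iff mult.commute)
  also have "\<dots> = (\<Sum>k<n2 P. integral\<^sup>L (lebesgue_on (Om P)) (\<lambda>x. v $ k * inner (gam P j x) (curl (phi P (n1 P + k)) x)))"
    by simp
  also have "\<dots> = integral\<^sup>L (lebesgue_on (Om P)) (\<lambda>x. \<Sum>k<n2 P. v $ k * inner (gam P j x) (curl (phi P (n1 P + k)) x))"
    by (rule Bochner_Integration.integral_sum[symmetric], rule integrable_mult_right, rule L2_inner_integrable'[OF winding_L2(2)[OF j] curl_L2]) simp
  also have "\<dots> = 0"
  proof (rule integral_eq_zero_AE)
    have cf: "curl_field (ext v) x = (\<Sum>k<n2 P. (v $ k) *\<^sub>R curl (phi P (n1 P + k)) x)" for x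
    proof -
      have "(\<Sum>l<n1 P + n2 P. (ext v $ l) *\<^sub>R curl (phi P l) x) = (\<Sum>k<n2 P. (v $ k) *\<^sub>R curl (phi P (n1 P + k)) x)"
        unfolding sum_lessThan_add using v by simp
      then show ?thesis unfolding curl_field_def by (simp only: n12)
    qed
    show "AE x in lebesgue_on (Om P). (\<Sum>k<n2 P. v $ k * inner (gam P j x) (curl (phi P (n1 P + k)) x)) = 0"
      using 0 unfolding C2_kernel[OF v]
    proof (rule eventually_mono)
      fix x assume "curl_field (ext v) x = 0"
      then have "inner (gam P j x) (\<Sum>k<n2 P. (v $ k) *\<^sub>R curl (phi P (n1 P + k)) x) = 0" by (simp add: cf)
      then show "(\<Sum>k<n2 P. v $ k * inner (gam P j x) (curl (phi P (n1 P + k)) x)) = 0" by (simp add: inner_sum_right)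
    qed
  qed
  finally show "((X2 P)\<^sup>T *\<^sub>v v) $ j = 0\<^sub>v (ports P) $ j" using j by simp
qed (simp add: X2_def)

context
  fixes Yh :: rmat and d :: nat
  assumes Yh: "Yh \<in> carrier_mat (n2 P) d" "cols_basis (n2 P) Yh (mat_image (C2 P)\<^sup>T)"
begin

lemma C2_carrier: "C2 P \<in> carrier_mat (nf P) (n2 P)" and K22_carrier: "K22 P \<in> carrier_mat (n2 P) (n2 P)"
  and X2_carrier: "X2 P \<in> carrier_mat (n2 P) (ports P)"
  by (simp_all add: C2_def K22_def X2_def)

lemma Yh_image: "mat_image (C2 P)\<^sup>T = {Yh *\<^sub>v y | y. y \<in> carrier_vec d}"
  by (rule cols_basis_image[OF Yh])

text \<open>The columns of \<open>Yh\<close> span the orthogonal complement of the kernel of \<open>C\<^sub>2\<close>.\<close>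

lemma Yh_transpose_zero_imp:
  assumes q: "q \<in> carrier_vec (n2 P)" and 0: "Yh\<^sup>T *\<^sub>v q = 0\<^sub>v d"
  shows "C2 P *\<^sub>v q = 0\<^sub>v (nf P)"
proof (rule ccontr)
  let ?z = "C2 P *\<^sub>v q"
  assume "?z \<noteq> 0\<^sub>v (nf P)"
  have z: "?z \<in> carrier_vec (nf P)" using C2_carrier q by simp
  have "(C2 P)\<^sup>T *\<^sub>v ?z \<in> mat_image (C2 P)\<^sup>T" using z C2_carrier by (auto simp: mat_image_def)
  then obtain y where y: "y \<in> carrier_vec d" "(C2 P)\<^sup>T *\<^sub>v ?z = Yh *\<^sub>v y" unfolding Yh_image by blast
  have "?z \<bullet> ?z = ((C2 P)\<^sup>T *\<^sub>v ?z) \<bullet> q" using C2_carrier q by (simp add: adjoint_left)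
  also have "\<dots> = y \<bullet> (Yh\<^sup>T *\<^sub>v q)" unfolding y(2) using Yh(1) y(1) q by (simp add: adjoint_right)
  also have "\<dots> = 0" using y(1) by (simp add: 0)
  finally show False using scalar_prod_self_pos[OF z \<open>?z \<noteq> 0\<^sub>v (nf P)\<close>] by simp
qed

text \<open>If \<open>X\<^sub>2 w\<close> is orthogonal to the image of \<open>C\<^sub>2\<^sup>T\<close>, it lies in the kernel of \<open>C\<^sub>2\<close>, to which the columns
  of \<open>X\<^sub>2\<close> are orthogonal; hence \<open>X\<^sub>2 w = 0\<close>.\<close>

lemma gram_spd:
  assumes rank: "vec_space.rank (n2 P) (X2 P) = ports P"
  shows "spd (ports P) (gram P Yh)"
proof -
  let ?A = "Yh\<^sup>T * X2 P"
  have A: "?A \<in> carrier_mat d (ports P)" using Yh X2_carrier by simp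
  have XY: "(X2 P)\<^sup>T * Yh \<in> carrier_mat (ports P) d" using Yh(1) X2_carrier by simp
  have AT: "?A\<^sup>T = (X2 P)\<^sup>T * Yh" using Yh(1) X2_carrier by (subst transpose_mult_dim) auto
  have "gram P Yh = ((X2 P)\<^sup>T * Yh) * ?A"
    unfolding gram_def by (rule assoc_mult_mat[OF XY _ X2_carrier]) (use Yh(1) in simp)
  then have G: "gram P Yh = ?A\<^sup>T * 1\<^sub>m d * ?A" unfolding AT right_mult_one_mat[OF XY] .
  show ?thesis unfolding spd_def G
  proof (intro conjI ballI impI)
    show "(?A\<^sup>T * 1\<^sub>m d * ?A)\<^sup>T = ?A\<^sup>T * 1\<^sub>m d * ?A"
      by (rule symmetric_congruence[OF A]) auto
    show "?A\<^sup>T * 1\<^sub>m d * ?A \<in> carrier_mat (ports P) (ports P)"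
      by (rule mult_carrier_mat[OF mult_carrier_mat[OF _ one_carrier_mat] A]) (use A in simp)
    fix w :: rvec assume w: "w \<in> carrier_vec (ports P)" "w \<noteq> 0\<^sub>v (ports P)"
    have Aw: "?A *\<^sub>v w \<in> carrier_vec d" by (rule mult_mat_vec_carrier[OF A w(1)])
    have "?A *\<^sub>v w \<noteq> 0\<^sub>v d"
    proof
      assume 0: "?A *\<^sub>v w = 0\<^sub>v d"
      define q where "q = X2 P *\<^sub>v w"
      have q: "q \<in> carrier_vec (n2 P)" using X2_carrier w(1) by (simp add: q_def)
      have "?A *\<^sub>v w = Yh\<^sup>T *\<^sub>v q" unfolding q_def using Yh(1) X2_carrier w(1) by (intro mv_assoc) auto
      then have "(X2 P)\<^sup>T *\<^sub>v q = 0\<^sub>v (ports P)" using 0 by (intro X2_kernel q Yh_transpose_zero_imp) simp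
      then have "q \<bullet> q = 0" using adjoint_left[of q "X2 P" w] X2_carrier w(1) q by (simp add: q_def)
      then have "q = 0\<^sub>v (n2 P)" using scalar_prod_self_pos[OF q] by force
      then show False using full_column_rank_injective[OF X2_carrier rank w(1)] w(2) by (simp add: q_def)
    qed
    then have "0 < (?A *\<^sub>v w) \<bullet> (?A *\<^sub>v w)" using scalar_prod_self_pos[OF Aw] by blast
    then show "0 < w \<bullet> ((?A\<^sup>T * 1\<^sub>m d * ?A) *\<^sub>v w)"
      unfolding congruence_form[OF A one_carrier_mat w(1)] one_mult_mat_vec[OF Aw] .
  qed
qed

text \<open>The columns of \<open>Yh Y\<close> are independent and lie in the image of \<open>C\<^sub>2\<^sup>T\<close>, which meets the kernel of \<open>C\<^sub>2\<close>
  only in \<open>0\<close>.\<close>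

lemma stiffness_spd:
  assumes Y: "Y \<in> carrier_mat d e" "Y\<^sup>T * Y = 1\<^sub>m e"
  shows "spd e ((Yh * Y)\<^sup>T * K22 P * (Yh * Y))"
  unfolding spd_def
proof (intro conjI ballI impI)
  have A: "Yh * Y \<in> carrier_mat (n2 P) e" using Yh Y by simp
  show "((Yh * Y)\<^sup>T * K22 P * (Yh * Y))\<^sup>T = (Yh * Y)\<^sup>T * K22 P * (Yh * Y)"
    by (rule symmetric_congruence[OF A K22_carrier K22_sym])
  show "(Yh * Y)\<^sup>T * K22 P * (Yh * Y) \<in> carrier_mat e e"
    by (rule mult_carrier_mat[OF mult_carrier_mat[OF _ K22_carrier] A]) (use A in simp)
  fix y :: rvec assume y: "y \<in> carrier_vec e" "y \<noteq> 0\<^sub>v e"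
  let ?q = "(Yh * Y) *\<^sub>v y"
  have q: "?q \<in> carrier_vec (n2 P)" by (rule mult_mat_vec_carrier[OF A y(1)])
  have Yy: "Y *\<^sub>v y \<in> carrier_vec d" by (rule mult_mat_vec_carrier[OF Y(1) y(1)])
  have qy: "?q = Yh *\<^sub>v (Y *\<^sub>v y)" using Yh(1) Y(1) y(1) by (intro mv_assoc) auto
  have "?q \<bullet> (K22 P *\<^sub>v ?q) \<noteq> 0"
  proof
    assume "?q \<bullet> (K22 P *\<^sub>v ?q) = 0"
    then have C: "C2 P *\<^sub>v ?q = 0\<^sub>v (nf P)" by (rule K22_zero_imp[OF q])
    have "?q \<in> mat_image (C2 P)\<^sup>T" unfolding Yh_image qy using Yy by blast
    then obtain z where z: "z \<in> carrier_vec (nf P)" "?q = (C2 P)\<^sup>T *\<^sub>v z"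
      using C2_carrier by (auto simp: mat_image_def)
    have "((C2 P)\<^sup>T *\<^sub>v z) \<bullet> ?q = z \<bullet> (C2 P *\<^sub>v ?q)" using C2_carrier z(1) q Yh(1) by (intro adjoint_left) auto
    then have "?q \<bullet> ?q = 0" using z(1) by (simp only: C z(2)[symmetric] scalar_prod_right_zero)
    then have "?q = 0\<^sub>v (n2 P)" using scalar_prod_self_pos[OF q] by force
    then have "Y *\<^sub>v y = 0\<^sub>v d" unfolding qy by (rule cols_basis_injective[OF Yh Yy])
    moreover have "y = Y\<^sup>T *\<^sub>v (Y *\<^sub>v y)"
      using Y y(1) mv_assoc[of "Y\<^sup>T" Y y] by simp
    ultimately show False using y(2) Y(1) by simp
  qed
  with K22_nonneg[OF q] have "0 < ?q \<bullet> (K22 P *\<^sub>v ?q)" by linarith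
  then show "0 < y \<bullet> (((Yh * Y)\<^sup>T * K22 P * (Yh * Y)) *\<^sub>v y)"
    unfolding congruence_form[OF A K22_carrier y(1)] .
qed

end

end

theorem theorem11:
  fixes P :: mqs
    and Yh Y YC N U :: rmat
    and a0 a10 a21 a22 :: rvec
    and u a i :: "real \<Rightarrow> rvec"
    and T :: real and ts :: "real list" and r k2 :: nat
  assumes domain: "mqs_domain P"
    and material: "mqs_material P"
    and winding: "mqs_winding P"
    and fem: "mqs_fem P"
    and X2_rank: "vec_space.rank (n2 P) (X2 P) = ports P"
    and k2: "k2 = kernel_dim (C2 P)"
    and Yh: "Yh \<in> carrier_mat (n2 P) (n2 P - k2)" "cols_basis (n2 P) Yh (mat_image (C2 P)\<^sup>T)"
    and YC: "YC \<in> carrier_mat (n2 P) k2" "cols_basis (n2 P) YC (mat_kernel (C2 P))"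
    and Y: "Y \<in> carrier_mat (n2 P - k2) (n2 P - k2 - ports P)"
      "cols_basis (n2 P - k2) Y (mat_kernel ((X2 P)\<^sup>T * Yh))"
      "Y\<^sup>T * Y = 1\<^sub>m (n2 P - k2 - ports P)"
    and N: "inv_sqrt_mat (ports P) (gram P Yh) N"
    and a0: "a10 \<in> carrier_vec (n1 P)" "a21 \<in> carrier_vec (n2 P - k2)" "a22 \<in> carrier_vec k2"
      "a0 = a10 @\<^sub>v (Yh *\<^sub>v a21 + YC *\<^sub>v a22)"
    and solution: "T > 0" "semidiscrete_solution P a0 T u a i"
    and snapshots: "set ts \<subseteq> {0..T}"
    and pod: "leading_left_singular r (snapshot_matrix P a ts) U"
  shows "is_passive (pod_model P Yh Y N U a10 a21)"
proof -
  interpret mqs_problem P by (rule mqs_problem.intro[OF domain material winding fem])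
  have rows: "dim_row (snapshot_matrix P a ts) = n1 P" by (simp add: snapshot_matrix_def)
  interpret reduced_mqs P Yh Y N U "n2 P - k2" "n2 P - k2 - ports P" r energy
  proof (rule reduced_mqs.intro)
    show "spd (ports P) (Rmat P)" using material by (simp add: mqs_material_def)
    show "continuous_vec (n1 P) T (\<lambda>t. K11 P (f t) *\<^sub>v f t)" if "continuous_vec (n1 P) T f" for T f
      using that by (rule K11_continuous)
    show "energy a1 a2 - energy b1 b2 \<le> (K11 P a1 *\<^sub>v a1 + K12 P *\<^sub>v a2) \<bullet> (a1 - b1)
        + (K21 P *\<^sub>v a1 + K22 P *\<^sub>v a2) \<bullet> (a2 - b2)"
      if "a1 \<in> carrier_vec (n1 P)" "a2 \<in> carrier_vec (n2 P)" "b1 \<in> carrier_vec (n1 P)" "b2 \<in> carrier_vec (n2 P)"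
      for a1 a2 b1 b2
      using that by (rule energy_subgrad)
    show "0 \<le> energy a1 a2" for a1 a2 by (rule energy_nonneg)
  qed (fact Yh(1) Y(1) N M11_spd K12_transpose K22_sym
      leading_left_singular_orthonormal[OF pod, unfolded rows] gram_spd[OF Yh X2_rank] stiffness_spd[OF Yh Y(1,3)])+
  show ?thesis by (rule pod_model_passive)
qed

end
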